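(* Let $\mathsf V$ be the variety of all $\ell$-groups (respectively, the variety of representable $\ell$-groups, or the variety of Abelian $\ell$-groups). For any partially ordered group $G$, the minimal layer of $\mathscr{P}_{\mathsf V}(G)$ (the subspace of its inclusion-minimal elements) is a Stone space whose dual Boolean algebra is $\mathrm{Pol}_{\mathrm p}F_{\mathsf V}(G)$, the algebra of principal polars of $F_{\mathsf V}(G)$.
   Context: A partially ordered group is a group $G$ (identity $\mathrm{e}$) with a partial order such that $a\le b$ implies $sat\le sbt$; $G^+=\{a\mid a\ge \mathrm{e}\}$. An $\ell$-group is a partially ordered group whose order is a lattice; it is representable if it is a subdirect product of totally ordered groups, and Abelian if its group is Abelian. An $\ell$-subgroup is a sublattice subgroup. A right pre-order on $G$ is a reflexive, transitive, total relation $\preceq$ on $G$, with $\preceq\ne G\times G$, extending the partial order of $G$ and such that $a\preceq b\Rightarrow at\preceq bt$. It is identified with its pre-cone $C=\{a\mid \mathrm{e}\preceq a\}$; $a\preceq_C b$ iff $ba^{-1}\in C$. Put $a\equiv_C b$ iff $a\preceq_C b$ and $b\preceq_C a$; $\Omega_C=G/{\equiv_C}$ is a chain with $[a]\le_C[b]$ iff $a\preceq_C b$. $\mathrm{Aut}\,\Omega_C$ is the $\ell$-group of order-preserving bijections of $\Omega_C$, where $f\cdot g$ means "$g$ after $f$" and lattice operations are pointwise. With $R_C(a)\colon[b]\mapsto[ba]$, $H_C$ is the $\ell$-subgroup of $\mathrm{Aut}\,\Omega_C$ generated by $R_C[G]$. $\mathscr{P}_{\mathsf V}(G)$ is the set of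 right pre-orders (pre-cones) $C$ on $G$ with $H_C\in\mathsf V$, ordered by inclusion, with the smallest topology containing all sets $\{C\in\mathscr{P}_{\mathsf V}(G)\mid a\in C,\ a^{-1}\notin C\}$, $a\in G$. $F_{\mathsf V}(G)$, with order-preserving group homomorphism $\eta\colon G\to F_{\mathsf V}(G)$, is the free $\ell$-group over $G$ in $\mathsf V$: $F_{\mathsf V}(G)\in\mathsf V$ and for each order-preserving group homomorphism $p\colon G\to K$ with $K\in\mathsf V$ there is exactly one group and lattice homomorphism $h\colon F_{\mathsf V}(G)\to K$ with $h\circ\eta=p$. For an $\ell$-group $H$, $|x|=x\vee x^{-1}$; for $S\subseteq H$, $S^\perp=\{x\in H\mid |x|\wedge|y|=\mathrm{e}\text{ for all }y\in S\}$. The polars (sets $T$ with $T=T^{\perp\perp}$) form, under inclusion, a complete Boolean algebra $\mathrm{Pol}\,H$ with top $H$, bottom $\{\mathrm e\}$, meet intersection, join $(\bigcup T_i)^{\perp\perp}$ and complement $T\mapsto T^\perp$. $\mathrm{Pol}_{\mathrm p}H=\{x^{\perp\perp}\mid x\in H\}$ is the sublattice of principal polars; the assertion includes that $\mathrm{Pol}_{\mathrm p}F_{\mathsf V}(G)$ is a Boolean algebra. A Stone space is a compact Hausdorff zero-dimensional space; that its dual Boolean algebra is $B$ means that it is homeomorphic to the Stone space of prime ideals (equivalently ultrafilters) of $B$, equivalently that its algebra of clopen sets is isomorphic to $B$. *)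

theory Defs
  imports "HOL-Analysis.Analysis" "HOL-Algebra.Lattice" "HOL-Algebra.Bij"
begin

section \<open>Partially ordered groups and l-groups\<close>

record 'a po_group = "'a monoid" +
  po_le :: "'a \<Rightarrow> 'a \<Rightarrow> bool" (infix \<open>\<preceq>\<index>\<close> 50)

definition po_order :: "'a po_group \<Rightarrow> 'a gorder" where
  "po_order G = \<lparr>carrier = carrier G, eq = (=), le = po_le G\<rparr>"

definition po_group :: "'a po_group \<Rightarrow> bool" where
  "po_group G \<longleftrightarrow> group G \<and> partial_order (po_order G) \<and>
    (\<forall>a\<in>carrier G. \<forall>b\<in>carrier G. \<forall>s\<in>carrier G. \<forall>t\<in>carrier G.
      a \<preceq>\<^bsub>G\<^esub> b \<longrightarrow> s \<otimes>\<^bsub>G\<^esub> a \<otimes>\<^bsub>G\<^esub> t \<preceq>\<^bsub>G\<^esub> s \<otimes>\<^bsub>G\<^esub> b \<otimes>\<^bsub>G\<^esub> t)"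

definition po_hom :: "'a po_group \<Rightarrow> 'b po_group \<Rightarrow> ('a \<Rightarrow> 'b) set" where
  "po_hom G K = {p \<in> hom G K.
    \<forall>a\<in>carrier G. \<forall>b\<in>carrier G. a \<preceq>\<^bsub>G\<^esub> b \<longrightarrow> p a \<preceq>\<^bsub>K\<^esub> p b}"

definition l_group :: "'a po_group \<Rightarrow> bool" where
  "l_group H \<longleftrightarrow> po_group H \<and> lattice (po_order H)"

definition to_group :: "'a po_group \<Rightarrow> bool" where
  "to_group H \<longleftrightarrow> po_group H \<and> total_order (po_order H)"

definition ljoin :: "'a po_group \<Rightarrow> 'a \<Rightarrow> 'a \<Rightarrow> 'a" where
  "ljoin H x y = x \<squnion>\<^bsub>po_order H\<^esub> y"

definition lmeet :: "'a po_group \<Rightarrow> 'a \<Rightarrow> 'a \<Rightarrow> 'a" where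
  "lmeet H x y = x \<sqinter>\<^bsub>po_order H\<^esub> y"

definition l_hom :: "'a po_group \<Rightarrow> 'b po_group \<Rightarrow> ('a \<Rightarrow> 'b) set" where
  "l_hom H K = {h \<in> hom H K.
    \<forall>x\<in>carrier H. \<forall>y\<in>carrier H.
      h (ljoin H x y) = ljoin K (h x) (h y) \<and> h (lmeet H x y) = lmeet K (h x) (h y)}"

definition l_subgroup :: "'a set \<Rightarrow> 'a po_group \<Rightarrow> bool" where
  "l_subgroup S H \<longleftrightarrow> subgroup S H \<and>
    (\<forall>x\<in>S. \<forall>y\<in>S. ljoin H x y \<in> S \<and> lmeet H x y \<in> S)"

definition l_generated :: "'a po_group \<Rightarrow> 'a set \<Rightarrow> 'a po_group" where
  "l_generated H X = H\<lparr>carrier := \<Inter>{S. l_subgroup S H \<and> X \<subseteq> S}\<rparr>"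

text \<open>
  A subdirect product representation is given by its components: l-homomorphisms onto totally
  ordered groups that jointly separate points. As the components are images of \<open>H\<close>, and as
  at most as many of them as \<open>H\<close> has elements are needed to separate the points of \<open>H\<close>,
  taking the factors and the indices in \<open>'a set\<close> is no restriction.
\<close>

definition representable :: "'a po_group \<Rightarrow> bool" where
  "representable H \<longleftrightarrow> (\<exists>(I :: 'a set set) (T :: 'a set \<Rightarrow> 'a set po_group) \<phi>.
    (\<forall>i\<in>I. to_group (T i) \<and> \<phi> i \<in> l_hom H (T i) \<and> \<phi> i ` carrier H = carrier (T i)) \<and>
    (\<forall>x\<in>carrier H. \<forall>y\<in>carrier H. (\<forall>i\<in>I. \<phi> i x = \<phi> i y) \<longrightarrow> x = y))"

datatype lgroup_variety = All_LGroups | Representable_LGroups | Abelian_LGroups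

text \<open>
  The three varieties are named by a datatype, and not given as a predicate on l-groups,
  because membership has to be expressed for l-groups over different types.
\<close>

fun in_variety :: "'a po_group \<Rightarrow> lgroup_variety \<Rightarrow> bool" where
  "in_variety H All_LGroups \<longleftrightarrow> l_group H"
| "in_variety H Representable_LGroups \<longleftrightarrow> l_group H \<and> representable H"
| "in_variety H Abelian_LGroups \<longleftrightarrow> l_group H \<and> comm_group H"


section \<open>Right pre-orders\<close>

definition right_preorder :: "'g po_group \<Rightarrow> ('g \<times> 'g) set \<Rightarrow> bool" where
  "right_preorder G R \<longleftrightarrow>
    preorder_on (carrier G) R \<and> total_on (carrier G) R \<and> R \<noteq> carrier G \<times> carrier G \<and>
    (\<forall>a\<in>carrier G. \<forall>b\<in>carrier G. a \<preceq>\<^bsub>G\<^esub> b \<longrightarrow> (a, b) \<in> R) \<and>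
    (\<forall>a b. \<forall>t\<in>carrier G. (a, b) \<in> R \<longrightarrow> (a \<otimes>\<^bsub>G\<^esub> t, b \<otimes>\<^bsub>G\<^esub> t) \<in> R)"

definition pre_cone :: "'g po_group \<Rightarrow> ('g \<times> 'g) set \<Rightarrow> 'g set" where
  "pre_cone G R = {a \<in> carrier G. (\<one>\<^bsub>G\<^esub>, a) \<in> R}"

definition cone_rel :: "'g po_group \<Rightarrow> 'g set \<Rightarrow> ('g \<times> 'g) set" where
  "cone_rel G C = {(a, b). a \<in> carrier G \<and> b \<in> carrier G \<and> b \<otimes>\<^bsub>G\<^esub> inv\<^bsub>G\<^esub> a \<in> C}"

definition cone_equiv :: "'g po_group \<Rightarrow> 'g set \<Rightarrow> ('g \<times> 'g) set" where
  "cone_equiv G C = cone_rel G C \<inter> (cone_rel G C)\<inverse>"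

definition Omega :: "'g po_group \<Rightarrow> 'g set \<Rightarrow> 'g set set" where
  "Omega G C = carrier G // cone_equiv G C"

definition Omega_le :: "'g po_group \<Rightarrow> 'g set \<Rightarrow> 'g set \<Rightarrow> 'g set \<Rightarrow> bool" where
  "Omega_le G C X Y \<longleftrightarrow> (\<exists>a\<in>X. \<exists>b\<in>Y. (a, b) \<in> cone_rel G C)"

text \<open>
  The product \<open>f \<cdot> g\<close> is ``\<open>g\<close> after \<open>f\<close>'', opposite to the one of \<^const>\<open>BijGroup\<close>.
  The lattice operations, being determined by the pointwise order, are pointwise on a chain.
\<close>

definition chain_aut :: "'x set \<Rightarrow> ('x \<Rightarrow> 'x \<Rightarrow> bool) \<Rightarrow> ('x \<Rightarrow> 'x) po_group" where
  "chain_aut A r =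
    \<lparr>carrier = {f \<in> Bij A. \<forall>x\<in>A. \<forall>y\<in>A. r x y \<longrightarrow> r (f x) (f y)},
     mult = (\<lambda>f g. compose A g f),
     one = (\<lambda>x\<in>A. x),
     po_le = (\<lambda>f g. \<forall>x\<in>A. r (f x) (g x))\<rparr>"

text \<open>
  \<open>right_mult G C a\<close> sends the class of \<open>b\<close> to the class of \<open>b \<otimes> a\<close>: it maps \<open>X\<close> to
  the class of the elements \<open>b \<otimes> a\<close> with \<open>b \<in> X\<close>, all of which are equivalent.
\<close>

definition right_mult :: "'g po_group \<Rightarrow> 'g set \<Rightarrow> 'g \<Rightarrow> 'g set \<Rightarrow> 'g set" where
  "right_mult G C a = (\<lambda>X\<in>Omega G C. cone_equiv G C `` ((\<lambda>b. b \<otimes>\<^bsub>G\<^esub> a) ` X))"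

definition H_group :: "'g po_group \<Rightarrow> 'g set \<Rightarrow> ('g set \<Rightarrow> 'g set) po_group" where
  "H_group G C =
    l_generated (chain_aut (Omega G C) (Omega_le G C)) (right_mult G C ` carrier G)"

definition preorders :: "lgroup_variety \<Rightarrow> 'g po_group \<Rightarrow> 'g set set" where
  "preorders V G = {C. \<exists>R. right_preorder G R \<and> C = pre_cone G R \<and> in_variety (H_group G C) V}"

definition preorder_space :: "lgroup_variety \<Rightarrow> 'g po_group \<Rightarrow> 'g set topology" where
  "preorder_space V G = topology_generated_by
    (insert (preorders V G)
      {{C \<in> preorders V G. a \<in> C \<and> inv\<^bsub>G\<^esub> a \<notin> C} | a. a \<in> carrier G})"

definition minimal_layer :: "lgroup_variety \<Rightarrow> 'g po_group \<Rightarrow> 'g set topology" where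
  "minimal_layer V G = subtopology (preorder_space V G)
    {C \<in> preorders V G. \<forall>D\<in>preorders V G. D \<subseteq> C \<longrightarrow> D = C}"


section \<open>Free l-groups over a partially ordered group\<close>

text \<open>
  Quantification over all l-groups \<open>K\<close> in the universal property becomes quantification over
  those with carrier in \<open>('f + 'g) list\<close>. This type is infinite and contains copies of \<open>F\<close> and
  of \<open>G\<close>, hence of every l-group generated by an image of \<open>G\<close>, and this makes the property
  equivalent to the one for \<open>K\<close> over an arbitrary type. Indeed, for an order-preserving
  homomorphism \<open>p\<close> from \<open>G\<close> to any \<open>K\<close>, a factorization through \<open>F\<close> exists because it does
  for the l-subgroup generated by the image of \<open>p\<close>. It is unique because \<open>F\<close> is generated by
  the image of \<open>\<eta>\<close>: the homomorphism from \<open>F\<close> to the l-subgroup generated by this image that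
  extends \<open>\<eta>\<close>, viewed as a homomorphism from \<open>F\<close> to \<open>F\<close>, is the identity by uniqueness for
  (a copy of) \<open>F\<close>.

  Homomorphisms are taken to be extensional, so that uniqueness refers to the carrier of \<open>F\<close>.
\<close>

definition free_lgroup_over ::
  "lgroup_variety \<Rightarrow> 'g po_group \<Rightarrow> 'f po_group \<Rightarrow> ('g \<Rightarrow> 'f) \<Rightarrow> bool" where
  "free_lgroup_over V G F \<eta> \<longleftrightarrow> in_variety F V \<and> \<eta> \<in> po_hom G F \<and>
    (\<forall>K :: ('f + 'g) list po_group. in_variety K V \<longrightarrow>
      (\<forall>p\<in>po_hom G K. \<exists>!h. h \<in> extensional (carrier F) \<and> h \<in> l_hom F K \<and>
        (\<forall>a\<in>carrier G. h (\<eta> a) = p a)))"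


section \<open>Principal polars\<close>

definition labs :: "'a po_group \<Rightarrow> 'a \<Rightarrow> 'a" where
  "labs H x = ljoin H x (inv\<^bsub>H\<^esub> x)"

definition polar :: "'a po_group \<Rightarrow> 'a set \<Rightarrow> 'a set" where
  "polar H S = {x \<in> carrier H. \<forall>y\<in>S. lmeet H (labs H x) (labs H y) = \<one>\<^bsub>H\<^esub>}"

definition principal_polars :: "'a po_group \<Rightarrow> 'a set gorder" where
  "principal_polars H =
    \<lparr>carrier = {polar H (polar H {x}) | x. x \<in> carrier H}, eq = (=), le = (\<subseteq>)\<rparr>"


section \<open>Stone duality\<close>

definition boolean_lattice :: "'a gorder \<Rightarrow> bool" where
  "boolean_lattice L \<longleftrightarrow> bounded_lattice L \<and>
    (\<forall>x\<in>carrier L. \<forall>y\<in>carrier L. \<forall>z\<in>carrier L.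
      x \<sqinter>\<^bsub>L\<^esub> (y \<squnion>\<^bsub>L\<^esub> z) = (x \<sqinter>\<^bsub>L\<^esub> y) \<squnion>\<^bsub>L\<^esub> (x \<sqinter>\<^bsub>L\<^esub> z)) \<and>
    (\<forall>x\<in>carrier L. \<exists>y\<in>carrier L. x \<sqinter>\<^bsub>L\<^esub> y = \<bottom>\<^bsub>L\<^esub> \<and> x \<squnion>\<^bsub>L\<^esub> y = \<top>\<^bsub>L\<^esub>)"

definition lattice_prime_ideal :: "'a gorder \<Rightarrow> 'a set \<Rightarrow> bool" where
  "lattice_prime_ideal L P \<longleftrightarrow> P \<subseteq> carrier L \<and> P \<noteq> {} \<and> P \<noteq> carrier L \<and>
    (\<forall>x\<in>carrier L. \<forall>y\<in>P. x \<sqsubseteq>\<^bsub>L\<^esub> y \<longrightarrow> x \<in> P) \<and>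
    (\<forall>x\<in>P. \<forall>y\<in>P. x \<squnion>\<^bsub>L\<^esub> y \<in> P) \<and>
    (\<forall>x\<in>carrier L. \<forall>y\<in>carrier L. x \<sqinter>\<^bsub>L\<^esub> y \<in> P \<longrightarrow> x \<in> P \<or> y \<in> P)"

definition prime_ideal_space :: "'a gorder \<Rightarrow> 'a set topology" where
  "prime_ideal_space L = topology_generated_by
    (insert {P. lattice_prime_ideal L P}
      {{P. lattice_prime_ideal L P \<and> x \<notin> P} | x. x \<in> carrier L})"

definition stone_space :: "'x topology \<Rightarrow> bool" where
  "stone_space X \<longleftrightarrow> compact_space X \<and> Hausdorff_space X \<and> X dim_le 0"

end

(*
  Call a prime cone of an l-group H a submonoid D that contains the positive cone, is closed under
  meets and satisfies that x or x^-1 is in D for all x; D meets D^-1 in a prime l-subgroup. Membership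
  of H in V says that the prime cones adapted to V (all of them, the normal ones, those containing
  the commutators) intersect in the positive cone, and by compactness every prime cone of such an H
  then contains an adapted one. Hence the minimal elements of P_V(G) are the minimal proper adapted
  cones of G; by a lexicographic construction these are the adapted C for which C and C^-1 intersect
  in the intersection K of all proper adapted cones. This condition is closed in the power set of G,
  so the minimal layer M is compact. Each C in M extends, through F -> H_C, to a unique prime cone
  of F, and an element of F that is in all of these is positive. So the support of x in F, the set
  of C in M at which x is nontrivial, determines x^{perp perp}; the supports separate points and form
  a field of clopen sets, because the complement in M of a basic open set is basic open or all of M.
*)
theory Submission
  imports Defs
begin

section \<open>Lattice-ordered groups\<close>

text \<open>In the representable case a pre-cone C with H_C in V need not be adapted: H_C may be
  representable although C is not normal. Moreover "H_C lies in V" speaks of a group that varies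
  with C and is no condition on finitely many elements of G at a time, so limits and intersections
  of pre-cones cannot be controlled through it. Adaptedness is such a condition, and it is inherited
  by inverse images under homomorphisms. All arguments about minimal elements and compactness are
  therefore made for adapted cones; H_C serves to find an adapted cone below a given pre-cone and to
  extend pre-cones to F.

  The passage to F rests on two facts. The image of G is a subgroup, so F is generated by it with
  lattice operations alone; and a prime cone turns joins into disjunctions and meets into
  conjunctions. Hence inclusions between prime cones of F can be checked on the image of G.\<close>

locale po_grp =
  fixes G :: "'a po_group" (structure)
  assumes po_group: "po_group G"

sublocale po_grp \<subseteq> group G
  using po_group by (simp add: po_group_def)

context po_grp
begin

lemma partial_order_po_order: "partial_order (po_order G)"
  using po_group by (simp add: po_group_def)

lemma po_refl [simp, intro]: "x \<in> carrier G \<Longrightarrow> x \<preceq> x"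
  using weak_partial_order.le_refl[OF partial_order.axioms(1)[OF partial_order_po_order], of x]
  by (simp add: po_order_def)

lemma po_trans [trans]:
  "\<lbrakk>x \<preceq> y; y \<preceq> z; x \<in> carrier G; y \<in> carrier G; z \<in> carrier G\<rbrakk> \<Longrightarrow> x \<preceq> z"
  using weak_partial_order.le_trans[OF partial_order.axioms(1)[OF partial_order_po_order], of x y z]
  by (simp add: po_order_def)

lemma po_antisym: "\<lbrakk>x \<preceq> y; y \<preceq> x; x \<in> carrier G; y \<in> carrier G\<rbrakk> \<Longrightarrow> x = y"
  using partial_order.le_antisym[OF partial_order_po_order, of x y] by (simp add: po_order_def)

lemma po_mult_lr:
  "\<lbrakk>a \<preceq> b; a \<in> carrier G; b \<in> carrier G; s \<in> carrier G; t \<in> carrier G\<rbrakk>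
    \<Longrightarrow> s \<otimes> a \<otimes> t \<preceq> s \<otimes> b \<otimes> t"
  using po_group by (simp add: po_group_def)

lemma po_mult_right:
  "\<lbrakk>a \<preceq> b; a \<in> carrier G; b \<in> carrier G; t \<in> carrier G\<rbrakk> \<Longrightarrow> a \<otimes> t \<preceq> b \<otimes> t"
  using po_mult_lr[of a b \<one> t] by simp

lemma po_mult_left:
  "\<lbrakk>a \<preceq> b; a \<in> carrier G; b \<in> carrier G; s \<in> carrier G\<rbrakk> \<Longrightarrow> s \<otimes> a \<preceq> s \<otimes> b"
  using po_mult_lr[of a b s \<one>] by simp

lemma po_mult_mono:
  "\<lbrakk>a \<preceq> b; c \<preceq> d; a \<in> carrier G; b \<in> carrier G; c \<in> carrier G; d \<in> carrier G\<rbrakk>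
    \<Longrightarrow> a \<otimes> c \<preceq> b \<otimes> d"
  by (meson po_mult_left po_mult_right po_trans m_closed)

lemma mult_inv_cancel:
  assumes "x \<in> carrier G" "y \<in> carrier G"
  shows "x \<otimes> inv y \<otimes> y = x" "x \<otimes> y \<otimes> inv y = x"
    "inv y \<otimes> (y \<otimes> x) = x" "y \<otimes> (inv y \<otimes> x) = x"
  using assms by (simp_all add: m_assoc) (simp_all add: m_assoc[symmetric])

lemma po_right_cancel:
  assumes "a \<in> carrier G" "b \<in> carrier G" "t \<in> carrier G"
  shows "a \<otimes> t \<preceq> b \<otimes> t \<longleftrightarrow> a \<preceq> b"
proof
  assume "a \<otimes> t \<preceq> b \<otimes> t"
  from po_mult_right[OF this, of "inv t"] show "a \<preceq> b"
    using assms by (simp add: mult_inv_cancel)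
qed (use assms po_mult_right in blast)

lemma po_left_cancel:
  assumes "a \<in> carrier G" "b \<in> carrier G" "t \<in> carrier G"
  shows "t \<otimes> a \<preceq> t \<otimes> b \<longleftrightarrow> a \<preceq> b"
proof
  assume "t \<otimes> a \<preceq> t \<otimes> b"
  from po_mult_left[OF this, of "inv t"] show "a \<preceq> b"
    using assms by (simp add: mult_inv_cancel)
qed (use assms po_mult_left in blast)

lemma po_iff_one_le:
  "\<lbrakk>a \<in> carrier G; b \<in> carrier G\<rbrakk> \<Longrightarrow> a \<preceq> b \<longleftrightarrow> \<one> \<preceq> b \<otimes> inv a"
  using po_right_cancel[of \<one> "b \<otimes> inv a" a] by (simp add: mult_inv_cancel)

lemma po_inv:
  assumes "a \<in> carrier G" "b \<in> carrier G"
  shows "inv a \<preceq> inv b \<longleftrightarrow> b \<preceq> a"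
proof -
  have "inv a \<preceq> inv b \<longleftrightarrow> a \<otimes> inv a \<preceq> a \<otimes> inv b"
    using assms po_left_cancel[of "inv a" "inv b" a] by simp
  also have "\<dots> \<longleftrightarrow> b \<preceq> a"
    using assms po_iff_one_le[of b a] by simp
  finally show ?thesis .
qed

lemma po_inv_le_iff: "\<lbrakk>a \<in> carrier G; b \<in> carrier G\<rbrakk> \<Longrightarrow> inv a \<preceq> b \<longleftrightarrow> inv b \<preceq> a"
  using po_inv[of a "inv b"] by simp

lemma po_le_inv_iff: "\<lbrakk>a \<in> carrier G; b \<in> carrier G\<rbrakk> \<Longrightarrow> a \<preceq> inv b \<longleftrightarrow> b \<preceq> inv a"
  using po_inv[of "inv a" b] by simp

end

lemma po_groupI:
  assumes "group G"
    and refl: "\<And>x. x \<in> carrier G \<Longrightarrow> x \<preceq>\<^bsub>G\<^esub> x"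
    and antisym: "\<And>x y. \<lbrakk>x \<preceq>\<^bsub>G\<^esub> y; y \<preceq>\<^bsub>G\<^esub> x; x \<in> carrier G; y \<in> carrier G\<rbrakk> \<Longrightarrow> x = y"
    and trans: "\<And>x y z. \<lbrakk>x \<preceq>\<^bsub>G\<^esub> y; y \<preceq>\<^bsub>G\<^esub> z; x \<in> carrier G; y \<in> carrier G; z \<in> carrier G\<rbrakk>
      \<Longrightarrow> x \<preceq>\<^bsub>G\<^esub> z"
    and mult: "\<And>a b s t. \<lbrakk>a \<preceq>\<^bsub>G\<^esub> b; a \<in> carrier G; b \<in> carrier G; s \<in> carrier G; t \<in> carrier G\<rbrakk>
      \<Longrightarrow> s \<otimes>\<^bsub>G\<^esub> a \<otimes>\<^bsub>G\<^esub> t \<preceq>\<^bsub>G\<^esub> s \<otimes>\<^bsub>G\<^esub> b \<otimes>\<^bsub>G\<^esub> t"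
  shows "po_group G"
proof -
  have "partial_order (po_order G)"
    by standard (auto simp: po_order_def intro: refl antisym trans)
  then show ?thesis
    using assms by (auto simp: po_group_def)
qed

lemma l_groupI:
  assumes "po_group G"
    and join: "\<And>x y. \<lbrakk>x \<in> carrier G; y \<in> carrier G\<rbrakk> \<Longrightarrow> \<exists>s\<in>carrier G. x \<preceq>\<^bsub>G\<^esub> s \<and> y \<preceq>\<^bsub>G\<^esub> s \<and>
      (\<forall>z\<in>carrier G. x \<preceq>\<^bsub>G\<^esub> z \<longrightarrow> y \<preceq>\<^bsub>G\<^esub> z \<longrightarrow> s \<preceq>\<^bsub>G\<^esub> z)"
    and meet: "\<And>x y. \<lbrakk>x \<in> carrier G; y \<in> carrier G\<rbrakk> \<Longrightarrow> \<exists>s\<in>carrier G. s \<preceq>\<^bsub>G\<^esub> x \<and> s \<preceq>\<^bsub>G\<^esub> y \<and>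
      (\<forall>z\<in>carrier G. z \<preceq>\<^bsub>G\<^esub> x \<longrightarrow> z \<preceq>\<^bsub>G\<^esub> y \<longrightarrow> z \<preceq>\<^bsub>G\<^esub> s)"
  shows "l_group G"
proof -
  interpret P: partial_order "po_order G"
    using assms(1) by (simp add: po_group_def)
  have "lattice (po_order G)"
  proof
    fix x y assume "x \<in> carrier (po_order G)" "y \<in> carrier (po_order G)"
    then show "\<exists>s. least (po_order G) s (Upper (po_order G) {x, y})"
      "\<exists>s. greatest (po_order G) s (Lower (po_order G) {x, y})"
      using join[of x y] meet[of x y]
      by (auto simp: po_order_def least_def greatest_def Upper_def Lower_def)
  qed
  then show ?thesis
    using assms(1) by (simp add: l_group_def)
qed

locale lgrp =
  fixes H :: "'a po_group" (structure)
  assumes l_group: "l_group H"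

sublocale lgrp \<subseteq> po_grp H
  using l_group by unfold_locales (simp add: l_group_def)

context lgrp
begin

abbreviation jn (infixl \<open>\<curlyvee>\<close> 65) where "x \<curlyvee> y \<equiv> ljoin H x y"
abbreviation mt (infixl \<open>\<curlywedge>\<close> 65) where "x \<curlywedge> y \<equiv> lmeet H x y"

lemma lattice_po_order: "lattice (po_order H)"
  using l_group by (simp add: l_group_def)

interpretation L: lattice "po_order H"
  by (rule lattice_po_order)

lemma carrier_po_order: "carrier (po_order H) = carrier H"
  and le_po_order: "le (po_order H) = po_le H"
  by (simp_all add: po_order_def)

lemma join_closed [simp]: "\<lbrakk>x \<in> carrier H; y \<in> carrier H\<rbrakk> \<Longrightarrow> x \<curlyvee> y \<in> carrier H"
  and join_ub1: "\<lbrakk>x \<in> carrier H; y \<in> carrier H\<rbrakk> \<Longrightarrow> x \<preceq> x \<curlyvee> y"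
  and join_ub2: "\<lbrakk>x \<in> carrier H; y \<in> carrier H\<rbrakk> \<Longrightarrow> y \<preceq> x \<curlyvee> y"
  and join_least: "\<lbrakk>x \<preceq> z; y \<preceq> z; x \<in> carrier H; y \<in> carrier H; z \<in> carrier H\<rbrakk> \<Longrightarrow> x \<curlyvee> y \<preceq> z"
  using L.join_closed[of x y] L.join_left[of x y] L.join_right[of x y] L.join_le[of x z y]
  by (simp_all add: ljoin_def carrier_po_order le_po_order)

lemma meet_closed [simp]: "\<lbrakk>x \<in> carrier H; y \<in> carrier H\<rbrakk> \<Longrightarrow> x \<curlywedge> y \<in> carrier H"
  and meet_lb1: "\<lbrakk>x \<in> carrier H; y \<in> carrier H\<rbrakk> \<Longrightarrow> x \<curlywedge> y \<preceq> x"
  and meet_lb2: "\<lbrakk>x \<in> carrier H; y \<in> carrier H\<rbrakk> \<Longrightarrow> x \<curlywedge> y \<preceq> y"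
  and meet_greatest:
    "\<lbrakk>z \<preceq> x; z \<preceq> y; x \<in> carrier H; y \<in> carrier H; z \<in> carrier H\<rbrakk> \<Longrightarrow> z \<preceq> x \<curlywedge> y"
  using L.meet_closed[of x y] L.meet_left[of x y] L.meet_right[of x y] L.meet_le[of z x y]
  by (simp_all add: lmeet_def carrier_po_order le_po_order)

lemma join_eqI:
  assumes "x \<in> carrier H" "y \<in> carrier H" "s \<in> carrier H" "x \<preceq> s" "y \<preceq> s"
    and "\<And>z. \<lbrakk>z \<in> carrier H; x \<preceq> z; y \<preceq> z\<rbrakk> \<Longrightarrow> s \<preceq> z"
  shows "x \<curlyvee> y = s"
  using assms by (intro po_antisym join_least) (simp_all add: join_ub1 join_ub2)

lemma meet_eqI:
  assumes "x \<in> carrier H" "y \<in> carrier H" "s \<in> carrier H" "s \<preceq> x" "s \<preceq> y"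
    and "\<And>z. \<lbrakk>z \<in> carrier H; z \<preceq> x; z \<preceq> y\<rbrakk> \<Longrightarrow> z \<preceq> s"
  shows "x \<curlywedge> y = s"
  using assms by (intro po_antisym meet_greatest) (simp_all add: meet_lb1 meet_lb2)

lemma join_absorb: "\<lbrakk>x \<preceq> y; x \<in> carrier H; y \<in> carrier H\<rbrakk> \<Longrightarrow> x \<curlyvee> y = y"
  and join_absorb2: "\<lbrakk>y \<preceq> x; x \<in> carrier H; y \<in> carrier H\<rbrakk> \<Longrightarrow> x \<curlyvee> y = x"
  by (rule join_eqI; simp)+

lemma meet_absorb: "\<lbrakk>x \<preceq> y; x \<in> carrier H; y \<in> carrier H\<rbrakk> \<Longrightarrow> x \<curlywedge> y = x"
  and meet_absorb2: "\<lbrakk>y \<preceq> x; x \<in> carrier H; y \<in> carrier H\<rbrakk> \<Longrightarrow> x \<curlywedge> y = y"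
  by (rule meet_eqI; simp)+

lemma le_iff_meet: "\<lbrakk>x \<in> carrier H; y \<in> carrier H\<rbrakk> \<Longrightarrow> x \<preceq> y \<longleftrightarrow> x \<curlywedge> y = x"
  using meet_absorb meet_lb2 by metis

lemma join_comm: "\<lbrakk>x \<in> carrier H; y \<in> carrier H\<rbrakk> \<Longrightarrow> x \<curlyvee> y = y \<curlyvee> x"
  by (rule join_eqI) (auto intro: join_ub1 join_ub2 join_least)

lemma meet_comm: "\<lbrakk>x \<in> carrier H; y \<in> carrier H\<rbrakk> \<Longrightarrow> x \<curlywedge> y = y \<curlywedge> x"
  by (rule meet_eqI) (auto intro: meet_lb1 meet_lb2 meet_greatest)

lemma mult_right_le: "\<lbrakk>a \<in> carrier H; b \<in> carrier H; t \<in> carrier H\<rbrakk> \<Longrightarrow> a \<otimes> t \<preceq> b \<longleftrightarrow> a \<preceq> b \<otimes> inv t"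
  using po_right_cancel[of a "b \<otimes> inv t" t] by (simp add: mult_inv_cancel)

lemma le_mult_right: "\<lbrakk>a \<in> carrier H; b \<in> carrier H; t \<in> carrier H\<rbrakk> \<Longrightarrow> a \<preceq> b \<otimes> t \<longleftrightarrow> a \<otimes> inv t \<preceq> b"
  using po_right_cancel[of "a \<otimes> inv t" b t] by (simp add: mult_inv_cancel)

lemma mult_left_le: "\<lbrakk>a \<in> carrier H; b \<in> carrier H; t \<in> carrier H\<rbrakk> \<Longrightarrow> t \<otimes> a \<preceq> b \<longleftrightarrow> a \<preceq> inv t \<otimes> b"
  using po_left_cancel[of a "inv t \<otimes> b" t] by (simp add: mult_inv_cancel)

lemma le_mult_left: "\<lbrakk>a \<in> carrier H; b \<in> carrier H; t \<in> carrier H\<rbrakk> \<Longrightarrow> a \<preceq> t \<otimes> b \<longleftrightarrow> inv t \<otimes> a \<preceq> b"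
  using po_left_cancel[of "inv t \<otimes> a" b t] by (simp add: mult_inv_cancel)

lemma join_mult:
  assumes "x \<in> carrier H" "y \<in> carrier H" "z \<in> carrier H"
  shows "(x \<curlyvee> y) \<otimes> z = (x \<otimes> z) \<curlyvee> (y \<otimes> z)"
  by (rule join_eqI[symmetric])
    (use assms in \<open>auto simp: mult_inv_cancel mult_right_le po_right_cancel intro: join_ub1 join_ub2 join_least\<close>)

lemma mult_join:
  assumes "x \<in> carrier H" "y \<in> carrier H" "z \<in> carrier H"
  shows "z \<otimes> (x \<curlyvee> y) = (z \<otimes> x) \<curlyvee> (z \<otimes> y)"
  by (rule join_eqI[symmetric])
    (use assms in \<open>auto simp: mult_inv_cancel mult_left_le po_left_cancel intro: join_ub1 join_ub2 join_least\<close>)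

lemma meet_mult:
  assumes "x \<in> carrier H" "y \<in> carrier H" "z \<in> carrier H"
  shows "(x \<curlywedge> y) \<otimes> z = (x \<otimes> z) \<curlywedge> (y \<otimes> z)"
  by (rule meet_eqI[symmetric])
    (use assms in \<open>auto simp: mult_inv_cancel le_mult_right po_right_cancel intro: meet_lb1 meet_lb2 meet_greatest\<close>)

lemma mult_meet:
  assumes "x \<in> carrier H" "y \<in> carrier H" "z \<in> carrier H"
  shows "z \<otimes> (x \<curlywedge> y) = (z \<otimes> x) \<curlywedge> (z \<otimes> y)"
  by (rule meet_eqI[symmetric])
    (use assms in \<open>auto simp: mult_inv_cancel le_mult_left po_left_cancel intro: meet_lb1 meet_lb2 meet_greatest\<close>)

lemma inv_join:
  assumes "x \<in> carrier H" "y \<in> carrier H"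
  shows "inv (x \<curlyvee> y) = inv x \<curlywedge> inv y"
proof (rule meet_eqI[symmetric])
  fix z assume z: "z \<in> carrier H" "z \<preceq> inv x" "z \<preceq> inv y"
  then have "x \<preceq> inv z" "y \<preceq> inv z"
    using po_le_inv_iff assms by blast+
  then have "x \<curlyvee> y \<preceq> inv z"
    using join_least assms z by simp
  then show "z \<preceq> inv (x \<curlyvee> y)"
    using po_le_inv_iff assms z by simp
qed (use assms in \<open>simp_all add: po_inv join_ub1 join_ub2\<close>)

lemma inv_meet:
  assumes "x \<in> carrier H" "y \<in> carrier H"
  shows "inv (x \<curlywedge> y) = inv x \<curlyvee> inv y"
  using inv_join[of "inv x" "inv y"] assms by (metis inv_inv inv_closed join_closed)

lemma l_subgroupD:
  assumes "l_subgroup S H"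
  shows "S \<subseteq> carrier H" "\<one> \<in> S" "\<And>x y. \<lbrakk>x \<in> S; y \<in> S\<rbrakk> \<Longrightarrow> x \<otimes> y \<in> S"
    "\<And>x. x \<in> S \<Longrightarrow> inv x \<in> S" "\<And>x y. \<lbrakk>x \<in> S; y \<in> S\<rbrakk> \<Longrightarrow> x \<curlyvee> y \<in> S"
    "\<And>x y. \<lbrakk>x \<in> S; y \<in> S\<rbrakk> \<Longrightarrow> x \<curlywedge> y \<in> S"
  using assms by (auto simp: l_subgroup_def subgroup_def)

lemma l_subgroup_carrier: "l_subgroup (carrier H) H"
  by (simp add: l_subgroup_def subgroup_self)

lemma l_subgroup_l_group:
  assumes S: "l_subgroup S H"
  shows "l_group (H\<lparr>carrier := S\<rparr>)"
    and "\<And>x y. \<lbrakk>x \<in> S; y \<in> S\<rbrakk> \<Longrightarrow> ljoin (H\<lparr>carrier := S\<rparr>) x y = x \<curlyvee> y"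
    and "\<And>x y. \<lbrakk>x \<in> S; y \<in> S\<rbrakk> \<Longrightarrow> lmeet (H\<lparr>carrier := S\<rparr>) x y = x \<curlywedge> y"
    and "\<And>x. x \<in> S \<Longrightarrow> inv\<^bsub>H\<lparr>carrier := S\<rparr>\<^esub> x = inv x"
proof -
  let ?S = "H\<lparr>carrier := S\<rparr>"
  note SD = l_subgroupD[OF S]
  have sub: "subgroup S H" using S by (simp add: l_subgroup_def)
  have cl: "x \<in> carrier H" if "x \<in> S" for x using that SD(1) by blast
  have po: "po_group ?S"
    by (rule po_groupI)
      (use cl in \<open>simp_all add: subgroup_imp_group[OF sub] po_mult_lr\<close>,
        (blast intro: po_antisym po_trans)+)
  show "l_group ?S"
  proof (rule l_groupI[OF po])
    fix x y assume xy: "x \<in> carrier ?S" "y \<in> carrier ?S"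
    show "\<exists>s\<in>carrier ?S. x \<preceq>\<^bsub>?S\<^esub> s \<and> y \<preceq>\<^bsub>?S\<^esub> s \<and>
        (\<forall>z\<in>carrier ?S. x \<preceq>\<^bsub>?S\<^esub> z \<longrightarrow> y \<preceq>\<^bsub>?S\<^esub> z \<longrightarrow> s \<preceq>\<^bsub>?S\<^esub> z)"
      by (rule bexI[of _ "x \<curlyvee> y"])
        (use xy SD(5,6) in \<open>auto intro: join_ub1 join_ub2 join_least cl\<close>)
    show "\<exists>s\<in>carrier ?S. s \<preceq>\<^bsub>?S\<^esub> x \<and> s \<preceq>\<^bsub>?S\<^esub> y \<and>
        (\<forall>z\<in>carrier ?S. z \<preceq>\<^bsub>?S\<^esub> x \<longrightarrow> z \<preceq>\<^bsub>?S\<^esub> y \<longrightarrow> z \<preceq>\<^bsub>?S\<^esub> s)"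
      by (rule bexI[of _ "x \<curlywedge> y"])
        (use xy SD(5,6) in \<open>auto intro: meet_lb1 meet_lb2 meet_greatest cl\<close>)
  qed
  then interpret K: lgrp ?S by unfold_locales
  show "ljoin ?S x y = x \<curlyvee> y" if "x \<in> S" "y \<in> S" for x y
    by (rule K.join_eqI)
      (use that SD(5,6) in \<open>auto intro: join_ub1 join_ub2 join_least cl\<close>)
  show "lmeet ?S x y = x \<curlywedge> y" if "x \<in> S" "y \<in> S" for x y
    by (rule K.meet_eqI)
      (use that SD(5,6) in \<open>auto intro: meet_lb1 meet_lb2 meet_greatest cl\<close>)
  show "inv\<^bsub>?S\<^esub> x = inv x" if "x \<in> S" for x
    using m_inv_consistent[OF sub that] .
qed

end

text \<open>For a subgroup \<open>X\<close> this sublattice is already an l-subgroup, because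
  products and inverses distribute over joins and meets.\<close>

inductive_set lattice_closure :: "'a po_group \<Rightarrow> 'a set \<Rightarrow> 'a set" for H X where
  gen: "x \<in> X \<Longrightarrow> x \<in> lattice_closure H X"
| join: "\<lbrakk>x \<in> lattice_closure H X; y \<in> lattice_closure H X\<rbrakk> \<Longrightarrow> ljoin H x y \<in> lattice_closure H X"
| meet: "\<lbrakk>x \<in> lattice_closure H X; y \<in> lattice_closure H X\<rbrakk> \<Longrightarrow> lmeet H x y \<in> lattice_closure H X"

context lgrp
begin

lemma lattice_closure_least:
  "\<lbrakk>l_subgroup S H; X \<subseteq> S\<rbrakk> \<Longrightarrow> lattice_closure H X \<subseteq> S"
proof
  fix x assume S: "l_subgroup S H" "X \<subseteq> S" and "x \<in> lattice_closure H X"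
  from this(3) show "x \<in> S"
    by induct (use S l_subgroupD[OF S(1)] in auto)
qed

lemma l_subgroup_lattice_closure:
  assumes X: "subgroup X H"
  shows "l_subgroup (lattice_closure H X) H"
proof -
  let ?L = "lattice_closure H X"
  have sub: "?L \<subseteq> carrier H"
    using lattice_closure_least[OF l_subgroup_carrier] subgroup.subset[OF X] by simp
  \<comment> \<open>Products are treated one factor at a time: here the left factor is a generator
    and the induction is on the right one; below the induction is on the left factor.\<close>
  have 1: "a \<otimes> y \<in> ?L" if "a \<in> X" "y \<in> ?L" for a y
    using that(2)
  proof induct
    case (gen y)
    then show ?case using subgroup.m_closed[OF X] that(1) by (blast intro: lattice_closure.gen)
  next
    case (join x y)
    then have "a \<otimes> (x \<curlyvee> y) = (a \<otimes> x) \<curlyvee> (a \<otimes> y)"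
      by (intro mult_join) (use sub that(1) subgroup.subset[OF X] in auto)
    then show ?case using join by (simp add: lattice_closure.join)
  next
    case (meet x y)
    then have "a \<otimes> (x \<curlywedge> y) = (a \<otimes> x) \<curlywedge> (a \<otimes> y)"
      by (intro mult_meet) (use sub that(1) subgroup.subset[OF X] in auto)
    then show ?case using meet by (simp add: lattice_closure.meet)
  qed
  have 2: "x \<otimes> y \<in> ?L" if "x \<in> ?L" "y \<in> ?L" for x y
    using that(1)
  proof induct
    case (join x z)
    then have "(x \<curlyvee> z) \<otimes> y = (x \<otimes> y) \<curlyvee> (z \<otimes> y)"
      by (intro join_mult) (use sub that(2) in auto)
    then show ?case using join by (simp add: lattice_closure.join)
  next
    case (meet x z)
    then have "(x \<curlywedge> z) \<otimes> y = (x \<otimes> y) \<curlywedge> (z \<otimes> y)"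
      by (intro meet_mult) (use sub that(2) in auto)
    then show ?case using meet by (simp add: lattice_closure.meet)
  qed (use 1 that in blast)
  have 3: "inv x \<in> ?L" if "x \<in> ?L" for x
    using that
  proof induct
    case (gen x)
    then show ?case using subgroup.m_inv_closed[OF X] by (blast intro: lattice_closure.gen)
  next
    case (join x y)
    then have "inv (x \<curlyvee> y) = inv x \<curlywedge> inv y"
      by (intro inv_join) (use sub in auto)
    then show ?case using join by (simp add: lattice_closure.meet)
  next
    case (meet x y)
    then have "inv (x \<curlywedge> y) = inv x \<curlyvee> inv y"
      by (intro inv_meet) (use sub in auto)
    then show ?case using meet by (simp add: lattice_closure.join)
  qed
  have "\<one> \<in> ?L" using subgroup.one_closed[OF X] by (rule lattice_closure.gen)
  then have "subgroup ?L H"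
    using 2 3 sub by (intro subgroupI) auto
  then show ?thesis
    by (auto simp: l_subgroup_def intro: lattice_closure.intros)
qed

lemma l_generated_subgroup:
  assumes X: "subgroup X H"
  shows "l_generated H X = H\<lparr>carrier := lattice_closure H X\<rparr>"
proof -
  have "\<Inter>{S. l_subgroup S H \<and> X \<subseteq> S} = lattice_closure H X"
    using l_subgroup_lattice_closure[OF X] lattice_closure_least
    by (intro antisym Inter_lower Inter_greatest) (auto intro: lattice_closure.gen)
  then show ?thesis by (simp add: l_generated_def)
qed

end

lemma l_homD:
  assumes "h \<in> l_hom H K"
  shows "h \<in> hom H K" "\<And>x. x \<in> carrier H \<Longrightarrow> h x \<in> carrier K"
    "\<And>x y. \<lbrakk>x \<in> carrier H; y \<in> carrier H\<rbrakk> \<Longrightarrow> h (x \<otimes>\<^bsub>H\<^esub> y) = h x \<otimes>\<^bsub>K\<^esub> h y"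
    "\<And>x y. \<lbrakk>x \<in> carrier H; y \<in> carrier H\<rbrakk> \<Longrightarrow> h (ljoin H x y) = ljoin K (h x) (h y)"
    "\<And>x y. \<lbrakk>x \<in> carrier H; y \<in> carrier H\<rbrakk> \<Longrightarrow> h (lmeet H x y) = lmeet K (h x) (h y)"
  using assms by (auto simp: l_hom_def hom_def)

locale lgrp_hom = H: lgrp H + K: lgrp K for H :: "'a po_group" and K :: "'b po_group" +
  fixes h
  assumes h: "h \<in> l_hom H K"

sublocale lgrp_hom \<subseteq> group_hom H K h
  using l_homD(1)[OF h] by unfold_locales

context lgrp_hom
begin

lemma hom_join: "\<lbrakk>x \<in> carrier H; y \<in> carrier H\<rbrakk> \<Longrightarrow> h (ljoin H x y) = ljoin K (h x) (h y)"
  and hom_meet: "\<lbrakk>x \<in> carrier H; y \<in> carrier H\<rbrakk> \<Longrightarrow> h (lmeet H x y) = lmeet K (h x) (h y)"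
  using l_homD[OF h] by auto

lemma hom_mono: "\<lbrakk>x \<preceq>\<^bsub>H\<^esub> y; x \<in> carrier H; y \<in> carrier H\<rbrakk> \<Longrightarrow> h x \<preceq>\<^bsub>K\<^esub> h y"
  using hom_meet[of x y] H.meet_absorb[of x y] K.le_iff_meet[of "h x" "h y"] by simp

lemma hom_le_iff:
  assumes "inj_on h (carrier H)" "x \<in> carrier H" "y \<in> carrier H"
  shows "h x \<preceq>\<^bsub>K\<^esub> h y \<longleftrightarrow> x \<preceq>\<^bsub>H\<^esub> y"
  using assms hom_meet[of x y] H.le_iff_meet[of x y] K.le_iff_meet[of "h x" "h y"]
  by (metis H.meet_closed hom_closed inj_onD)

end

section \<open>Cones and quotients\<close>

text \<open>These are the pre-cones of right pre-orders together with the improper cone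
  \<open>carrier G\<close>. Keeping the improper one makes the notion stable under inverse images
  and closed in the power set.\<close>

definition total_cone :: "'a po_group \<Rightarrow> 'a set \<Rightarrow> bool" where
  "total_cone G C \<longleftrightarrow> C \<subseteq> carrier G \<and> (\<forall>x\<in>carrier G. \<one>\<^bsub>G\<^esub> \<preceq>\<^bsub>G\<^esub> x \<longrightarrow> x \<in> C) \<and>
    (\<forall>x\<in>C. \<forall>y\<in>C. x \<otimes>\<^bsub>G\<^esub> y \<in> C) \<and> (\<forall>x\<in>carrier G. x \<in> C \<or> inv\<^bsub>G\<^esub> x \<in> C)"

text \<open>A prime cone \<open>D\<close> corresponds to the prime (convex) l-subgroup \<open>D \<inter> D\<inverse>\<close>.\<close>

definition prime_cone :: "'a po_group \<Rightarrow> 'a set \<Rightarrow> bool" where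
  "prime_cone H D \<longleftrightarrow> total_cone H D \<and> (\<forall>x\<in>D. \<forall>y\<in>D. lmeet H x y \<in> D)"

text \<open>The quotient of \<open>H\<close> by a normal cone, realised on the image of a map whose fibres are the
  classes. With the positive cone and an injective map it is an isomorphic copy of \<open>H\<close>.\<close>

definition cone_quotient :: "'a po_group \<Rightarrow> 'a set \<Rightarrow> ('a \<Rightarrow> 'b) \<Rightarrow> 'b po_group" where
  "cone_quotient H D f =
    \<lparr>carrier = f ` carrier H,
     mult = (\<lambda>X Y. f (inv_into (carrier H) f X \<otimes>\<^bsub>H\<^esub> inv_into (carrier H) f Y)),
     one = f \<one>\<^bsub>H\<^esub>,
     po_le = (\<lambda>X Y. inv_into (carrier H) f Y \<otimes>\<^bsub>H\<^esub> inv\<^bsub>H\<^esub> (inv_into (carrier H) f X) \<in> D)\<rparr>"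

locale normal_cone = lgrp +
  fixes D and f :: "'a \<Rightarrow> 'b"
  assumes sub: "D \<subseteq> carrier H"
    and pos: "\<And>x. \<lbrakk>x \<in> carrier H; \<one> \<preceq> x\<rbrakk> \<Longrightarrow> x \<in> D"
    and mult: "\<And>x y. \<lbrakk>x \<in> D; y \<in> D\<rbrakk> \<Longrightarrow> x \<otimes> y \<in> D"
    and meet: "\<And>x y. \<lbrakk>x \<in> D; y \<in> D\<rbrakk> \<Longrightarrow> x \<curlywedge> y \<in> D"
    and normal: "\<And>x y. \<lbrakk>x \<in> D; y \<in> carrier H\<rbrakk> \<Longrightarrow> y \<otimes> x \<otimes> inv y \<in> D"
    and fibres: "\<And>a b. \<lbrakk>a \<in> carrier H; b \<in> carrier H\<rbrakk> \<Longrightarrow>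
      f a = f b \<longleftrightarrow> b \<otimes> inv a \<in> D \<and> a \<otimes> inv b \<in> D"
begin

abbreviation "Q \<equiv> cone_quotient H D f"
abbreviation e where "e \<equiv> inv_into (carrier H) f"
definition q where "q a b \<longleftrightarrow> b \<otimes> inv a \<in> D"

lemma carrier_Q: "carrier Q = f ` carrier H"
  by (simp add: cone_quotient_def)

lemma e_closed [simp]: "a \<in> carrier H \<Longrightarrow> e (f a) \<in> carrier H"
  by (simp add: inv_into_into)

lemma q_iff: "\<lbrakk>a \<in> carrier H; b \<in> carrier H\<rbrakk> \<Longrightarrow> f a = f b \<longleftrightarrow> q a b \<and> q b a"
  by (simp add: fibres q_def)

lemma q_e: "a \<in> carrier H \<Longrightarrow> q (e (f a)) a \<and> q a (e (f a))"
  using q_iff[of "e (f a)" a] by (simp add: f_inv_into_f)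

lemma q_of_le: "\<lbrakk>a \<preceq> b; a \<in> carrier H; b \<in> carrier H\<rbrakk> \<Longrightarrow> q a b"
  by (simp add: q_def pos po_iff_one_le[symmetric])

lemma q_refl: "a \<in> carrier H \<Longrightarrow> q a a"
  by (simp add: q_of_le)

lemma q_trans: "\<lbrakk>q a b; q b c; a \<in> carrier H; b \<in> carrier H; c \<in> carrier H\<rbrakk> \<Longrightarrow> q a c"
  using mult[of "c \<otimes> inv b" "b \<otimes> inv a"]
  by (simp add: q_def m_assoc[symmetric] mult_inv_cancel)

lemma q_mult:
  assumes "q a b" "a \<in> carrier H" "b \<in> carrier H" "s \<in> carrier H" "t \<in> carrier H"
  shows "q (s \<otimes> a \<otimes> t) (s \<otimes> b \<otimes> t)"
proof -
  have "(s \<otimes> b \<otimes> t) \<otimes> inv (s \<otimes> a \<otimes> t) = s \<otimes> (b \<otimes> inv a) \<otimes> inv s"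
    using assms by (simp add: inv_mult_group m_assoc mult_inv_cancel)
  then show ?thesis
    using normal[of "b \<otimes> inv a" s] assms by (simp add: q_def)
qed

lemma q_mult2:
  assumes "q a b" "q c d" "a \<in> carrier H" "b \<in> carrier H" "c \<in> carrier H" "d \<in> carrier H"
  shows "q (a \<otimes> c) (b \<otimes> d)"
  using q_trans[of "a \<otimes> c" "b \<otimes> c" "b \<otimes> d"] q_mult[of a b \<one> c] q_mult[of c d b \<one>] assms
  by simp

lemma mult_Q: "\<lbrakk>a \<in> carrier H; b \<in> carrier H\<rbrakk> \<Longrightarrow> f a \<otimes>\<^bsub>Q\<^esub> f b = f (a \<otimes> b)"
  using q_e[of a] q_e[of b] q_mult2 by (simp add: cone_quotient_def q_iff)

lemma one_Q: "\<one>\<^bsub>Q\<^esub> = f \<one>"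
  by (simp add: cone_quotient_def)

lemma le_Q: "\<lbrakk>a \<in> carrier H; b \<in> carrier H\<rbrakk> \<Longrightarrow> f a \<preceq>\<^bsub>Q\<^esub> f b \<longleftrightarrow> q a b"
  using q_e[of a] q_e[of b] q_trans
  by (simp add: cone_quotient_def flip: q_def) (meson e_closed)

lemma group_Q: "group Q"
proof (rule groupI)
  fix x assume "x \<in> carrier Q"
  then obtain a where "a \<in> carrier H" "x = f a" by (auto simp: carrier_Q)
  then show "\<exists>y\<in>carrier Q. y \<otimes>\<^bsub>Q\<^esub> x = \<one>\<^bsub>Q\<^esub>"
    by (auto simp: carrier_Q one_Q mult_Q intro!: bexI[of _ "inv a"])
qed (auto simp: carrier_Q one_Q mult_Q m_assoc)

lemma hom_Q: "f \<in> hom H Q"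
  by (auto simp: hom_def carrier_Q mult_Q)

lemma l_group_Q: "l_group Q"
proof (rule l_groupI)
  show "po_group Q"
  proof (rule po_groupI[OF group_Q])
    show "\<And>x. x \<in> carrier Q \<Longrightarrow> x \<preceq>\<^bsub>Q\<^esub> x"
      by (auto simp: carrier_Q le_Q q_refl)
    show "\<And>x y. \<lbrakk>x \<preceq>\<^bsub>Q\<^esub> y; y \<preceq>\<^bsub>Q\<^esub> x; x \<in> carrier Q; y \<in> carrier Q\<rbrakk> \<Longrightarrow> x = y"
      by (auto simp: carrier_Q le_Q q_iff)
    show "\<And>x y z. \<lbrakk>x \<preceq>\<^bsub>Q\<^esub> y; y \<preceq>\<^bsub>Q\<^esub> z; x \<in> carrier Q; y \<in> carrier Q; z \<in> carrier Q\<rbrakk>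
        \<Longrightarrow> x \<preceq>\<^bsub>Q\<^esub> z"
      by (auto simp: carrier_Q le_Q intro: q_trans)
    show "\<And>a b s t. \<lbrakk>a \<preceq>\<^bsub>Q\<^esub> b; a \<in> carrier Q; b \<in> carrier Q; s \<in> carrier Q; t \<in> carrier Q\<rbrakk>
        \<Longrightarrow> s \<otimes>\<^bsub>Q\<^esub> a \<otimes>\<^bsub>Q\<^esub> t \<preceq>\<^bsub>Q\<^esub> s \<otimes>\<^bsub>Q\<^esub> b \<otimes>\<^bsub>Q\<^esub> t"
      by (auto simp: carrier_Q le_Q mult_Q q_mult)
  qed
next
  fix x y assume "x \<in> carrier Q" "y \<in> carrier Q"
  then obtain a b where ab: "a \<in> carrier H" "b \<in> carrier H" "x = f a" "y = f b"
    by (auto simp: carrier_Q)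
  \<comment> \<open>Closure of \<open>D\<close> under meets makes the image of a join a least upper
    bound, because c (a \<or> b)^-1 is the meet of c a^-1 and c b^-1.\<close>
  have "q (a \<curlyvee> b) c" if "c \<in> carrier H" "q a c" "q b c" for c
    using meet[of "c \<otimes> inv a" "c \<otimes> inv b"] that ab by (simp add: q_def inv_join mult_meet)
  then show "\<exists>s\<in>carrier Q. x \<preceq>\<^bsub>Q\<^esub> s \<and> y \<preceq>\<^bsub>Q\<^esub> s \<and>
      (\<forall>z\<in>carrier Q. x \<preceq>\<^bsub>Q\<^esub> z \<longrightarrow> y \<preceq>\<^bsub>Q\<^esub> z \<longrightarrow> s \<preceq>\<^bsub>Q\<^esub> z)"
    using ab by (intro bexI[of _ "f (a \<curlyvee> b)"])
      (auto simp: carrier_Q le_Q join_ub1 join_ub2 intro: q_of_le)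
  have "q c (a \<curlywedge> b)" if "c \<in> carrier H" "q c a" "q c b" for c
    using meet[of "a \<otimes> inv c" "b \<otimes> inv c"] that ab by (simp add: q_def meet_mult)
  then show "\<exists>s\<in>carrier Q. s \<preceq>\<^bsub>Q\<^esub> x \<and> s \<preceq>\<^bsub>Q\<^esub> y \<and>
      (\<forall>z\<in>carrier Q. z \<preceq>\<^bsub>Q\<^esub> x \<longrightarrow> z \<preceq>\<^bsub>Q\<^esub> y \<longrightarrow> z \<preceq>\<^bsub>Q\<^esub> s)"
    using ab by (intro bexI[of _ "f (a \<curlywedge> b)"])
      (auto simp: carrier_Q le_Q meet_lb1 meet_lb2 intro: q_of_le)
qed

lemma l_hom_Q: "f \<in> l_hom H Q"
proof -
  interpret Q: lgrp Q using l_group_Q by unfold_locales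
  have "f (a \<curlyvee> b) = ljoin Q (f a) (f b)" if ab: "a \<in> carrier H" "b \<in> carrier H" for a b
  proof (rule Q.join_eqI[symmetric])
    fix z assume "z \<in> carrier Q" "f a \<preceq>\<^bsub>Q\<^esub> z" "f b \<preceq>\<^bsub>Q\<^esub> z"
    then obtain c where "c \<in> carrier H" "z = f c" "q a c" "q b c"
      using ab by (auto simp: carrier_Q le_Q)
    then show "f (a \<curlyvee> b) \<preceq>\<^bsub>Q\<^esub> z"
      using meet[of "c \<otimes> inv a" "c \<otimes> inv b"] ab by (simp add: le_Q q_def inv_join mult_meet)
  qed (use ab in \<open>auto simp: carrier_Q le_Q join_ub1 join_ub2 intro: q_of_le\<close>)
  moreover have "f (a \<curlywedge> b) = lmeet Q (f a) (f b)" if ab: "a \<in> carrier H" "b \<in> carrier H" for a b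
  proof (rule Q.meet_eqI[symmetric])
    fix z assume "z \<in> carrier Q" "z \<preceq>\<^bsub>Q\<^esub> f a" "z \<preceq>\<^bsub>Q\<^esub> f b"
    then obtain c where "c \<in> carrier H" "z = f c" "q c a" "q c b"
      using ab by (auto simp: carrier_Q le_Q)
    then show "z \<preceq>\<^bsub>Q\<^esub> f (a \<curlywedge> b)"
      using meet[of "a \<otimes> inv c" "b \<otimes> inv c"] ab by (simp add: le_Q q_def meet_mult)
  qed (use ab in \<open>auto simp: carrier_Q le_Q meet_lb1 meet_lb2 intro: q_of_le\<close>)
  ultimately show ?thesis
    using hom_Q by (simp add: l_hom_def)
qed

lemma to_group_Q:
  assumes "\<And>x. x \<in> carrier H \<Longrightarrow> x \<in> D \<or> inv x \<in> D"
  shows "to_group Q"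
proof -
  have po: "po_group Q" using l_group_Q by (simp add: l_group_def)
  then interpret P: partial_order "po_order Q" by (simp add: po_group_def)
  have "total_order (po_order Q)"
  proof
    fix x y assume "x \<in> carrier (po_order Q)" "y \<in> carrier (po_order Q)"
    then obtain a b where ab: "a \<in> carrier H" "b \<in> carrier H" "x = f a" "y = f b"
      by (auto simp: po_order_def carrier_Q)
    then have "q a b \<or> q b a"
      using assms[of "a \<otimes> inv b"] by (auto simp: q_def inv_mult_group)
    then show "x \<sqsubseteq>\<^bsub>po_order Q\<^esub> y \<or> y \<sqsubseteq>\<^bsub>po_order Q\<^esub> x"
      using ab by (simp add: po_order_def le_Q)
  qed
  then show ?thesis using po by (simp add: to_group_def)
qed

end

text \<open>Transport of structure along an injection. It moves the targets of the universal
  property into the type of lists.\<close>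

lemma (in lgrp) ex_l_copy:
  fixes j :: "'a \<Rightarrow> 'b"
  assumes "inj_on j (carrier H)"
  shows "\<exists>K :: 'b po_group. l_group K \<and> j \<in> l_hom H K \<and> carrier K = j ` carrier H"
proof -
  have inj: "j a = j b \<longleftrightarrow> a = b" if "a \<in> carrier H" "b \<in> carrier H" for a b
    using assms that by (auto dest: inj_onD)
  interpret normal_cone H "{x \<in> carrier H. \<one> \<preceq> x}" j
  proof unfold_locales
    fix x y assume "x \<in> {x \<in> carrier H. \<one> \<preceq> x}" "y \<in> {x \<in> carrier H. \<one> \<preceq> x}"
    then show "x \<otimes> y \<in> {x \<in> carrier H. \<one> \<preceq> x}" "x \<curlywedge> y \<in> {x \<in> carrier H. \<one> \<preceq> x}"
      using po_mult_mono[of \<one> x \<one> y] meet_greatest[of \<one> x y] by auto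
  next
    fix x y assume "x \<in> {x \<in> carrier H. \<one> \<preceq> x}" "y \<in> carrier H"
    then show "y \<otimes> x \<otimes> inv y \<in> {x \<in> carrier H. \<one> \<preceq> x}"
      using po_mult_lr[of \<one> x y "inv y"] by auto
  next
    fix a b assume "a \<in> carrier H" "b \<in> carrier H"
    then show "j a = j b \<longleftrightarrow>
        b \<otimes> inv a \<in> {x \<in> carrier H. \<one> \<preceq> x} \<and> a \<otimes> inv b \<in> {x \<in> carrier H. \<one> \<preceq> x}"
      by (auto simp: inj po_iff_one_le[symmetric] intro: po_antisym)
  qed auto
  show ?thesis
    using l_group_Q l_hom_Q carrier_Q by blast
qed

section \<open>Separation of non-positive elements by prime cones\<close>

context lgrp
begin

text \<open>A prime cone without totality. Zorn's lemma is applied to these in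
  \<open>ex_prime_cone\<close>, where maximality brings totality back.\<close>

definition l_cone :: "'a set \<Rightarrow> bool" where
  "l_cone P \<longleftrightarrow> P \<subseteq> carrier H \<and> (\<forall>x\<in>carrier H. \<one> \<preceq> x \<longrightarrow> x \<in> P) \<and>
    (\<forall>x\<in>P. \<forall>y\<in>P. x \<otimes> y \<in> P \<and> x \<curlywedge> y \<in> P)"

lemma l_coneD:
  assumes "l_cone P"
  shows "\<And>x. x \<in> P \<Longrightarrow> x \<in> carrier H" "\<And>x. \<lbrakk>x \<in> carrier H; \<one> \<preceq> x\<rbrakk> \<Longrightarrow> x \<in> P"
    "\<And>x y. \<lbrakk>x \<in> P; y \<in> P\<rbrakk> \<Longrightarrow> x \<otimes> y \<in> P" "\<And>x y. \<lbrakk>x \<in> P; y \<in> P\<rbrakk> \<Longrightarrow> x \<curlywedge> y \<in> P"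
  using assms by (auto simp: l_cone_def)

lemma l_cone_up:
  assumes "l_cone P" "x \<in> P" "x \<preceq> y" "y \<in> carrier H"
  shows "y \<in> P"
proof -
  note D = l_coneD[OF assms(1)]
  have "y \<otimes> inv x \<in> P"
    using assms D(1)[of x] D(2)[of "y \<otimes> inv x"] po_iff_one_le[of x y] by simp
  then show ?thesis
    using D(3)[of "y \<otimes> inv x" x] D(1) assms by (simp add: mult_inv_cancel)
qed

lemma prime_cone_iff: "prime_cone H D \<longleftrightarrow> l_cone D \<and> (\<forall>x\<in>carrier H. x \<in> D \<or> inv x \<in> D)"
  by (auto simp: prime_cone_def total_cone_def l_cone_def)

lemma prime_coneD:
  assumes "prime_cone H D"
  shows "l_cone D" "\<And>x. x \<in> carrier H \<Longrightarrow> x \<in> D \<or> inv x \<in> D"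
  using assms by (auto simp: prime_cone_iff)

lemma prime_cone_meet_iff:
  assumes D: "prime_cone H D" and xy: "x \<in> carrier H" "y \<in> carrier H"
  shows "x \<curlywedge> y \<in> D \<longleftrightarrow> x \<in> D \<and> y \<in> D"
  using l_coneD(4)[OF prime_coneD(1)[OF D]] l_cone_up[OF prime_coneD(1)[OF D]] xy
  by (meson meet_lb1 meet_lb2 meet_closed)

text \<open>By totality x y^-1 or its inverse is in \<open>D\<close>. In the first case so is its
  meet with 1, which equals x (x \<or> y)^-1; multiplying by x \<or> y gives x. The other case is
  symmetric.\<close>

lemma prime_cone_join_iff:
  assumes D: "prime_cone H D" and xy: "x \<in> carrier H" "y \<in> carrier H"
  shows "x \<curlyvee> y \<in> D \<longleftrightarrow> x \<in> D \<or> y \<in> D"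
proof
  have *: "x \<in> D" if xy: "x \<in> carrier H" "y \<in> carrier H" and "x \<curlyvee> y \<in> D" "x \<otimes> inv y \<in> D" for x y
  proof -
    have "\<one> \<curlywedge> (x \<otimes> inv y) \<in> D"
      using that prime_cone_meet_iff[OF D] l_coneD(2)[OF prime_coneD(1)[OF D]] by simp
    moreover have "\<one> \<curlywedge> (x \<otimes> inv y) = x \<otimes> inv (x \<curlyvee> y)"
      using xy by (simp add: inv_join mult_meet)
    ultimately show ?thesis
      using l_coneD(3)[OF prime_coneD(1)[OF D]] that
      by (metis join_closed mult_inv_cancel(1))
  qed
  assume "x \<curlyvee> y \<in> D"
  moreover have "x \<otimes> inv y \<in> D \<or> y \<otimes> inv x \<in> D"
    using prime_coneD(2)[OF D, of "x \<otimes> inv y"] xy by (simp add: inv_mult_group)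
  ultimately show "x \<in> D \<or> y \<in> D"
    using *[of x y] *[of y x] xy join_comm by auto
qed (use l_cone_up[OF prime_coneD(1)[OF D]] xy join_ub1 join_ub2 in auto)

text \<open>After expanding the product, every term except b c has a factor a, and lies below a
  because the other factor is negative.\<close>

lemma neg_join_mult:
  assumes "a \<in> carrier H" "b \<in> carrier H" "c \<in> carrier H" "a \<preceq> \<one>" "b \<preceq> \<one>" "c \<preceq> \<one>"
  shows "(a \<curlyvee> b) \<otimes> (a \<curlyvee> c) \<preceq> a \<curlyvee> (b \<otimes> c)"
proof -
  have 1: "a \<otimes> (a \<curlyvee> c) \<preceq> a \<curlyvee> (b \<otimes> c)"
  proof (rule po_trans)
    show "a \<otimes> (a \<curlyvee> c) \<preceq> a"
      using po_mult_left[of "a \<curlyvee> c" \<one> a] join_least[of a \<one> c] assms by simp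
  qed (use assms join_ub1 in auto)
  have "b \<otimes> a \<preceq> a \<curlyvee> (b \<otimes> c)"
  proof (rule po_trans)
    show "b \<otimes> a \<preceq> a"
      using po_mult_right[of b \<one> a] assms by simp
  qed (use assms join_ub1 in auto)
  then have "b \<otimes> (a \<curlyvee> c) \<preceq> a \<curlyvee> (b \<otimes> c)"
    using assms by (simp add: mult_join join_least join_ub2)
  with 1 show ?thesis
    using assms by (simp add: join_mult[of a b "a \<curlyvee> c"] join_least)
qed

text \<open>The semigroup generated by \<open>A\<close> and \<open>u\<close>. It is used with
  negative generators only, so that a product lies below each of its factors.\<close>

inductive_set words :: "'a set \<Rightarrow> 'a \<Rightarrow> 'a set" for A u where
  base: "a \<in> A \<Longrightarrow> a \<in> words A u"
| gen: "u \<in> words A u"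
| mult: "\<lbrakk>x \<in> words A u; y \<in> words A u\<rbrakk> \<Longrightarrow> x \<otimes> y \<in> words A u"

lemma words_neg:
  assumes "w \<in> words A u" "\<And>a. a \<in> A \<Longrightarrow> a \<in> carrier H \<and> a \<preceq> \<one>" "u \<in> carrier H" "u \<preceq> \<one>"
  shows "w \<in> carrier H \<and> w \<preceq> \<one>"
  using assms(1)
proof induct
  case (mult x y)
  then show ?case using po_mult_mono[of x \<one> y \<one>] by simp
qed (use assms in auto)

text \<open>Induction on both words, where \<open>neg_join_mult\<close> reduces products to their
  factors. A letter from \<open>P\<close> joined with anything stays in \<open>P\<close>, and the
  only remaining pair of letters is \<open>u\<close>, \<open>v\<close>, whose join is 1.\<close>

lemma words_join:
  assumes P: "l_cone P" and u: "u \<in> carrier H" "u \<preceq> \<one>" and v: "v \<in> carrier H" "v \<preceq> \<one>"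
    and uv: "u \<curlyvee> v = \<one>" and s: "s \<in> words {p \<in> P. p \<preceq> \<one>} u" and t: "t \<in> words {p \<in> P. p \<preceq> \<one>} v"
  shows "s \<curlyvee> t \<in> P"
proof -
  let ?A = "{p \<in> P. p \<preceq> \<one>}"
  have neg: "w \<in> carrier H \<and> w \<preceq> \<one>" if "w \<in> words ?A u \<or> w \<in> words ?A v" for w
    using that words_neg[of w ?A u] words_neg[of w ?A v] u v l_coneD(1)[OF P] by blast
  have A: "a \<curlyvee> x \<in> P" "x \<curlyvee> a \<in> P" if "a \<in> ?A" "x \<in> carrier H" for a x
    using that l_cone_up[OF P] l_coneD(1)[OF P] by (auto simp: join_ub1 join_ub2)
  have m: "a \<curlyvee> (b \<otimes> c) \<in> P" if "a \<curlyvee> b \<in> P" "a \<curlyvee> c \<in> P"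
    "a \<in> carrier H \<and> a \<preceq> \<one>" "b \<in> carrier H \<and> b \<preceq> \<one>" "c \<in> carrier H \<and> c \<preceq> \<one>" for a b c
    using l_cone_up[OF P l_coneD(3)[OF P that(1,2)] neg_join_mult] that by simp
  have gen: "u \<curlyvee> t \<in> P"
    using t
  proof induct
    case gen
    then show ?case using uv l_coneD(2)[OF P] by simp
  next
    case (mult x y)
    then show ?case using m[of u x y] neg u by blast
  qed (use A u in simp)
  show ?thesis
    using s
  proof induct
    case (mult x y)
    then have *: "x \<in> carrier H" "y \<in> carrier H" "t \<in> carrier H"
      using neg t by blast+
    have "t \<curlyvee> x \<in> P" "t \<curlyvee> y \<in> P"
      using mult join_comm[OF *(3)] * by simp_all
    then have "t \<curlyvee> (x \<otimes> y) \<in> P"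
      using m mult(1,3) neg t by blast
    then show ?case using join_comm[OF *(3)] * by simp
  next
    case (base a)
    then show ?case using A(1) neg t by blast
  qed (use gen in simp)
qed

text \<open>This is the l-cone generated by \<open>P\<close> and \<open>u\<close>. Meets cause no
  trouble: the product of two words lies below both, hence below the meet of any elements above
  them.\<close>

lemma l_cone_words:
  assumes P: "l_cone P" and u: "u \<in> carrier H" "u \<preceq> \<one>"
  shows "l_cone {y \<in> carrier H. \<exists>w\<in>words {p \<in> P. p \<preceq> \<one>} u. w \<preceq> y}" (is "l_cone ?P")
proof -
  let ?W = "words {p \<in> P. p \<preceq> \<one>} u"
  have neg: "w \<in> carrier H \<and> w \<preceq> \<one>" if "w \<in> ?W" for w
    using that words_neg[of w "{p \<in> P. p \<preceq> \<one>}" u] u l_coneD(1)[OF P] by blast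
  have "\<one> \<in> ?W"
    using l_coneD(2)[OF P] by (auto intro: words.base)
  moreover have "x \<otimes> y \<in> ?P \<and> x \<curlywedge> y \<in> ?P" if xy: "x \<in> ?P" "y \<in> ?P" for x y
  proof -
    obtain v w where vw: "v \<in> ?W" "w \<in> ?W" "v \<preceq> x" "w \<preceq> y" "x \<in> carrier H" "y \<in> carrier H"
      using xy by blast
    note cl = neg[OF vw(1)] neg[OF vw(2)]
    have "v \<otimes> w \<preceq> v" "v \<otimes> w \<preceq> w"
      using po_mult_left[of w \<one> v] po_mult_right[of v \<one> w] cl by auto
    then have "v \<otimes> w \<preceq> x" "v \<otimes> w \<preceq> y"
      using vw cl by (meson po_trans m_closed)+
    then have "v \<otimes> w \<preceq> x \<curlywedge> y"
      using vw cl meet_greatest by simp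
    moreover have "v \<otimes> w \<preceq> x \<otimes> y" using vw cl po_mult_mono by simp
    ultimately show ?thesis
      using vw words.mult[OF vw(1,2)] by auto
  qed
  ultimately show ?thesis
    by (auto simp: l_cone_def)
qed

text \<open>An l-cone \<open>P\<close> that is maximal among those omitting x is total. If it
  omitted both z and z^-1, then enlarging it by the negative part of either would bring in x; so x
  lies above a word of each kind, hence above their join, which is in \<open>P\<close> by
  \<open>words_join\<close>.\<close>

lemma ex_prime_cone:
  assumes x: "x \<in> carrier H" "\<not> \<one> \<preceq> x"
  obtains D where "prime_cone H D" "x \<notin> D"
proof -
  let ?S = "{P. l_cone P \<and> x \<notin> P}"
  have start: "{y \<in> carrier H. \<one> \<preceq> y} \<in> ?S"
    using x po_mult_mono[of \<one> _ \<one>] by (auto simp: l_cone_def intro: meet_greatest)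
  have union: "\<Union>\<C> \<in> ?S" if ne: "\<C> \<noteq> {}" and chain: "subset.chain ?S \<C>" for \<C>
  proof -
    have all: "\<And>P. P \<in> \<C> \<Longrightarrow> l_cone P \<and> x \<notin> P"
      and ch: "\<And>P Q. \<lbrakk>P \<in> \<C>; Q \<in> \<C>\<rbrakk> \<Longrightarrow> P \<subseteq> Q \<or> Q \<subseteq> P"
      using chain by (auto simp: subset_chain_def)
    have cl: "a \<otimes> b \<in> \<Union>\<C> \<and> a \<curlywedge> b \<in> \<Union>\<C>" if ab: "a \<in> \<Union>\<C>" "b \<in> \<Union>\<C>" for a b
    proof -
      obtain P where "P \<in> \<C>" "a \<in> P" "b \<in> P" using ab ch by blast
      then show ?thesis using all l_coneD(3,4) by (meson UnionI)
    qed
    obtain P where P: "P \<in> \<C>" using ne by blast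
    have "\<Union>\<C> \<subseteq> carrier H" "x \<notin> \<Union>\<C>" using all l_coneD(1) by blast+
    moreover have "y \<in> \<Union>\<C>" if "y \<in> carrier H" "\<one> \<preceq> y" for y
      using P all l_coneD(2) that by (meson UnionI)
    ultimately show ?thesis
      using cl by (simp add: l_cone_def)
  qed
  have "\<exists>P\<in>?S. \<forall>Q\<in>?S. P \<subseteq> Q \<longrightarrow> Q = P"
    by (rule subset_Zorn_nonempty[OF _ union]) (use start in blast)
  then obtain P where P: "l_cone P" "x \<notin> P"
    and max: "\<And>Q. \<lbrakk>l_cone Q; x \<notin> Q; P \<subseteq> Q\<rbrakk> \<Longrightarrow> Q = P"
    by auto
  note D = l_coneD[OF P(1)]
  \<comment> \<open>The l-cone generated by \<open>P\<close> and 1 \<and> z contains z, so it is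
    strictly larger than \<open>P\<close> and by maximality contains x.\<close>
  have w: "\<exists>w\<in>words {p \<in> P. p \<preceq> \<one>} (\<one> \<curlywedge> z). w \<preceq> x" if z: "z \<in> carrier H" "z \<notin> P" for z
  proof (rule ccontr)
    let ?u = "\<one> \<curlywedge> z"
    let ?Q = "{y \<in> carrier H. \<exists>w\<in>words {p \<in> P. p \<preceq> \<one>} ?u. w \<preceq> y}"
    have u: "?u \<in> carrier H" "?u \<preceq> \<one>" "?u \<preceq> z" using z meet_lb1 meet_lb2 by auto
    have "P \<subseteq> ?Q"
    proof
      fix p assume p: "p \<in> P"
      then have "\<one> \<curlywedge> p \<in> P" using D by simp
      then have "\<one> \<curlywedge> p \<in> words {p \<in> P. p \<preceq> \<one>} ?u"
        using D(1)[OF p] meet_lb1 by (auto intro: words.base)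
      then show "p \<in> ?Q" using D(1)[OF p] meet_lb2 by auto
    qed
    moreover assume "\<not> ?thesis"
    ultimately have "?Q = P"
      using l_cone_words[OF P(1) u(1,2)] by (intro max) auto
    moreover have "z \<in> ?Q" using u z words.gen by auto
    ultimately show False using z by simp
  qed
  have "z \<in> P \<or> inv z \<in> P" if z: "z \<in> carrier H" for z
  proof (rule ccontr)
    let ?u = "\<one> \<curlywedge> z" and ?v = "\<one> \<curlywedge> inv z"
    assume "\<not> ?thesis"
    then obtain s t where st: "s \<in> words {p \<in> P. p \<preceq> \<one>} ?u" "s \<preceq> x"
      "t \<in> words {p \<in> P. p \<preceq> \<one>} ?v" "t \<preceq> x"
      using w[of z] w[of "inv z"] z by auto
    have uv: "?u \<in> carrier H" "?u \<preceq> \<one>" "?v \<in> carrier H" "?v \<preceq> \<one>" using z meet_lb1 by auto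
    \<comment> \<open>The negative parts of z and z^-1 have join 1: since \<open>?v\<close> is z^-1
      \<open>?u\<close>, the join is (1 \<or> z^-1) \<open>?u\<close>, and 1 \<or> z^-1 is the
      inverse of \<open>?u\<close>.\<close>
    have "?v = inv z \<otimes> ?u"
      using z by (simp add: mult_meet meet_comm)
    then have "?u \<curlyvee> ?v = (\<one> \<curlyvee> inv z) \<otimes> ?u"
      using z by (simp add: join_mult del: meet_closed) (simp add: join_mult)
    also have "\<dots> = inv ?u \<otimes> ?u" using z by (simp add: inv_meet)
    finally have "s \<curlyvee> t \<in> P"
      using words_join[OF P(1) uv _ st(1,3)] uv by simp
    moreover have "s \<in> carrier H" "t \<in> carrier H"
      using words_neg[OF st(1)] words_neg[OF st(3)] uv D(1) by auto
    ultimately have "x \<in> P"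
      using st x l_cone_up[OF P(1)] join_least by blast
    then show False using P by simp
  qed
  then have "prime_cone H P" using P(1) by (simp add: prime_cone_iff)
  then show thesis using that P(2) by blast
qed

end

section \<open>Cones adapted to a variety\<close>

text \<open>Every l-group acts on the chain of cosets of the prime subgroup of a prime cone, so that the
  variety of all l-groups imposes no condition.\<close>

fun adapted :: "lgroup_variety \<Rightarrow> 'a po_group \<Rightarrow> 'a set \<Rightarrow> bool" where
  "adapted All_LGroups G C \<longleftrightarrow> True"
| "adapted Representable_LGroups G C \<longleftrightarrow>
    (\<forall>g\<in>carrier G. \<forall>x\<in>C. g \<otimes>\<^bsub>G\<^esub> x \<otimes>\<^bsub>G\<^esub> inv\<^bsub>G\<^esub> g \<in> C)"
| "adapted Abelian_LGroups G C \<longleftrightarrow>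
    (\<forall>a\<in>carrier G. \<forall>b\<in>carrier G. a \<otimes>\<^bsub>G\<^esub> b \<otimes>\<^bsub>G\<^esub> inv\<^bsub>G\<^esub> a \<otimes>\<^bsub>G\<^esub> inv\<^bsub>G\<^esub> b \<in> C)"

section \<open>The compact space of cones, with subsets encoded as predicates under the product
  topology\<close>

lemma compact_UNIV_pred: "compact (UNIV :: ('a \<Rightarrow> bool) set)"
proof -
  have "compact_space (product_topology (\<lambda>_. euclidean) (UNIV :: 'a set) :: ('a \<Rightarrow> bool) topology)"
    unfolding compact_space_product_topology by (simp add: compact_space_def finite_imp_compact)
  then show ?thesis
    by (simp add: euclidean_product_topology compact_space_def)
qed

lemma open_Collect_apply: "open {f :: 'a \<Rightarrow> bool. f x}"
proof -
  have "open ((\<lambda>f :: 'a \<Rightarrow> bool. f x) -` {True})"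
    by (rule open_vimage) (simp_all add: open_discrete)
  then show ?thesis by (simp add: vimage_def)
qed

lemma closed_Collect_apply: "closed {f :: 'a \<Rightarrow> bool. f x}"
proof -
  have "closed ((\<lambda>f :: 'a \<Rightarrow> bool. f x) -` {True})"
    by (rule closed_vimage) simp_all
  then show ?thesis by (simp add: vimage_def)
qed

lemmas clopen_Collect_intros =
  open_Collect_apply closed_Collect_apply closed_Collect_all closed_Collect_imp
  closed_Collect_conj closed_Collect_disj closed_Collect_const open_Collect_const
  open_Collect_conj open_Collect_disj

text \<open>Each instance of a condition involves only finitely many memberships, hence defines a
  clopen set; the universal quantifiers are intersections of these.\<close>

lemma closed_total_cone: "closed {f. total_cone G {x. f x}}"
  unfolding total_cone_def Ball_def subset_iff mem_Collect_eq
  by (intro clopen_Collect_intros)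

lemma closed_prime_cone: "closed {f. prime_cone H {x. f x}}"
  unfolding prime_cone_def Ball_def mem_Collect_eq
  by (intro clopen_Collect_intros closed_total_cone)

lemma closed_adapted: "closed {f. adapted V G {x. f x}}"
  by (cases V) (simp_all add: Ball_def, (intro clopen_Collect_intros)+)

context lgrp
begin

text \<open>Positivity in a totally ordered target pulls back to a normal prime cone. The last claim
  is phrased with the meet with 1 so that it can be fed by a coordinate that separates 1 \<and> y
  from 1.\<close>

lemma total_quotient_cone:
  assumes T: "to_group T" and \<phi>: "\<phi> \<in> l_hom H T"
  shows "prime_cone H {x \<in> carrier H. \<one>\<^bsub>T\<^esub> \<preceq>\<^bsub>T\<^esub> \<phi> x}"
    and "adapted Representable_LGroups H {x \<in> carrier H. \<one>\<^bsub>T\<^esub> \<preceq>\<^bsub>T\<^esub> \<phi> x}"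
    and "\<lbrakk>y \<in> carrier H; \<phi> (\<one> \<curlywedge> y) \<noteq> \<one>\<^bsub>T\<^esub>\<rbrakk> \<Longrightarrow> y \<notin> {x \<in> carrier H. \<one>\<^bsub>T\<^esub> \<preceq>\<^bsub>T\<^esub> \<phi> x}"
proof -
  interpret T: total_order "po_order T" using T by (simp add: to_group_def)
  have "l_group T" using T T.lattice_axioms by (simp add: to_group_def l_group_def)
  then interpret lgrp_hom H T \<phi>
    using \<phi> by unfold_locales
  have tot: "x \<preceq>\<^bsub>T\<^esub> y \<or> y \<preceq>\<^bsub>T\<^esub> x" if "x \<in> carrier T" "y \<in> carrier T" for x y
    using T.total_order_total[of x y] that by (simp add: po_order_def)
  show "prime_cone H {x \<in> carrier H. \<one>\<^bsub>T\<^esub> \<preceq>\<^bsub>T\<^esub> \<phi> x}"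
    unfolding prime_cone_iff l_cone_def
  proof (intro conjI ballI impI)
    fix x y assume "x \<in> {x \<in> carrier H. \<one>\<^bsub>T\<^esub> \<preceq>\<^bsub>T\<^esub> \<phi> x}" "y \<in> {x \<in> carrier H. \<one>\<^bsub>T\<^esub> \<preceq>\<^bsub>T\<^esub> \<phi> x}"
    then show "x \<otimes> y \<in> {x \<in> carrier H. \<one>\<^bsub>T\<^esub> \<preceq>\<^bsub>T\<^esub> \<phi> x}"
      "x \<curlywedge> y \<in> {x \<in> carrier H. \<one>\<^bsub>T\<^esub> \<preceq>\<^bsub>T\<^esub> \<phi> x}"
      using K.po_mult_mono[of "\<one>\<^bsub>T\<^esub>" "\<phi> x" "\<one>\<^bsub>T\<^esub>" "\<phi> y"]
      by (auto simp: hom_meet intro: K.meet_greatest)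
  next
    fix x assume "x \<in> carrier H" "\<one> \<preceq> x"
    then show "x \<in> {x \<in> carrier H. \<one>\<^bsub>T\<^esub> \<preceq>\<^bsub>T\<^esub> \<phi> x}"
      using hom_mono[of \<one> x] by simp
  next
    fix x assume "x \<in> carrier H"
    then show "x \<in> {x \<in> carrier H. \<one>\<^bsub>T\<^esub> \<preceq>\<^bsub>T\<^esub> \<phi> x} \<or> inv x \<in> {x \<in> carrier H. \<one>\<^bsub>T\<^esub> \<preceq>\<^bsub>T\<^esub> \<phi> x}"
      using tot[of "\<one>\<^bsub>T\<^esub>" "\<phi> x"] K.po_le_inv_iff[of "\<one>\<^bsub>T\<^esub>" "\<phi> x"] by auto
  qed auto
  show "adapted Representable_LGroups H {x \<in> carrier H. \<one>\<^bsub>T\<^esub> \<preceq>\<^bsub>T\<^esub> \<phi> x}"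
  proof -
    have "\<one>\<^bsub>T\<^esub> \<preceq>\<^bsub>T\<^esub> \<phi> (g \<otimes> x \<otimes> inv g)"
      if "g \<in> carrier H" "x \<in> carrier H" "\<one>\<^bsub>T\<^esub> \<preceq>\<^bsub>T\<^esub> \<phi> x" for g x
      using K.po_mult_lr[of "\<one>\<^bsub>T\<^esub>" "\<phi> x" "\<phi> g" "inv\<^bsub>T\<^esub> (\<phi> g)"] that by simp
    then show ?thesis by simp
  qed
  show "y \<notin> {x \<in> carrier H. \<one>\<^bsub>T\<^esub> \<preceq>\<^bsub>T\<^esub> \<phi> x}" if "y \<in> carrier H" "\<phi> (\<one> \<curlywedge> y) \<noteq> \<one>\<^bsub>T\<^esub>"
    using that hom_meet[of \<one> y] K.meet_absorb[of "\<one>\<^bsub>T\<^esub>" "\<phi> y"] by auto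
qed

text \<open>The cones themselves are the indices and the quotients by them, realised on sets of
  classes, are the factors; both then have the types that \<open>representable\<close>
  prescribes.\<close>

lemma representable_of_normal_prime_cones:
  assumes sep: "\<And>x. \<lbrakk>x \<in> carrier H; \<And>D. \<lbrakk>prime_cone H D; adapted Representable_LGroups H D\<rbrakk> \<Longrightarrow> x \<in> D\<rbrakk>
    \<Longrightarrow> \<one> \<preceq> x"
  shows "representable H"
proof -
  define cls where "cls D a = {b \<in> carrier H. b \<otimes> inv a \<in> D \<and> a \<otimes> inv b \<in> D}" for D a
  define I where "I = {D. prime_cone H D \<and> adapted Representable_LGroups H D}"
  have cls: "cls D a = cls D b \<longleftrightarrow> b \<otimes> inv a \<in> D \<and> a \<otimes> inv b \<in> D"
    if D: "D \<in> I" and ab: "a \<in> carrier H" "b \<in> carrier H" for D a b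
  proof -
    have L: "l_cone D" using D prime_coneD(1) by (auto simp: I_def)
    have tr: "z \<otimes> inv x \<in> D" if "z \<otimes> inv y \<in> D" "y \<otimes> inv x \<in> D"
      "x \<in> carrier H" "y \<in> carrier H" "z \<in> carrier H" for x y z
      using l_coneD(3)[OF L that(1,2)] that(3-) by (simp add: m_assoc[symmetric] mult_inv_cancel)
    have "b \<in> cls D b" using ab l_coneD(2)[OF L] by (simp add: cls_def)
    then show ?thesis
      using ab by (auto simp: cls_def intro: tr)
  qed
  have nc: "normal_cone H D (cls D)" if D: "D \<in> I" for D
  proof unfold_locales
    have L: "l_cone D" and N: "adapted Representable_LGroups H D"
      using D prime_coneD(1) by (auto simp: I_def)
    show "D \<subseteq> carrier H" using L l_coneD(1) by blast
    fix x y assume x: "x \<in> D"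
    show "x \<otimes> y \<in> D" "x \<curlywedge> y \<in> D" if "y \<in> D"
      using x that l_coneD(3,4)[OF L] by auto
    show "y \<otimes> x \<otimes> inv y \<in> D" if "y \<in> carrier H"
      using x that N by simp
  qed (use cls D l_coneD(2) prime_coneD(1) in \<open>auto simp: I_def\<close>)
  have "to_group (cone_quotient H D (cls D)) \<and> cls D \<in> l_hom H (cone_quotient H D (cls D)) \<and>
    cls D ` carrier H = carrier (cone_quotient H D (cls D))" if D: "D \<in> I" for D
  proof -
    interpret normal_cone H D "cls D" using nc[OF D] .
    show ?thesis
      using to_group_Q l_hom_Q carrier_Q prime_coneD(2) D by (auto simp: I_def)
  qed
  moreover have "x = y" if xy: "x \<in> carrier H" "y \<in> carrier H" "\<forall>D\<in>I. cls D x = cls D y" for x y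
  proof -
    have "\<one> \<preceq> x \<otimes> inv y" "\<one> \<preceq> y \<otimes> inv x"
      using xy cls by (auto intro!: sep simp: I_def)
    then show ?thesis
      using xy po_iff_one_le[of x y] po_iff_one_le[of y x] by (simp add: po_antisym)
  qed
  ultimately show ?thesis
    unfolding representable_def
    by (intro exI[of _ I] exI[of _ "\<lambda>D. cone_quotient H D (cls D)"] exI[of _ cls]) blast
qed

lemma commutator_eq_one_iff:
  assumes "a \<in> carrier H" "b \<in> carrier H"
  shows "a \<otimes> b \<otimes> inv a \<otimes> inv b = \<one> \<longleftrightarrow> a \<otimes> b = b \<otimes> a"
  by (metis assms inv_closed inv_equality inv_inv m_assoc m_closed mult_inv_cancel(1) r_inv)

text \<open>This form treats the three varieties alike and is compatible with inverse images of
  cones. For all l-groups it is \<open>ex_prime_cone\<close>. In the Abelian case every commutator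
  is 1 and so is in every prime cone; conversely, if all commutators are positive, they are 1,
  because the inverse of a commutator is a commutator.\<close>

lemma in_variety_iff:
  "in_variety H V \<longleftrightarrow>
    (\<forall>x\<in>carrier H. (\<forall>D. prime_cone H D \<and> adapted V H D \<longrightarrow> x \<in> D) \<longrightarrow> \<one> \<preceq> x)"
proof (cases V)
  case All_LGroups
  then show ?thesis
    using l_group by simp (metis ex_prime_cone)
next
  case Representable_LGroups
  have "\<one> \<preceq> x" if rep: "representable H" and x: "x \<in> carrier H"
    "\<And>D. \<lbrakk>prime_cone H D; adapted Representable_LGroups H D\<rbrakk> \<Longrightarrow> x \<in> D" for x
  proof (rule ccontr)
    assume "\<not> \<one> \<preceq> x"
    then have ne: "\<one> \<curlywedge> x \<noteq> \<one>" using le_iff_meet[of \<one> x] x by simp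
    obtain I and T :: "'a set \<Rightarrow> 'a set po_group" and \<phi> where
      *: "(\<forall>i\<in>I. to_group (T i) \<and> \<phi> i \<in> l_hom H (T i) \<and> \<phi> i ` carrier H = carrier (T i)) \<and>
        (\<forall>x\<in>carrier H. \<forall>y\<in>carrier H. (\<forall>i\<in>I. \<phi> i x = \<phi> i y) \<longrightarrow> x = y)"
      using rep unfolding representable_def by (elim exE) (rule that)
    then have \<phi>: "\<forall>i\<in>I. to_group (T i) \<and> \<phi> i \<in> l_hom H (T i)" and
      sep: "\<forall>x\<in>carrier H. \<forall>y\<in>carrier H. (\<forall>i\<in>I. \<phi> i x = \<phi> i y) \<longrightarrow> x = y"
      by simp_all
    obtain i where i: "i \<in> I" "\<phi> i (\<one> \<curlywedge> x) \<noteq> \<phi> i \<one>"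
      using sep[rule_format, of "\<one> \<curlywedge> x" \<one>] ne x by auto
    interpret T: total_order "po_order (T i)" using \<phi> i by (simp add: to_group_def)
    have "group (T i)" using \<phi> i by (simp add: to_group_def po_group_def)
    then have "\<phi> i \<one> = \<one>\<^bsub>T i\<^esub>"
      using hom_one[OF l_homD(1)[of "\<phi> i" H "T i"]] \<phi> i is_group by blast
    then have "\<phi> i (\<one> \<curlywedge> x) \<noteq> \<one>\<^bsub>T i\<^esub>" using i by simp
    then show False
      using total_quotient_cone[of "T i" "\<phi> i"] \<phi> i x by blast
  qed
  then show ?thesis
    using Representable_LGroups l_group representable_of_normal_prime_cones by auto
next
  case Abelian_LGroups
  show ?thesis
  proof
    assume "in_variety H V"
    then have comm: "comm_group H" using Abelian_LGroups by simp
    have "a \<otimes> b \<otimes> inv a \<otimes> inv b = \<one>" if "a \<in> carrier H" "b \<in> carrier H" for a b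
      using commutator_eq_one_iff[OF that] comm_monoid.m_comm[OF comm_group.axioms(1)[OF comm] that]
      by simp
    then have "adapted V H D" if "prime_cone H D" for D
      using l_coneD(2)[OF prime_coneD(1)[OF that], of \<one>] Abelian_LGroups by simp
    then show "\<forall>x\<in>carrier H. (\<forall>D. prime_cone H D \<and> adapted V H D \<longrightarrow> x \<in> D) \<longrightarrow> \<one> \<preceq> x"
      by (metis ex_prime_cone)
  next
    assume sep: "\<forall>x\<in>carrier H. (\<forall>D. prime_cone H D \<and> adapted V H D \<longrightarrow> x \<in> D) \<longrightarrow> \<one> \<preceq> x"
    have le: "\<one> \<preceq> a \<otimes> b \<otimes> inv a \<otimes> inv b" if "a \<in> carrier H" "b \<in> carrier H" for a b
      using sep that Abelian_LGroups by simp
    have "a \<otimes> b = b \<otimes> a" if ab: "a \<in> carrier H" "b \<in> carrier H" for a b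
    proof -
      have "b \<otimes> a \<otimes> inv b \<otimes> inv a = inv (a \<otimes> b \<otimes> inv a \<otimes> inv b)"
        using ab by (simp add: inv_mult_group m_assoc)
      then have "a \<otimes> b \<otimes> inv a \<otimes> inv b = \<one>"
        using le[of a b] le[of b a] ab po_le_inv_iff[of \<one> "a \<otimes> b \<otimes> inv a \<otimes> inv b"]
        by (simp add: po_antisym)
      then show ?thesis using ab commutator_eq_one_iff by simp
    qed
    then have "comm_group H" by (intro group_comm_groupI)
    then show "in_variety H V" using Abelian_LGroups l_group by simp
  qed
qed

text \<open>The adapted prime cones omitting a given element form a compact set, so it suffices to
  omit finitely many elements outside \<open>D\<close> at once. Since \<open>D\<close> is prime,
  their join is again outside \<open>D\<close>, hence not positive, and by membership in
  \<open>V\<close> some adapted prime cone omits the join and everything below it.\<close>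

lemma adapted_prime_cone_below:
  assumes V: "in_variety H V" and D: "prime_cone H D"
  obtains E where "prime_cone H E" "adapted V H E" "E \<subseteq> D"
proof -
  let ?S = "{f. prime_cone H {x. f x} \<and> adapted V H {x. f x}}"
  have "closed ?S" by (intro clopen_Collect_intros closed_prime_cone closed_adapted)
  then have cpt: "compact ?S"
    using compact_Int_closed[OF compact_UNIV_pred] by simp
  have closed: "closed {f :: 'a \<Rightarrow> bool. \<not> f x}" for x
    by (intro closed_Collect_neg open_Collect_apply)
  have fip: "?S \<inter> (\<Inter>x\<in>X. {f. \<not> f x}) \<noteq> {}" if X: "finite X" "X \<subseteq> carrier H - D" for X
  proof (cases "X = {}")
    case True
    \<comment> \<open>With nothing to omit, the improper cone is a witness.\<close>
    have "prime_cone H (carrier H)" by (auto simp: prime_cone_iff l_cone_def)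
    moreover have "adapted V H (carrier H)" by (cases V) simp_all
    ultimately have "(\<lambda>x. x \<in> carrier H) \<in> ?S" by simp
    then show ?thesis using True by blast
  next
    case False
    have "\<exists>y\<in>carrier H - D. \<forall>x\<in>X. x \<preceq> y"
      using X(1) False X(2)
    proof (induction rule: finite_ne_induct)
      case (insert x X)
      then obtain y where y: "y \<in> carrier H - D" "\<forall>x\<in>X. x \<preceq> y" by auto
      have "x \<curlyvee> y \<in> carrier H - D"
        using prime_cone_join_iff[OF D] y insert by auto
      moreover have "z \<preceq> x \<curlyvee> y" if z: "z \<in> X" for z
        using po_trans[of z y "x \<curlyvee> y"] y z insert join_ub2 by auto
      ultimately show ?case
        using join_ub1[of x y] y insert by blast
    qed auto
    then obtain y where y: "y \<in> carrier H - D" "\<forall>x\<in>X. x \<preceq> y" by blast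
    then have "\<not> \<one> \<preceq> y" using l_coneD(2)[OF prime_coneD(1)[OF D]] by blast
    then obtain E where E: "prime_cone H E" "adapted V H E" "y \<notin> E"
      using V y unfolding in_variety_iff by blast
    have "x \<notin> E" if "x \<in> X" for x
      using l_cone_up[OF prime_coneD(1)[OF E(1)], of x y] E(3) y that by blast
    then have "(\<lambda>x. x \<in> E) \<in> ?S \<inter> (\<Inter>x\<in>X. {f. \<not> f x})" using E by simp
    then show ?thesis by blast
  qed
  have "?S \<inter> (\<Inter>x\<in>carrier H - D. {f. \<not> f x}) \<noteq> {}"
    using cpt closed fip by (rule compact_imp_fip_image)
  then obtain f where f: "prime_cone H {x. f x}" "adapted V H {x. f x}"
    "\<And>x. x \<in> carrier H - D \<Longrightarrow> \<not> f x" by auto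
  moreover have "{x. f x} \<subseteq> D"
    using l_coneD(1)[OF prime_coneD(1)[OF f(1)]] f(3) by blast
  ultimately show thesis using that by blast
qed

end

lemma total_cone_vimage:
  assumes "po_group G" "po_group K" "p \<in> po_hom G K" "total_cone K D"
  shows "total_cone G {a \<in> carrier G. p a \<in> D}"
proof -
  interpret G: po_grp G using assms by unfold_locales
  interpret K: po_grp K using assms by unfold_locales
  interpret group_hom G K p
    using assms(3) by unfold_locales (simp add: po_hom_def)
  have "\<one>\<^bsub>K\<^esub> \<preceq>\<^bsub>K\<^esub> p a" if "a \<in> carrier G" "\<one>\<^bsub>G\<^esub> \<preceq>\<^bsub>G\<^esub> a" for a
    using assms(3) that by (force simp: po_hom_def)
  then show ?thesis
    using assms(4) by (auto simp: total_cone_def)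
qed

lemma adapted_vimage:
  assumes "group_hom G K p" "adapted V K D"
  shows "adapted V G {a \<in> carrier G. p a \<in> D}"
proof -
  interpret group_hom G K p by fact
  show ?thesis
    using assms(2) by (cases V) simp_all
qed

lemma (in lgrp_hom) prime_cone_vimage:
  assumes "prime_cone K D"
  shows "prime_cone H {x \<in> carrier H. h x \<in> D}"
proof -
  have "h \<in> po_hom H K" using hom_mono homh by (auto simp: po_hom_def)
  then show ?thesis
    using assms total_cone_vimage[OF H.po_group K.po_group]
    by (auto simp: prime_cone_def hom_meet)
qed

text \<open>Closure of the varieties under sub-l-groups, without a case distinction: the adapted
  prime cones of \<open>H\<close> pull back to enough adapted prime cones of
  \<open>K\<close>.\<close>

lemma in_variety_inj:
  assumes "l_group K" "in_variety H V" "e \<in> l_hom K H" "inj_on e (carrier K)"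
  shows "in_variety K V"
proof -
  have "l_group H" using assms(2) by (cases V) auto
  then interpret lgrp_hom K H e using assms by unfold_locales
  show ?thesis
    unfolding H.in_variety_iff
  proof (intro ballI impI)
    fix x assume x: "x \<in> carrier K" "\<forall>D. prime_cone K D \<and> adapted V K D \<longrightarrow> x \<in> D"
    have "e x \<in> D" if "prime_cone H D" "adapted V H D" for D
      using prime_cone_vimage[OF that(1)] adapted_vimage[OF group_hom_axioms that(2)] x by blast
    then have "\<one>\<^bsub>H\<^esub> \<preceq>\<^bsub>H\<^esub> e x"
      using assms(2) x unfolding K.in_variety_iff by simp
    then show "\<one>\<^bsub>K\<^esub> \<preceq>\<^bsub>K\<^esub> x"
      using hom_le_iff[OF assms(4), of "\<one>\<^bsub>K\<^esub>" x] x by simp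
  qed
qed

section \<open>The universal property\<close>

lemma l_hom_inv_into:
  assumes "l_group H" "l_group K" "j \<in> l_hom H K" "inj_on j (carrier H)" "carrier K = j ` carrier H"
  shows "inv_into (carrier H) j \<in> l_hom K H"
proof -
  interpret lgrp_hom H K j using assms by unfold_locales
  have [simp]: "inv_into (carrier H) j (j x) = x" if "x \<in> carrier H" for x
    using assms(4) that by simp
  have "j x \<otimes>\<^bsub>K\<^esub> j y = j (x \<otimes>\<^bsub>H\<^esub> y)" "ljoin K (j x) (j y) = j (ljoin H x y)"
    "lmeet K (j x) (j y) = j (lmeet H x y)" if "x \<in> carrier H" "y \<in> carrier H" for x y
    using that by (simp_all add: hom_join hom_meet)
  then show ?thesis
    using assms(5) by (auto simp: l_hom_def hom_def simp del: hom_mult)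
qed

lemma l_hom_comp: "\<lbrakk>f \<in> l_hom H K; g \<in> l_hom K L\<rbrakk> \<Longrightarrow> (\<lambda>x. g (f x)) \<in> l_hom H L"
  by (auto simp: l_hom_def hom_def Pi_iff)

lemma po_hom_l_hom_comp:
  assumes "l_group K" "l_group L" "p \<in> po_hom G K" "g \<in> l_hom K L"
  shows "(\<lambda>x. g (p x)) \<in> po_hom G L"
proof -
  interpret lgrp_hom K L g using assms by unfold_locales
  show ?thesis
    using assms(3) by (auto simp: po_hom_def hom_def Pi_iff intro: hom_mono)
qed

lemma (in lgrp) restrict_l_hom:
  "restrict h (carrier H) \<in> l_hom H K \<longleftrightarrow> h \<in> l_hom H K"
  by (simp add: l_hom_def hom_def Pi_iff cong: conj_cong)

lemma (in lgrp) lattice_closure_idem: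
  assumes X: "subgroup X H"
  shows "lattice_closure (H\<lparr>carrier := lattice_closure H X\<rparr>) X = lattice_closure H X"
    (is "lattice_closure ?L X = _")
proof
  note L = l_subgroup_l_group[OF l_subgroup_lattice_closure[OF X]]
  interpret L: lgrp ?L using L(1) by unfold_locales
  show "lattice_closure ?L X \<subseteq> lattice_closure H X"
    using L.lattice_closure_least[OF L.l_subgroup_carrier, of X] by (auto intro: lattice_closure.gen)
  show "lattice_closure H X \<subseteq> lattice_closure ?L X"
  proof
    fix x assume "x \<in> lattice_closure H X"
    then show "x \<in> lattice_closure ?L X"
    proof induct
      case (join x y)
      then show ?case using lattice_closure.join[OF join(2,4)] L(2) by simp
    next
      case (meet x y)
      then show ?case using lattice_closure.meet[OF meet(2,4)] L(3) by simp
    qed (rule lattice_closure.gen)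
  qed
qed

lemma in_varietyD: "in_variety H V \<Longrightarrow> l_group H"
  by (cases V) auto

text \<open>Lattice operations suffice to reach every element of the l-subgroup generated by the
  image of a group, since this image is a subgroup.\<close>

datatype 'g lterm = Gen 'g | Join "'g lterm" "'g lterm" | Meet "'g lterm" "'g lterm"

primrec eval_lterm :: "'a po_group \<Rightarrow> ('g \<Rightarrow> 'a) \<Rightarrow> 'g lterm \<Rightarrow> 'a" where
  "eval_lterm H p (Gen a) = p a"
| "eval_lterm H p (Join s t) = ljoin H (eval_lterm H p s) (eval_lterm H p t)"
| "eval_lterm H p (Meet s t) = lmeet H (eval_lterm H p s) (eval_lterm H p t)"

lemma ex_lterm: "x \<in> lattice_closure H (p ` A) \<Longrightarrow> \<exists>t. eval_lterm H p t = x"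
proof (induct rule: lattice_closure.induct)
  case (gen x)
  then show ?case by (metis eval_lterm.simps(1) imageE)
next
  case (join x y)
  then show ?case by (metis eval_lterm.simps(2))
next
  case (meet x y)
  then show ?case by (metis eval_lterm.simps(3))
qed

text \<open>A prefix code. It embeds every l-group generated by an image of \<open>G\<close> into the type of lists over
  which the targets \<open>K\<close> of the universal property range.\<close>

primrec code :: "'g lterm \<Rightarrow> ('f + 'g) list" where
  "code (Gen a) = [Inr a]"
| "code (Join s t) = Inl undefined # Inl undefined # code s @ code t"
| "code (Meet s t) = Inl undefined # Inr undefined # code s @ code t"

lemma code_prefix: "code s @ r = code s' @ r' \<Longrightarrow> s = s' \<and> r = r'"
proof (induct s arbitrary: s' r r')
  case (Gen a)
  then show ?case by (cases s') auto
next
  case (Join s t)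
  show ?case
  proof (cases s')
    case (Join u v)
    then have "code s @ code t @ r = code u @ code v @ r'" using Join.prems by simp
    from Join.hyps(1)[OF this] have "s = u" and "code t @ r = code v @ r'" by simp_all
    with Join.hyps(2) \<open>s' = Join u v\<close> show ?thesis by blast
  qed (use Join.prems in simp_all)
next
  case (Meet s t)
  show ?case
  proof (cases s')
    case (Meet u v)
    then have "code s @ code t @ r = code u @ code v @ r'" using Meet.prems by simp
    from Meet.hyps(1)[OF this] have "s = u" and "code t @ r = code v @ r'" by simp_all
    with Meet.hyps(2) \<open>s' = Meet u v\<close> show ?thesis by blast
  qed (use Meet.prems in simp_all)
qed

lemma ex_inj_lattice_closure:
  "\<exists>j :: 'a \<Rightarrow> ('f + 'g) list. inj_on j (lattice_closure H ((p :: 'g \<Rightarrow> 'a) ` A))"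
proof -
  obtain \<tau> where \<tau>: "\<And>x. x \<in> lattice_closure H (p ` A) \<Longrightarrow> eval_lterm H p (\<tau> x) = x"
    using ex_lterm[of _ H p A] by metis
  have "inj_on (\<lambda>x. code (\<tau> x) :: ('f + 'g) list) (lattice_closure H (p ` A))"
  proof (rule inj_onI)
    fix x y assume xy: "x \<in> lattice_closure H (p ` A)" "y \<in> lattice_closure H (p ` A)"
      "code (\<tau> x) = (code (\<tau> y) :: ('f + 'g) list)"
    then have "\<tau> x = \<tau> y" using code_prefix[of "\<tau> x" "[]" "\<tau> y" "[]"] by simp
    then show "x = y" using \<tau>[OF xy(1)] \<tau>[OF xy(2)] by metis
  qed
  then show ?thesis by blast
qed

section \<open>Free l-groups: targets of arbitrary type, and generation by the image of G\<close>

locale free_lgrp = po_grp G for V and G :: "'g po_group" (structure) +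
  fixes F :: "'f po_group" and \<eta> :: "'g \<Rightarrow> 'f"
  assumes free: "free_lgroup_over V G F \<eta>"
begin

lemma F_in_variety: "in_variety F V"
  and \<eta>: "\<eta> \<in> po_hom G F"
  using free by (simp_all add: free_lgroup_over_def)

sublocale F: lgrp F
  using in_varietyD[OF F_in_variety] by unfold_locales

sublocale \<eta>: group_hom G F \<eta>
  using \<eta> by unfold_locales (simp add: po_hom_def)

lemma ex1_hom:
  fixes K :: "('f + 'g) list po_group"
  assumes "in_variety K V" "p \<in> po_hom G K"
  shows "\<exists>!h. h \<in> extensional (carrier F) \<and> h \<in> l_hom F K \<and> (\<forall>a\<in>carrier G. h (\<eta> a) = p a)"
  using free assms by (auto simp: free_lgroup_over_def)

text \<open>This lifts the type restriction in the universal property. A target generated by the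
  image of \<open>G\<close> has a copy \<open>K'\<close> on lists; the homomorphism into the copy is
  followed by the inverse of the copying map.\<close>

lemma ex_hom:
  assumes K: "in_variety K V" and p: "p \<in> po_hom G K"
    and gen: "carrier K = lattice_closure K (p ` carrier G)"
  shows "\<exists>h\<in>l_hom F K. \<forall>a\<in>carrier G. h (\<eta> a) = p a"
proof -
  interpret K: lgrp K using in_varietyD[OF K] by unfold_locales
  obtain j :: "_ \<Rightarrow> ('f + 'g) list" where inj: "inj_on j (carrier K)"
    using ex_inj_lattice_closure[of K p "carrier G"] gen by auto
  obtain K' where K': "l_group K'" "j \<in> l_hom K K'" "carrier K' = j ` carrier K"
    using K.ex_l_copy[OF inj] by blast
  let ?e = "inv_into (carrier K) j"
  have e: "?e \<in> l_hom K' K"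
    using l_hom_inv_into[OF K.l_group K'(1,2) inj K'(3)] .
  have "in_variety K' V"
    by (rule in_variety_inj[OF K'(1) K e]) (simp add: K'(3) inj_on_inv_into)
  from ex1_hom[OF this po_hom_l_hom_comp[OF K.l_group K'(1) p K'(2)]]
  obtain h where h: "h \<in> l_hom F K'" "\<And>a. a \<in> carrier G \<Longrightarrow> h (\<eta> a) = j (p a)" by blast
  have "p a \<in> carrier K" if "a \<in> carrier G" for a
    using p that by (auto simp: po_hom_def hom_def)
  then show ?thesis
    using l_hom_comp[OF h(1) e] h(2) inj by (intro bexI[of _ "\<lambda>x. ?e (h x)"]) auto
qed

lemma carrier_F: "carrier F = lattice_closure F (\<eta> ` carrier G)" (is "_ = ?L")
proof -
  have sub: "l_subgroup ?L F"
    using F.l_subgroup_lattice_closure[OF \<eta>.img_is_subgroup] .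
  note L = F.l_subgroup_l_group[OF sub] F.l_subgroupD[OF sub]
  let ?FL = "F\<lparr>carrier := ?L\<rparr>"
  have id: "(\<lambda>x. x) \<in> l_hom ?FL F"
    using L by (auto simp: l_hom_def hom_def)
  have V: "in_variety ?FL V"
    by (rule in_variety_inj[OF L(1) F_in_variety id]) (simp add: inj_on_def)
  have \<eta>L: "\<eta> ` carrier G \<subseteq> ?L" by (auto intro: lattice_closure.gen)
  then have p: "\<eta> \<in> po_hom G ?FL"
    using \<eta> by (auto simp: po_hom_def hom_def)
  have "carrier ?FL = lattice_closure ?FL (\<eta> ` carrier G)"
    using F.lattice_closure_idem[OF \<eta>.img_is_subgroup] by simp
  then obtain h where h: "h \<in> l_hom F ?FL" "\<And>a. a \<in> carrier G \<Longrightarrow> h (\<eta> a) = \<eta> a"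
    using ex_hom[OF V p] by blast
  \<comment> \<open>Uniqueness is available for targets on lists only, so \<open>h\<close> is
    compared with the identity of \<open>F\<close> after embedding \<open>F\<close> there.\<close>
  let ?j = "\<lambda>x. [Inl x] :: ('f + 'g) list"
  have inj: "inj_on ?j (carrier F)" by (simp add: inj_on_def)
  obtain K where K: "l_group K" "?j \<in> l_hom F K" "carrier K = ?j ` carrier F"
    using F.ex_l_copy[OF inj] by blast
  have "in_variety K V"
    by (rule in_variety_inj[OF K(1) F_in_variety l_hom_inv_into[OF F.l_group K(1,2) inj K(3)]])
      (simp add: K(3) inj_on_inv_into)
  from ex1_hom[OF this po_hom_l_hom_comp[OF F.l_group K(1) \<eta> K(2)]]
  have ex1: "\<exists>!h. h \<in> extensional (carrier F) \<and> h \<in> l_hom F K \<and> (\<forall>a\<in>carrier G. h (\<eta> a) = ?j (\<eta> a))" .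
  have "(\<lambda>x. ?j (h x)) \<in> l_hom F K"
    using l_hom_comp[OF l_hom_comp[OF h(1) id] K(2)] .
  moreover obtain h0 where h0: "\<And>f. \<lbrakk>f \<in> extensional (carrier F); f \<in> l_hom F K;
      \<And>a. a \<in> carrier G \<Longrightarrow> f (\<eta> a) = ?j (\<eta> a)\<rbrakk> \<Longrightarrow> f = h0"
    using ex1 by (elim ex1E) blast
  ultimately have "restrict (\<lambda>x. ?j (h x)) (carrier F) = h0"
    using h(2) by (intro h0) (simp_all add: F.restrict_l_hom)
  moreover have "restrict ?j (carrier F) = h0"
    using K(2) by (intro h0) (simp_all add: F.restrict_l_hom)
  ultimately have "restrict (\<lambda>x. ?j (h x)) (carrier F) = restrict ?j (carrier F)" by simp
  then have "h x = x" if "x \<in> carrier F" for x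
    using that by (metis (no_types, lifting) list.inject restrict_apply' sum.inject(1))
  then have "carrier F \<subseteq> ?L"
    using l_homD(2)[OF h(1)] by force
  then show ?thesis using L(5) by blast
qed

end

text \<open>Membership in a prime cone commutes with the lattice operations, so an inclusion on
  generators propagates by induction. For \<open>F\<close> it gives both uniqueness of extensions of
  a cone of \<open>G\<close> and their monotonicity.\<close>

lemma (in lgrp) prime_cone_lattice_closure_mono:
  assumes "prime_cone H D" "prime_cone H E" "X \<subseteq> carrier H" "D \<inter> X \<subseteq> E"
  shows "D \<inter> lattice_closure H X \<subseteq> E"
proof -
  have cl: "lattice_closure H X \<subseteq> carrier H"
    using lattice_closure_least[OF l_subgroup_carrier assms(3)] .
  have "x \<in> D \<longrightarrow> x \<in> E" if "x \<in> lattice_closure H X" for x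
    using that
  proof induct
    case (join x y)
    then show ?case
      using prime_cone_join_iff[OF assms(1)] prime_cone_join_iff[OF assms(2)] cl by blast
  next
    case (meet x y)
    then show ?case
      using prime_cone_meet_iff[OF assms(1)] prime_cone_meet_iff[OF assms(2)] cl by blast
  qed (use assms(4) in blast)
  then show ?thesis by blast
qed

section \<open>Automorphisms of chains\<close>

locale chain =
  fixes A :: "'x set" and r :: "'x \<Rightarrow> 'x \<Rightarrow> bool"
  assumes antisym: "\<lbrakk>r x y; r y x; x \<in> A; y \<in> A\<rbrakk> \<Longrightarrow> x = y"
    and trans: "\<lbrakk>r x y; r y z; x \<in> A; y \<in> A; z \<in> A\<rbrakk> \<Longrightarrow> r x z"
    and total: "\<lbrakk>x \<in> A; y \<in> A\<rbrakk> \<Longrightarrow> r x y \<or> r y x"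
begin

abbreviation "K \<equiv> chain_aut A r"

lemma refl: "x \<in> A \<Longrightarrow> r x x"
  using total by blast

text \<open>On a chain a monotone injection also reflects the order. The equivalence on the right
  therefore makes inverses monotone at once and yields injectivity.\<close>

lemma carrier_chain_aut_iff:
  "f \<in> carrier K \<longleftrightarrow> f \<in> extensional A \<and> f ` A = A \<and> (\<forall>x\<in>A. \<forall>y\<in>A. r (f x) (f y) \<longleftrightarrow> r x y)"
  (is "_ \<longleftrightarrow> ?R")
proof
  assume f: "f \<in> carrier K"
  then have fA: "f ` A = A" and inj: "inj_on f A"
    by (auto simp: chain_aut_def Bij_def bij_betw_def)
  have "r x y" if "x \<in> A" "y \<in> A" "r (f x) (f y)" for x y
  proof (rule ccontr)
    assume n: "\<not> r x y"
    then have "r (f y) (f x)" using f total that by (auto simp: chain_aut_def)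
    then have "f x = f y" using antisym that fA by blast
    then show False using inj n refl that by (auto dest: inj_onD)
  qed
  then show ?R using f fA by (auto simp: chain_aut_def Bij_def)
next
  assume R: ?R
  then have "inj_on f A" using refl antisym by (metis inj_onI)
  then show "f \<in> carrier K" using R by (auto simp: chain_aut_def Bij_def bij_betw_def)
qed

lemma chain_autD:
  assumes "f \<in> carrier K"
  shows "f \<in> extensional A" "f ` A = A" "\<And>x. x \<in> A \<Longrightarrow> f x \<in> A"
    "\<And>x y. \<lbrakk>x \<in> A; y \<in> A\<rbrakk> \<Longrightarrow> r (f x) (f y) \<longleftrightarrow> r x y"
  using assms by (auto simp: carrier_chain_aut_iff)

lemma mult_chain_aut: "x \<in> A \<Longrightarrow> (f \<otimes>\<^bsub>K\<^esub> g) x = g (f x)"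
  by (simp add: chain_aut_def compose_def)

lemma one_chain_aut: "x \<in> A \<Longrightarrow> \<one>\<^bsub>K\<^esub> x = x"
  by (simp add: chain_aut_def)

lemma le_chain_aut: "f \<preceq>\<^bsub>K\<^esub> g \<longleftrightarrow> (\<forall>x\<in>A. r (f x) (g x))"
  by (simp add: chain_aut_def)

lemma chain_aut_eqI:
  "\<lbrakk>f \<in> carrier K; g \<in> carrier K; \<And>x. x \<in> A \<Longrightarrow> f x = g x\<rbrakk> \<Longrightarrow> f = g"
  using chain_autD(1) by (blast intro: extensionalityI)

lemma mult_closed:
  assumes f: "f \<in> carrier K" and g: "g \<in> carrier K"
  shows "f \<otimes>\<^bsub>K\<^esub> g \<in> carrier K"
proof -
  have "(f \<otimes>\<^bsub>K\<^esub> g) ` A = (\<lambda>x. g (f x)) ` A"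
    by (rule image_cong) (simp_all add: mult_chain_aut)
  also have "\<dots> = A"
    using chain_autD(2)[OF f] chain_autD(2)[OF g] by (simp add: image_image[symmetric])
  finally show ?thesis
    unfolding carrier_chain_aut_iff
    using chain_autD(3,4)[OF f] chain_autD(3,4)[OF g]
    by (auto simp: mult_chain_aut) (simp add: chain_aut_def)
qed

lemma one_closed: "\<one>\<^bsub>K\<^esub> \<in> carrier K"
  by (simp add: chain_aut_def id_Bij)

lemma group_chain_aut: "group K"
proof (rule groupI)
  fix f assume f: "f \<in> carrier K"
  then have bij: "bij_betw f A A" by (auto simp: chain_aut_def Bij_def)
  let ?g = "\<lambda>x\<in>A. inv_into A f x"
  have g: "?g x \<in> A \<and> f (?g x) = x" if "x \<in> A" for x
    using bij that by (simp add: bij_betw_inv_into_right bij_betw_def inv_into_into)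
  have "?g ` A = A"
    using bij_betw_inv_into[OF bij] by (simp add: bij_betw_def)
  moreover have "r (?g x) (?g y) \<longleftrightarrow> r x y" if "x \<in> A" "y \<in> A" for x y
    using chain_autD(4)[OF f, of "?g x" "?g y"] g that by metis
  ultimately have gK: "?g \<in> carrier K"
    unfolding carrier_chain_aut_iff by blast
  moreover have "?g \<otimes>\<^bsub>K\<^esub> f = \<one>\<^bsub>K\<^esub>"
    using g by (intro chain_aut_eqI mult_closed gK f one_closed) (simp add: mult_chain_aut one_chain_aut)
  ultimately show "\<exists>g\<in>carrier K. g \<otimes>\<^bsub>K\<^esub> f = \<one>\<^bsub>K\<^esub>" by blast
qed (auto intro!: chain_aut_eqI simp: mult_closed one_closed mult_chain_aut one_chain_aut chain_autD(3))

lemma po_group_chain_aut: "po_group K"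
proof (rule po_groupI[OF group_chain_aut])
  show "\<And>f. f \<in> carrier K \<Longrightarrow> f \<preceq>\<^bsub>K\<^esub> f"
    by (simp add: le_chain_aut refl chain_autD(3))
  show "\<And>f g. \<lbrakk>f \<preceq>\<^bsub>K\<^esub> g; g \<preceq>\<^bsub>K\<^esub> f; f \<in> carrier K; g \<in> carrier K\<rbrakk> \<Longrightarrow> f = g"
    by (rule chain_aut_eqI) (auto simp: le_chain_aut chain_autD(3) intro: antisym)
  show "\<And>f g h. \<lbrakk>f \<preceq>\<^bsub>K\<^esub> g; g \<preceq>\<^bsub>K\<^esub> h; f \<in> carrier K; g \<in> carrier K; h \<in> carrier K\<rbrakk> \<Longrightarrow> f \<preceq>\<^bsub>K\<^esub> h"
    unfolding le_chain_aut by (meson chain_autD(3) trans)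
  show "\<And>f g s t. \<lbrakk>f \<preceq>\<^bsub>K\<^esub> g; f \<in> carrier K; g \<in> carrier K; s \<in> carrier K; t \<in> carrier K\<rbrakk>
      \<Longrightarrow> s \<otimes>\<^bsub>K\<^esub> f \<otimes>\<^bsub>K\<^esub> t \<preceq>\<^bsub>K\<^esub> s \<otimes>\<^bsub>K\<^esub> g \<otimes>\<^bsub>K\<^esub> t"
    by (simp add: le_chain_aut mult_chain_aut chain_autD(3,4))
qed

definition sup_fun where "sup_fun f g = (\<lambda>x\<in>A. if r (f x) (g x) then g x else f x)"

lemma sup_fun_closed:
  assumes f: "f \<in> carrier K" and g: "g \<in> carrier K"
  shows "sup_fun f g \<in> carrier K"
proof -
  let ?s = "sup_fun f g"
  note F = chain_autD[OF f] and G = chain_autD[OF g]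
  have sA: "?s x \<in> A" if "x \<in> A" for x using that F G by (simp add: sup_fun_def)
  have ub: "r (f x) (?s x)" "r (g x) (?s x)" if "x \<in> A" for x
    using that total[of "f x" "g x"] refl F(3) G(3) by (auto simp: sup_fun_def)
  have eq: "?s x = f x \<or> ?s x = g x" if "x \<in> A" for x using that by (simp add: sup_fun_def)
  have mono: "r (?s x) (?s y)" if xy: "x \<in> A" "y \<in> A" "r x y" for x y
  proof -
    have "r (f x) (?s y)" "r (g x) (?s y)"
      using trans[of "f x" "f y" "?s y"] trans[of "g x" "g y" "?s y"] xy F(3,4) G(3,4) sA ub by auto
    then show ?thesis using eq[OF xy(1)] by auto
  qed
  have refl': "r x y" if xy: "x \<in> A" "y \<in> A" "r (?s x) (?s y)" for x y
  proof (rule ccontr)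
    assume n: "\<not> r x y"
    then have "r y x" "x \<noteq> y" using total refl xy by blast+
    then have "?s x = ?s y" using mono antisym sA xy by blast
    have "r (f x) (?s y)" "r (g x) (?s y)"
      using ub[OF xy(1)] \<open>?s x = ?s y\<close> by simp_all
    then have "r (f x) (f y) \<or> r (g x) (g y)"
      using eq[OF xy(2)] by auto
    then show False using F(4) G(4) xy n by blast
  qed
  \<comment> \<open>Let y be f a and g b. At the smaller of a and b one function takes the value y
    and the other a value at most y, so the pointwise maximum is y there.\<close>
  have "y \<in> ?s ` A" if y: "y \<in> A" for y
  proof -
    obtain a where a: "a \<in> A" "f a = y" using F(2) y by (metis imageE)
    obtain b where b: "b \<in> A" "g b = y" using G(2) y by (metis imageE)
    show ?thesis
    proof (cases "r a b")
      case True
      then have "r (g a) (f a)" using G(4)[of a b] a b by simp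
      then have "?s a = y" using a antisym[of "f a" "g a"] F(3) G(3) by (auto simp: sup_fun_def)
      then show ?thesis using a by blast
    next
      case False
      then have "r (f b) (g b)" using total[of a b] F(4)[of b a] a b by simp
      then have "?s b = y" using b by (auto simp: sup_fun_def)
      then show ?thesis using b by blast
    qed
  qed
  then have "?s ` A = A" using sA by blast
  moreover have "?s \<in> extensional A" by (simp add: sup_fun_def)
  ultimately show ?thesis
    using mono refl' unfolding carrier_chain_aut_iff by blast
qed

lemma sup_fun_lub:
  assumes f: "f \<in> carrier K" and g: "g \<in> carrier K"
  shows "f \<preceq>\<^bsub>K\<^esub> sup_fun f g" "g \<preceq>\<^bsub>K\<^esub> sup_fun f g"
    "\<lbrakk>f \<preceq>\<^bsub>K\<^esub> h; g \<preceq>\<^bsub>K\<^esub> h\<rbrakk> \<Longrightarrow> sup_fun f g \<preceq>\<^bsub>K\<^esub> h"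
proof -
  show "f \<preceq>\<^bsub>K\<^esub> sup_fun f g" "g \<preceq>\<^bsub>K\<^esub> sup_fun f g"
    using total[of "f x" "g x" for x] refl chain_autD(3)[OF f] chain_autD(3)[OF g]
    unfolding le_chain_aut sup_fun_def by auto
qed (simp add: le_chain_aut sup_fun_def)

lemma l_group_chain_aut: "l_group K"
proof (rule l_groupI[OF po_group_chain_aut])
  interpret K: po_grp K using po_group_chain_aut by unfold_locales
  fix f g assume fg: "f \<in> carrier K" "g \<in> carrier K"
  show "\<exists>s\<in>carrier K. f \<preceq>\<^bsub>K\<^esub> s \<and> g \<preceq>\<^bsub>K\<^esub> s \<and>
      (\<forall>z\<in>carrier K. f \<preceq>\<^bsub>K\<^esub> z \<longrightarrow> g \<preceq>\<^bsub>K\<^esub> z \<longrightarrow> s \<preceq>\<^bsub>K\<^esub> z)"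
    by (rule bexI[of _ "sup_fun f g"]) (simp_all add: fg sup_fun_closed sup_fun_lub)
  \<comment> \<open>Inversion reverses the order, so the inverse of the join of the inverses is the
    meet.\<close>
  let ?s = "sup_fun (inv\<^bsub>K\<^esub> f) (inv\<^bsub>K\<^esub> g)"
  have s: "?s \<in> carrier K" using fg by (simp add: sup_fun_closed)
  show "\<exists>s\<in>carrier K. s \<preceq>\<^bsub>K\<^esub> f \<and> s \<preceq>\<^bsub>K\<^esub> g \<and>
      (\<forall>z\<in>carrier K. z \<preceq>\<^bsub>K\<^esub> f \<longrightarrow> z \<preceq>\<^bsub>K\<^esub> g \<longrightarrow> z \<preceq>\<^bsub>K\<^esub> s)"
  proof (intro bexI[of _ "inv\<^bsub>K\<^esub> ?s"] conjI ballI impI)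
    show "inv\<^bsub>K\<^esub> ?s \<preceq>\<^bsub>K\<^esub> f" "inv\<^bsub>K\<^esub> ?s \<preceq>\<^bsub>K\<^esub> g"
      using sup_fun_lub(1,2)[of "inv\<^bsub>K\<^esub> f" "inv\<^bsub>K\<^esub> g"] fg s
        K.po_inv_le_iff[of ?s f] K.po_inv_le_iff[of ?s g] by auto
    fix z assume z: "z \<in> carrier K" "z \<preceq>\<^bsub>K\<^esub> f" "z \<preceq>\<^bsub>K\<^esub> g"
    then have "?s \<preceq>\<^bsub>K\<^esub> inv\<^bsub>K\<^esub> z"
      using fg by (intro sup_fun_lub(3)) (simp_all add: K.po_inv)
    then show "z \<preceq>\<^bsub>K\<^esub> inv\<^bsub>K\<^esub> ?s"
      using K.po_le_inv_iff[of z ?s] z s by simp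
  qed (use s in simp)
qed

lemma inv_chain_aut_le:
  assumes f: "f \<in> carrier K" and x: "x \<in> A"
  shows "r ((inv\<^bsub>K\<^esub> f) x) x \<longleftrightarrow> r x (f x)"
proof -
  interpret K: group K using group_chain_aut .
  let ?g = "inv\<^bsub>K\<^esub> f"
  have g: "?g \<in> carrier K" using f by simp
  have "f (?g x) = x"
    using mult_chain_aut[OF x, of ?g f] one_chain_aut[OF x] f by simp
  then show ?thesis
    using chain_autD(4)[OF f, of "?g x" x] chain_autD(3)[OF g x] x by simp
qed

text \<open>The prime l-subgroup that belongs to this cone is the stabilizer of x in
  \<open>S\<close>.\<close>

lemma chain_stabilizer:
  assumes x: "x \<in> A" and S: "l_subgroup S K"
  shows "prime_cone (K\<lparr>carrier := S\<rparr>) {f \<in> S. r x (f x)}"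
proof -
  interpret K: lgrp K using l_group_chain_aut by unfold_locales
  note SD = K.l_subgroupD[OF S] and SL = K.l_subgroup_l_group[OF S]
  interpret SS: lgrp "K\<lparr>carrier := S\<rparr>" using SL(1) by unfold_locales
  have inv: "r ((inv\<^bsub>K\<^esub> f) x) x \<longleftrightarrow> r x (f x)" if "f \<in> S" for f
    using inv_chain_aut_le[OF _ x] that SD(1) by blast
  have cl: "f \<in> carrier K" if "f \<in> S" for f using that SD(1) by blast
  have join: "ljoin K f g x \<in> {f x, g x}" if "f \<in> carrier K" "g \<in> carrier K" for f g
  proof -
    have "ljoin K f g = sup_fun f g"
      using that sup_fun_closed sup_fun_lub by (intro K.join_eqI) auto
    then show ?thesis using x by (simp add: sup_fun_def)
  qed
  have mult: "r x (g (f x))" if "f \<in> S" "g \<in> S" "r x (f x)" "r x (g x)" for f g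
    using trans[of x "g x" "g (f x)"] that x chain_autD(3,4)[OF cl] by simp
  \<comment> \<open>Only joins have been evaluated pointwise, through \<open>sup_fun\<close>; a meet
    is treated as the inverse of a join of inverses.\<close>
  have meet: "r x (lmeet K f g x)" if fg: "f \<in> S" "g \<in> S" "r x (f x)" "r x (g x)" for f g
  proof -
    have "r (ljoin K (inv\<^bsub>K\<^esub> f) (inv\<^bsub>K\<^esub> g) x) x"
      using join[of "inv\<^bsub>K\<^esub> f" "inv\<^bsub>K\<^esub> g"] fg inv cl by auto
    then have "r ((inv\<^bsub>K\<^esub> (lmeet K f g)) x) x"
      using fg cl by (simp add: K.inv_meet)
    then show ?thesis using inv SD(6) fg by blast
  qed
  have "r x (f x) \<or> r x ((inv\<^bsub>K\<^esub> f) x)" if f: "f \<in> S" for f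
    using inv[OF f] total[OF x, of "(inv\<^bsub>K\<^esub> f) x"] x chain_autD(3) SD(4) f cl by blast
  then show ?thesis
    unfolding SS.prime_cone_iff SS.l_cone_def
    using SD SL x mult meet by (auto simp: mult_chain_aut le_chain_aut one_chain_aut)
qed

end

section \<open>The action of a group on the chain of a right pre-order\<close>

text \<open>Because multiplication distributes over the lattice operations, the elements commuting
  with a fixed s form a sublattice. This is applied twice, first with s a generator and then with s
  an arbitrary element of the closure.\<close>

lemma (in lgrp) lattice_closure_commute:
  assumes X: "X \<subseteq> carrier H" and comm: "\<And>x y. \<lbrakk>x \<in> X; y \<in> X\<rbrakk> \<Longrightarrow> x \<otimes> y = y \<otimes> x"
    and xy: "x \<in> lattice_closure H X" "y \<in> lattice_closure H X"
  shows "x \<otimes> y = y \<otimes> x"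
proof -
  have cl: "lattice_closure H X \<subseteq> carrier H"
    using lattice_closure_least[OF l_subgroup_carrier X] .
  have *: "x \<otimes> s = s \<otimes> x"
    if x: "x \<in> lattice_closure H X" and s: "s \<in> carrier H" and "\<And>z. z \<in> X \<Longrightarrow> z \<otimes> s = s \<otimes> z" for x s
    using x
  proof induct
    case (join x y)
    then have "x \<in> carrier H" "y \<in> carrier H" using cl by auto
    then show ?case using join s by (simp add: join_mult mult_join)
  next
    case (meet x y)
    then have "x \<in> carrier H" "y \<in> carrier H" using cl by auto
    then show ?case using meet s by (simp add: meet_mult mult_meet)
  qed (use that in simp)
  have "z \<otimes> y = y \<otimes> z" if "z \<in> X" for z
    using *[OF xy(2), of z] comm that X by auto
  then show ?thesis using *[OF xy(1), of y] xy cl by auto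
qed

locale cone = po_grp +
  fixes C
  assumes total_cone: "total_cone G C"
begin

lemma C_closed: "x \<in> C \<Longrightarrow> x \<in> carrier G"
  and C_pos: "\<lbrakk>x \<in> carrier G; \<one> \<preceq> x\<rbrakk> \<Longrightarrow> x \<in> C"
  and C_mult: "\<lbrakk>x \<in> C; y \<in> C\<rbrakk> \<Longrightarrow> x \<otimes> y \<in> C"
  and C_total: "x \<in> carrier G \<Longrightarrow> x \<in> C \<or> inv x \<in> C"
  using total_cone by (auto simp: total_cone_def)

lemma one_C: "\<one> \<in> C"
  by (simp add: C_pos)

abbreviation le where "le a b \<equiv> (a, b) \<in> cone_rel G C"
abbreviation cls where "cls b \<equiv> cone_equiv G C `` {b}"
abbreviation Rm where "Rm \<equiv> right_mult G C"
abbreviation "HC \<equiv> H_group G C"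

lemma le_iff: "le a b \<longleftrightarrow> a \<in> carrier G \<and> b \<in> carrier G \<and> b \<otimes> inv a \<in> C"
  by (simp add: cone_rel_def)

lemma le_refl: "a \<in> carrier G \<Longrightarrow> le a a"
  by (simp add: le_iff one_C)

lemma le_trans: "\<lbrakk>le a b; le b c\<rbrakk> \<Longrightarrow> le a c"
  using C_mult[of "c \<otimes> inv b" "b \<otimes> inv a"]
  by (simp add: le_iff m_assoc[symmetric] mult_inv_cancel)

lemma le_total: "\<lbrakk>a \<in> carrier G; b \<in> carrier G\<rbrakk> \<Longrightarrow> le a b \<or> le b a"
  using C_total[of "b \<otimes> inv a"] by (auto simp: le_iff inv_mult_group)

lemma le_mult_iff:
  assumes "a \<in> carrier G" "b \<in> carrier G" "t \<in> carrier G"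
  shows "le (a \<otimes> t) (b \<otimes> t) \<longleftrightarrow> le a b"
proof -
  have "b \<otimes> t \<otimes> inv (a \<otimes> t) = b \<otimes> inv a"
    using assms by (simp add: inv_mult_group m_assoc mult_inv_cancel)
  then show ?thesis using assms by (simp add: le_iff)
qed

lemma equiv_iff: "(a, b) \<in> cone_equiv G C \<longleftrightarrow> le a b \<and> le b a"
  by (simp add: cone_equiv_def)

lemma cls_eq_iff: "\<lbrakk>a \<in> carrier G; b \<in> carrier G\<rbrakk> \<Longrightarrow> cls a = cls b \<longleftrightarrow> le a b \<and> le b a"
  using le_refl by (auto simp: equiv_iff intro: le_trans)

lemma Omega_eq: "Omega G C = cls ` carrier G"
  by (auto simp: Omega_def quotient_def)

lemma Omega_le_iff:
  assumes "a \<in> carrier G" "b \<in> carrier G"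
  shows "Omega_le G C (cls a) (cls b) \<longleftrightarrow> le a b"
proof
  assume "Omega_le G C (cls a) (cls b)"
  then show "le a b"
    by (auto simp: Omega_le_def equiv_iff) (meson le_trans)
next
  assume "le a b"
  then show "Omega_le G C (cls a) (cls b)"
    using le_refl assms unfolding Omega_le_def by (intro bexI[of _ a] bexI[of _ b]) (auto simp: equiv_iff)
qed

sublocale chain "Omega G C" "Omega_le G C"
proof
  fix X Y Z assume XY: "X \<in> Omega G C" "Y \<in> Omega G C"
  then obtain a b where ab: "a \<in> carrier G" "b \<in> carrier G" "X = cls a" "Y = cls b"
    by (auto simp: Omega_eq)
  show "Omega_le G C X Y \<or> Omega_le G C Y X"
    using ab le_total by (simp add: Omega_le_iff)
  show "X = Y" if "Omega_le G C X Y" "Omega_le G C Y X"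
    using that ab by (simp add: Omega_le_iff cls_eq_iff)
  assume "Z \<in> Omega G C"
  then obtain c where "c \<in> carrier G" "Z = cls c" by (auto simp: Omega_eq)
  then show "Omega_le G C X Z" if "Omega_le G C X Y" "Omega_le G C Y Z"
    using that ab le_trans by (simp add: Omega_le_iff)
qed

sublocale K: lgrp K
  using l_group_chain_aut by unfold_locales

lemma Rm_cls:
  assumes "a \<in> carrier G" "b \<in> carrier G"
  shows "Rm a (cls b) = cls (b \<otimes> a)"
proof -
  have "cone_equiv G C `` ((\<lambda>b. b \<otimes> a) ` cls b) = cls (b \<otimes> a)"
  proof
    show "cone_equiv G C `` ((\<lambda>b. b \<otimes> a) ` cls b) \<subseteq> cls (b \<otimes> a)"
    proof
      fix x assume "x \<in> cone_equiv G C `` ((\<lambda>b. b \<otimes> a) ` cls b)"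
      then obtain c where c: "le b c" "le c b" "le (c \<otimes> a) x" "le x (c \<otimes> a)"
        by (auto simp: equiv_iff)
      then have "le (b \<otimes> a) (c \<otimes> a)" "le (c \<otimes> a) (b \<otimes> a)"
        using assms le_mult_iff le_iff by auto
      then show "x \<in> cls (b \<otimes> a)"
        using le_trans[OF _ c(3)] le_trans[OF c(4)] by (simp add: equiv_iff)
    qed
    show "cls (b \<otimes> a) \<subseteq> cone_equiv G C `` ((\<lambda>b. b \<otimes> a) ` cls b)"
      using assms le_refl by (auto simp: equiv_iff)
  qed
  then show ?thesis
    using assms by (simp add: right_mult_def Omega_eq)
qed

lemma Rm_closed: "a \<in> carrier G \<Longrightarrow> Rm a \<in> carrier K"
  unfolding carrier_chain_aut_iff
proof (intro conjI)
  assume a: "a \<in> carrier G"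
  show "Rm a \<in> extensional (Omega G C)" by (simp add: right_mult_def)
  have "b \<in> carrier G \<Longrightarrow> b = b \<otimes> inv a \<otimes> a" for b using a by (simp add: mult_inv_cancel)
  then have "(\<lambda>b. b \<otimes> a) ` carrier G = carrier G"
    using a by (auto simp: image_iff intro!: bexI[of _ "_ \<otimes> inv a"])
  moreover have "Rm a ` Omega G C = cls ` (\<lambda>b. b \<otimes> a) ` carrier G"
    using a by (auto simp: Omega_eq Rm_cls image_image)
  ultimately show "Rm a ` Omega G C = Omega G C"
    by (simp add: Omega_eq)
  show "\<forall>x\<in>Omega G C. \<forall>y\<in>Omega G C. Omega_le G C (Rm a x) (Rm a y) \<longleftrightarrow> Omega_le G C x y"
    using a by (auto simp: Omega_eq Rm_cls Omega_le_iff le_mult_iff)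
qed

lemma Rm_mult:
  assumes "a \<in> carrier G" "b \<in> carrier G"
  shows "Rm (a \<otimes> b) = Rm a \<otimes>\<^bsub>K\<^esub> Rm b"
proof (rule chain_aut_eqI)
  fix x assume x: "x \<in> Omega G C"
  then obtain c where "c \<in> carrier G" "x = cls c" by (auto simp: Omega_eq)
  then show "Rm (a \<otimes> b) x = (Rm a \<otimes>\<^bsub>K\<^esub> Rm b) x"
    using assms x by (simp add: mult_chain_aut Rm_cls m_assoc)
qed (use assms in \<open>simp_all add: Rm_closed\<close>)

text \<open>Evaluating at the class of c compares c a with c b, and (c b) (c a)^-1 is the conjugate
  of b a^-1 by c.\<close>

lemma Rm_le_iff:
  assumes "a \<in> carrier G" "b \<in> carrier G"
  shows "Rm a \<preceq>\<^bsub>K\<^esub> Rm b \<longleftrightarrow> (\<forall>c\<in>carrier G. c \<otimes> (b \<otimes> inv a) \<otimes> inv c \<in> C)"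
proof -
  have "c \<otimes> b \<otimes> inv (c \<otimes> a) = c \<otimes> (b \<otimes> inv a) \<otimes> inv c" if "c \<in> carrier G" for c
    using assms that by (simp add: inv_mult_group m_assoc)
  then show ?thesis
    using assms unfolding le_chain_aut by (simp add: Omega_eq Rm_cls Omega_le_iff le_iff)
qed

lemma group_hom_Rm: "group_hom G K Rm"
  by unfold_locales (simp add: hom_def Pi_iff Rm_closed Rm_mult)

lemma subgroup_Rm: "subgroup (Rm ` carrier G) K"
  using group_hom.img_is_subgroup[OF group_hom_Rm] .

lemma HC_eq: "HC = K\<lparr>carrier := lattice_closure K (Rm ` carrier G)\<rparr>"
  unfolding H_group_def by (rule K.l_generated_subgroup[OF subgroup_Rm])

text \<open>The form of generation that \<open>ex_hom\<close> requires of its target.\<close>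

lemma carrier_HC: "carrier HC = lattice_closure HC (Rm ` carrier G)"
  using K.lattice_closure_idem[OF subgroup_Rm] by (simp add: HC_eq)

lemma l_subgroup_HC: "l_subgroup (carrier HC) K"
  using K.l_subgroup_lattice_closure[OF subgroup_Rm] by (simp add: HC_eq)

sublocale HC: lgrp HC
  using K.l_subgroup_l_group(1)[OF l_subgroup_HC] by unfold_locales (simp add: HC_eq)

lemma Rm_HC: "a \<in> carrier G \<Longrightarrow> Rm a \<in> carrier HC"
  by (auto simp: HC_eq intro: lattice_closure.gen)

lemma Rm_po_hom: "Rm \<in> po_hom G HC"
proof -
  have "Rm a \<preceq>\<^bsub>K\<^esub> Rm b" if "a \<in> carrier G" "b \<in> carrier G" "a \<preceq> b" for a b
  proof -
    have "c \<otimes> \<one> \<otimes> inv c \<preceq> c \<otimes> (b \<otimes> inv a) \<otimes> inv c" if "c \<in> carrier G" for c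
      using that \<open>a \<preceq> b\<close> \<open>a \<in> carrier G\<close> \<open>b \<in> carrier G\<close> po_iff_one_le[of a b]
      by (intro po_mult_lr) auto
    then show ?thesis
      using that by (auto simp: Rm_le_iff intro!: C_pos)
  qed
  moreover have "Rm a \<otimes>\<^bsub>HC\<^esub> Rm b = Rm (a \<otimes> b)" if "a \<in> carrier G" "b \<in> carrier G" for a b
    using that by (simp add: Rm_mult HC_eq)
  ultimately show ?thesis
    by (auto simp: po_hom_def hom_def Rm_HC) (simp add: HC_eq)
qed

text \<open>The cone of the point stabilizer at the class of 1. Its inverse image under
  \<open>Rm\<close> is \<open>C\<close>, which is how cones of \<open>G\<close> are compared with
  prime cones of \<open>HC\<close>.\<close>

definition stab where "stab = {f \<in> carrier HC. Omega_le G C (cls \<one>) (f (cls \<one>))}"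

lemma prime_cone_stab: "prime_cone HC stab"
proof -
  have "cls \<one> \<in> Omega G C" by (simp add: Omega_eq)
  from chain_stabilizer[OF this l_subgroup_HC] show ?thesis
    by (simp add: stab_def HC_eq)
qed

lemma Rm_stab_iff: "a \<in> carrier G \<Longrightarrow> Rm a \<in> stab \<longleftrightarrow> a \<in> C"
  by (simp add: stab_def Rm_HC Rm_cls Omega_le_iff le_iff)

lemma group_hom_Rm_HC: "group_hom G HC Rm"
  using Rm_po_hom by unfold_locales (simp add: po_hom_def)

text \<open>\<open>stab\<close> need not be adapted, but it contains an adapted prime cone of
  \<open>HC\<close>, and the inverse image of that under \<open>Rm\<close> is adapted and lies below
  \<open>C\<close>.\<close>

lemma ex_adapted_below:
  assumes "in_variety HC V"
  obtains E where "total_cone G E" "adapted V G E" "E \<subseteq> C"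
proof -
  obtain D where D: "prime_cone HC D" "adapted V HC D" "D \<subseteq> stab"
    using HC.adapted_prime_cone_below[OF assms prime_cone_stab] .
  have "total_cone G {a \<in> carrier G. Rm a \<in> D}"
    using total_cone_vimage[OF po_group HC.po_group Rm_po_hom] D(1) by (simp add: prime_cone_def)
  moreover have "adapted V G {a \<in> carrier G. Rm a \<in> D}"
    using adapted_vimage[OF group_hom_Rm_HC D(2)] .
  moreover have "{a \<in> carrier G. Rm a \<in> D} \<subseteq> C"
    using D(3) Rm_stab_iff by blast
  ultimately show thesis using that by blast
qed

text \<open>If \<open>C\<close> is normal, the image of \<open>Rm\<close> is ordered like the chain
  of \<open>C\<close>, so that \<open>HC\<close> is a totally ordered group and its positive cone is
  a normal prime cone. If \<open>C\<close> contains the commutators, the image of \<open>Rm\<close>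
  is commutative, and so is the lattice it generates.\<close>

lemma in_variety_of_adapted:
  assumes "adapted V G C"
  shows "in_variety HC V"
proof (cases V)
  case All_LGroups
  then show ?thesis using HC.l_group by simp
next
  case Representable_LGroups
  then have norm: "g \<otimes> x \<otimes> inv g \<in> C" if "g \<in> carrier G" "x \<in> C" for g x
    using assms that by simp
  have le: "Rm a \<preceq>\<^bsub>K\<^esub> Rm b \<longleftrightarrow> le a b" if ab: "a \<in> carrier G" "b \<in> carrier G" for a b
  proof
    assume "Rm a \<preceq>\<^bsub>K\<^esub> Rm b"
    then show "le a b" using ab by (auto simp: Rm_le_iff le_iff dest!: bspec[of _ _ \<one>])
  qed (use ab norm in \<open>auto simp: Rm_le_iff le_iff\<close>)
  then have tot: "f \<preceq>\<^bsub>K\<^esub> g \<or> g \<preceq>\<^bsub>K\<^esub> f" if "f \<in> Rm ` carrier G" "g \<in> Rm ` carrier G" for f g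
    using that by auto (use le_total in blast)
  \<comment> \<open>Of two comparable elements one is the join and the other the meet, so the
    totally ordered image of \<open>Rm\<close> is already an l-subgroup and exhausts
    \<open>HC\<close>.\<close>
  have "l_subgroup (Rm ` carrier G) K"
    unfolding l_subgroup_def
  proof (intro conjI ballI subgroup_Rm)
    fix f g assume fg: "f \<in> Rm ` carrier G" "g \<in> Rm ` carrier G"
    then have "f \<in> carrier K" "g \<in> carrier K" using Rm_closed by auto
    then show "ljoin K f g \<in> Rm ` carrier G" "lmeet K f g \<in> Rm ` carrier G"
      using tot[OF fg] fg K.join_absorb K.join_absorb2 K.meet_absorb K.meet_absorb2 by metis+
  qed
  then have HC: "carrier HC \<subseteq> Rm ` carrier G"
    using K.lattice_closure_least by (simp add: HC_eq)
  let ?P = "{f \<in> carrier HC. \<one>\<^bsub>HC\<^esub> \<preceq>\<^bsub>HC\<^esub> f}"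
  have "f \<in> ?P \<or> inv\<^bsub>HC\<^esub> f \<in> ?P" if f: "f \<in> carrier HC" for f
  proof -
    have "\<one>\<^bsub>HC\<^esub> \<preceq>\<^bsub>K\<^esub> f \<or> f \<preceq>\<^bsub>K\<^esub> \<one>\<^bsub>HC\<^esub>"
      using tot[OF subsetD[OF HC HC.one_closed] subsetD[OF HC f]] .
    then have "\<one>\<^bsub>HC\<^esub> \<preceq>\<^bsub>HC\<^esub> f \<or> f \<preceq>\<^bsub>HC\<^esub> \<one>\<^bsub>HC\<^esub>" by (simp add: HC_eq)
    then show ?thesis using f HC.po_le_inv_iff[of "\<one>\<^bsub>HC\<^esub>" f] by auto
  qed
  moreover have "f \<otimes>\<^bsub>HC\<^esub> g \<in> ?P \<and> lmeet HC f g \<in> ?P" if "f \<in> ?P" "g \<in> ?P" for f g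
    using that HC.po_mult_mono[of "\<one>\<^bsub>HC\<^esub>" f "\<one>\<^bsub>HC\<^esub>" g] HC.meet_greatest[of "\<one>\<^bsub>HC\<^esub>" f g] by auto
  ultimately have "prime_cone HC ?P"
    unfolding HC.prime_cone_iff HC.l_cone_def by simp
  moreover have "adapted V HC ?P"
    using Representable_LGroups HC.po_mult_lr[of "\<one>\<^bsub>HC\<^esub>" f g "inv\<^bsub>HC\<^esub> g" for f g] by simp
  ultimately have "f \<in> ?P" if "\<forall>D. prime_cone HC D \<and> adapted V HC D \<longrightarrow> f \<in> D" for f
    using that by (elim allE[of _ ?P]) simp
  then show ?thesis
    unfolding HC.in_variety_iff by simp
next
  case Abelian_LGroups
  have comm: "a \<otimes> b \<otimes> inv a \<otimes> inv b \<in> C" if "a \<in> carrier G" "b \<in> carrier G" for a b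
    using assms Abelian_LGroups that by simp
  have le: "Rm (b \<otimes> a) \<preceq>\<^bsub>K\<^esub> Rm (a \<otimes> b)" if ab: "a \<in> carrier G" "b \<in> carrier G" for a b
  proof -
    have "c \<otimes> (a \<otimes> b \<otimes> inv (b \<otimes> a)) \<otimes> inv c \<in> C" if c: "c \<in> carrier G" for c
    proof -
      let ?k = "a \<otimes> b \<otimes> inv a \<otimes> inv b"
      \<comment> \<open>The conjugate of the commutator \<open>?k\<close> by c is the commutator of
        c and \<open>?k\<close> times \<open>?k\<close>, hence a product of two elements of
        \<open>C\<close>.\<close>
      have "c \<otimes> (a \<otimes> b \<otimes> inv (b \<otimes> a)) \<otimes> inv c = (c \<otimes> ?k \<otimes> inv c \<otimes> inv ?k) \<otimes> ?k"
        using ab c by (simp add: inv_mult_group m_assoc mult_inv_cancel)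
      then show ?thesis using comm[of c ?k] comm[of a b] ab c C_mult by simp
    qed
    then show ?thesis using ab by (simp add: Rm_le_iff)
  qed
  have Rm_comm: "Rm a \<otimes>\<^bsub>K\<^esub> Rm b = Rm b \<otimes>\<^bsub>K\<^esub> Rm a" if ab: "a \<in> carrier G" "b \<in> carrier G" for a b
    using le[of a b] le[of b a] ab
    by (intro K.po_antisym) (simp_all add: Rm_mult Rm_closed)
  have "f \<otimes>\<^bsub>K\<^esub> g = g \<otimes>\<^bsub>K\<^esub> f" if "f \<in> carrier HC" "g \<in> carrier HC" for f g
  proof (rule K.lattice_closure_commute[OF subgroup.subset[OF subgroup_Rm]])
    show "\<And>x y. \<lbrakk>x \<in> Rm ` carrier G; y \<in> Rm ` carrier G\<rbrakk> \<Longrightarrow> x \<otimes>\<^bsub>K\<^esub> y = y \<otimes>\<^bsub>K\<^esub> x"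
      by (elim imageE) (simp only: Rm_comm)
  qed (use that in \<open>simp_all add: HC_eq\<close>)
  then have "comm_group HC"
    by (intro HC.group_comm_groupI) (simp add: HC_eq)
  then show ?thesis using Abelian_LGroups HC.l_group by simp
qed

end

text \<open>Right translation recovers a right pre-order from its pre-cone: a precedes b exactly
  when b a^-1 is in the pre-cone. Under this correspondence the relation of all pairs belongs to the
  improper cone.\<close>

lemma preorders_eq:
  assumes "po_group G"
  shows "preorders V G = {C. total_cone G C \<and> C \<noteq> carrier G \<and> in_variety (H_group G C) V}"
proof -
  interpret po_grp G using assms by unfold_locales
  have 1: "total_cone G (pre_cone G R) \<and> pre_cone G R \<noteq> carrier G" if R: "right_preorder G R" for R
  proof -
    have sub: "R \<subseteq> carrier G \<times> carrier G" and tr: "trans R" and rfl: "\<And>a. a \<in> carrier G \<Longrightarrow> (a, a) \<in> R"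
      and tot: "total_on (carrier G) R" and ne: "R \<noteq> carrier G \<times> carrier G"
      and pos: "\<And>a b. \<lbrakk>a \<in> carrier G; b \<in> carrier G; a \<preceq>\<^bsub>G\<^esub> b\<rbrakk> \<Longrightarrow> (a, b) \<in> R"
      and mult: "\<And>a b t. \<lbrakk>t \<in> carrier G; (a, b) \<in> R\<rbrakk> \<Longrightarrow> (a \<otimes>\<^bsub>G\<^esub> t, b \<otimes>\<^bsub>G\<^esub> t) \<in> R"
      using R by (auto simp: right_preorder_def preorder_on_def refl_on_def)
    have "(\<one>\<^bsub>G\<^esub>, x \<otimes>\<^bsub>G\<^esub> y) \<in> R" if "(\<one>\<^bsub>G\<^esub>, x) \<in> R" "(\<one>\<^bsub>G\<^esub>, y) \<in> R" for x y
    proof -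
      have y: "y \<in> carrier G" using that sub by blast
      then have "(y, x \<otimes>\<^bsub>G\<^esub> y) \<in> R" using mult[OF y that(1)] by simp
      then show ?thesis using that(2) tr by (blast dest: transD)
    qed
    moreover have "(\<one>\<^bsub>G\<^esub>, x) \<in> R \<or> (\<one>\<^bsub>G\<^esub>, inv\<^bsub>G\<^esub> x) \<in> R" if x: "x \<in> carrier G" for x
    proof -
      have "(\<one>\<^bsub>G\<^esub>, x) \<in> R \<or> (x, \<one>\<^bsub>G\<^esub>) \<in> R"
        using tot x rfl by (metis one_closed total_on_def)
      then show ?thesis using mult[of "inv\<^bsub>G\<^esub> x" x "\<one>\<^bsub>G\<^esub>"] x by auto
    qed
    moreover have "pre_cone G R \<noteq> carrier G"
    proof
      assume all: "pre_cone G R = carrier G"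
      have "(a, b) \<in> R" if ab: "a \<in> carrier G" "b \<in> carrier G" for a b
      proof -
        have "(\<one>\<^bsub>G\<^esub>, b \<otimes>\<^bsub>G\<^esub> inv\<^bsub>G\<^esub> a) \<in> R" using all ab by (auto simp: pre_cone_def)
        then show ?thesis using mult[of a "\<one>\<^bsub>G\<^esub>" "b \<otimes>\<^bsub>G\<^esub> inv\<^bsub>G\<^esub> a"] ab by (simp add: mult_inv_cancel)
      qed
      then show False using ne sub by blast
    qed
    ultimately show ?thesis
      using pos by (auto simp: total_cone_def pre_cone_def)
  qed
  have 2: "right_preorder G (cone_rel G C) \<and> C = pre_cone G (cone_rel G C)"
    if C: "total_cone G C" "C \<noteq> carrier G" for C
  proof -
    interpret cone G C using C by unfold_locales
    obtain x where x: "x \<in> carrier G" "x \<notin> C" using C C_closed by blast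
    have "cone_rel G C \<subseteq> carrier G \<times> carrier G" by (auto simp: le_iff)
    moreover have "trans (cone_rel G C)" by (blast intro: transI le_trans)
    moreover have "total_on (carrier G) (cone_rel G C)" using le_total by (simp add: total_on_def)
    moreover have "cone_rel G C \<noteq> carrier G \<times> carrier G"
      using x le_iff[of "\<one>\<^bsub>G\<^esub>" x] by auto
    moreover have "\<forall>a b. \<forall>t\<in>carrier G. le a b \<longrightarrow> le (a \<otimes>\<^bsub>G\<^esub> t) (b \<otimes>\<^bsub>G\<^esub> t)"
      using le_mult_iff by (simp add: le_iff)
    moreover have "\<forall>a\<in>carrier G. \<forall>b\<in>carrier G. a \<preceq>\<^bsub>G\<^esub> b \<longrightarrow> le a b"
      by (simp add: le_iff C_pos po_iff_one_le[symmetric])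
    ultimately have "right_preorder G (cone_rel G C)"
      using le_refl by (simp add: right_preorder_def preorder_on_def refl_on_def)
    then show ?thesis
      using C_closed by (auto simp: pre_cone_def le_iff)
  qed
  show ?thesis
    using 1 2 unfolding preorders_def by blast
qed

section \<open>Stone duality for a separating field of clopen sets\<close>

locale clopen_field =
  fixes X :: "'x topology" and B :: "'x set set"
  assumes compact: "compact_space X"
    and B_open: "U \<in> B \<Longrightarrow> openin X U"
    and B_top: "topspace X \<in> B"
    and B_union: "\<lbrakk>U \<in> B; W \<in> B\<rbrakk> \<Longrightarrow> U \<union> W \<in> B"
    and B_compl: "U \<in> B \<Longrightarrow> topspace X - U \<in> B"
    and B_sep: "\<lbrakk>x \<in> topspace X; y \<in> topspace X; x \<noteq> y\<rbrakk> \<Longrightarrow> \<exists>U\<in>B. x \<in> U \<and> y \<notin> U"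
begin

lemma B_sub: "U \<in> B \<Longrightarrow> U \<subseteq> topspace X"
  using B_open openin_subset by blast

lemma B_empty: "{} \<in> B"
  using B_compl[OF B_top] by simp

lemma B_inter:
  assumes "U \<in> B" "W \<in> B"
  shows "U \<inter> W \<in> B"
proof -
  have "U \<inter> W = topspace X - ((topspace X - U) \<union> (topspace X - W))"
    using B_sub assms by blast
  then show ?thesis using B_compl B_union assms by simp
qed

lemma B_closed: "U \<in> B \<Longrightarrow> closedin X U"
  using B_open[OF B_compl] B_sub by (simp add: closedin_def)

text \<open>Compactness for covers directed upwards. It yields both the clopen neighbourhoods of a
  point and a point that the members of a prime ideal fail to cover.\<close>

lemma union_closed_cover:
  assumes Q: "Q \<subseteq> B" "Q \<noteq> {}" "\<And>U W. \<lbrakk>U \<in> Q; W \<in> Q\<rbrakk> \<Longrightarrow> U \<union> W \<in> Q"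
    and Z: "closedin X Z" "Z \<subseteq> \<Union>Q"
  shows "\<exists>U\<in>Q. Z \<subseteq> U"
proof -
  have "compactin X Z" using closedin_compact_space[OF compact Z(1)] .
  then obtain \<F> where \<F>: "finite \<F>" "\<F> \<subseteq> Q" "Z \<subseteq> \<Union>\<F>"
    using compactinD[of X Z Q] Z(2) Q(1) B_open by blast
  show ?thesis
  proof (cases "\<F> = {}")
    case True
    then show ?thesis using \<F> Q(2) by auto
  next
    case False
    from \<F>(1) False \<F>(2) have "\<Union>\<F> \<in> Q"
      by (induction rule: finite_ne_induct) (use Q(3) in auto)
    then show ?thesis using \<F>(3) by blast
  qed
qed

lemma stone_space: "stone_space X"
proof -
  have "Hausdorff_space X"
    unfolding Hausdorff_space_def
  proof (intro allI impI)
    fix x y assume xy: "x \<in> topspace X \<and> y \<in> topspace X \<and> x \<noteq> y"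
    then obtain U where "U \<in> B" "x \<in> U" "y \<notin> U" using B_sep by blast
    then show "\<exists>U W. openin X U \<and> openin X W \<and> x \<in> U \<and> y \<in> W \<and> disjnt U W"
      using B_open B_open[OF B_compl] xy
      by (intro exI[of _ U] exI[of _ "topspace X - U"]) (auto simp: disjnt_def)
  qed
  moreover have "\<exists>U. (closedin X U \<and> openin X U) \<and> x \<in> U \<and> U \<subseteq> W" if W: "openin X W" "x \<in> W" for W x
  proof -
    have x: "x \<in> topspace X" using W openin_subset by blast
    have "closedin X (topspace X - W)" using W(1) by blast
    \<comment> \<open>Each point outside \<open>W\<close> lies in a member of \<open>B\<close> that
      omits x. One such member covers the whole complement of \<open>W\<close>, and its complement
      is the clopen neighbourhood sought.\<close>
    moreover have "topspace X - W \<subseteq> \<Union>{U \<in> B. x \<notin> U}"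
    proof
      fix y assume "y \<in> topspace X - W"
      then obtain U where "U \<in> B" "y \<in> U" "x \<notin> U" using B_sep[of y x] x W by auto
      then show "y \<in> \<Union>{U \<in> B. x \<notin> U}" by blast
    qed
    moreover have "{U \<in> B. x \<notin> U} \<noteq> {}" using B_empty by blast
    ultimately have "\<exists>U\<in>{U \<in> B. x \<notin> U}. topspace X - W \<subseteq> U"
      using B_union by (intro union_closed_cover) auto
    then obtain U where "U \<in> B" "x \<notin> U" "topspace X - W \<subseteq> U" by blast
    then show ?thesis
      using B_open[OF B_compl] B_closed[OF B_compl] x
      by (intro exI[of _ "topspace X - U"]) auto
  qed
  then have "X dim_le 0"
    unfolding dimension_le_0_neighbourhood_base_of_clopen
    by (subst open_neighbourhood_base_of) auto
  ultimately show ?thesis using compact by (simp add: stone_space_def)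
qed

end

locale clopen_representation = clopen_field X B
  for X :: "'x topology" and B +
  fixes L :: "'b gorder" and \<phi> :: "'b \<Rightarrow> 'x set"
  assumes L_eq: "eq L = (=)"
    and \<phi>_image: "\<phi> ` carrier L = B"
    and \<phi>_inj: "inj_on \<phi> (carrier L)"
    and \<phi>_le: "\<lbrakk>x \<in> carrier L; y \<in> carrier L\<rbrakk> \<Longrightarrow> x \<sqsubseteq>\<^bsub>L\<^esub> y \<longleftrightarrow> \<phi> x \<subseteq> \<phi> y"
begin

lemma \<phi>_B: "x \<in> carrier L \<Longrightarrow> \<phi> x \<in> B"
  using \<phi>_image by blast

lemma obtain_\<phi>:
  assumes "U \<in> B"
  obtains x where "x \<in> carrier L" "\<phi> x = U"
  using assms \<phi>_image by blast

lemma \<phi>_eqD: "\<lbrakk>\<phi> x = \<phi> y; x \<in> carrier L; y \<in> carrier L\<rbrakk> \<Longrightarrow> x = y"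
  using \<phi>_inj by (auto dest: inj_onD)

sublocale PO: partial_order L
proof
  fix x y assume "x \<sqsubseteq>\<^bsub>L\<^esub> y" "y \<sqsubseteq>\<^bsub>L\<^esub> x" "x \<in> carrier L" "y \<in> carrier L"
  then have "\<phi> x = \<phi> y" by (intro equalityI) (simp_all only: \<phi>_le)
  then show "x .=\<^bsub>L\<^esub> y"
    using \<phi>_eqD \<open>x \<in> carrier L\<close> \<open>y \<in> carrier L\<close> by (simp add: L_eq)
next
  fix x y z assume "x \<sqsubseteq>\<^bsub>L\<^esub> y" "y \<sqsubseteq>\<^bsub>L\<^esub> z" "x \<in> carrier L" "y \<in> carrier L" "z \<in> carrier L"
  then show "x \<sqsubseteq>\<^bsub>L\<^esub> z"
    using subset_trans[of "\<phi> x" "\<phi> y" "\<phi> z"] by (simp only: \<phi>_le)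
qed (simp_all add: L_eq \<phi>_le)

lemma least_join:
  assumes "x \<in> carrier L" "y \<in> carrier L" "z \<in> carrier L" "\<phi> z = \<phi> x \<union> \<phi> y"
  shows "least L z (Upper L {x, y})"
proof (rule least_UpperI)
  fix u assume "u \<in> Upper L {x, y}"
  then have "u \<in> carrier L" "x \<sqsubseteq>\<^bsub>L\<^esub> u" "y \<sqsubseteq>\<^bsub>L\<^esub> u"
    using assms(1,2) by (auto simp: Upper_def)
  then show "z \<sqsubseteq>\<^bsub>L\<^esub> u" using assms by (simp add: \<phi>_le)
qed (use assms in \<open>auto simp: \<phi>_le\<close>)

lemma greatest_meet:
  assumes "x \<in> carrier L" "y \<in> carrier L" "z \<in> carrier L" "\<phi> z = \<phi> x \<inter> \<phi> y"
  shows "greatest L z (Lower L {x, y})"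
proof (rule greatest_LowerI)
  fix u assume "u \<in> Lower L {x, y}"
  then have "u \<in> carrier L" "u \<sqsubseteq>\<^bsub>L\<^esub> x" "u \<sqsubseteq>\<^bsub>L\<^esub> y"
    using assms(1,2) by (auto simp: Lower_def)
  then show "u \<sqsubseteq>\<^bsub>L\<^esub> z" using assms by (simp add: \<phi>_le)
qed (use assms in \<open>auto simp: \<phi>_le\<close>)

sublocale LL: lattice L
proof
  fix x y assume xy: "x \<in> carrier L" "y \<in> carrier L"
  show "\<exists>s. least L s (Upper L {x, y})"
    using obtain_\<phi>[OF B_union[OF \<phi>_B \<phi>_B, OF xy]] least_join xy by metis
  show "\<exists>s. greatest L s (Lower L {x, y})"
    using obtain_\<phi>[OF B_inter[OF \<phi>_B \<phi>_B, OF xy]] greatest_meet xy by metis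
qed

sublocale BL: bounded_lattice L
proof
  obtain x where x: "x \<in> carrier L" "\<phi> x = {}" using obtain_\<phi>[OF B_empty] .
  show "\<exists>x. least L x (carrier L)"
    by (rule exI[of _ x]) (use x in \<open>auto simp: least_def \<phi>_le\<close>)
  obtain y where y: "y \<in> carrier L" "\<phi> y = topspace X" using obtain_\<phi>[OF B_top] .
  show "\<exists>x. greatest L x (carrier L)"
    by (rule exI[of _ y]) (use y B_sub[OF \<phi>_B] in \<open>auto simp: greatest_def \<phi>_le\<close>)
qed

lemma \<phi>_join:
  assumes xy: "x \<in> carrier L" "y \<in> carrier L"
  shows "\<phi> (x \<squnion>\<^bsub>L\<^esub> y) = \<phi> x \<union> \<phi> y"
proof
  obtain z where z: "z \<in> carrier L" "\<phi> z = \<phi> x \<union> \<phi> y"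
    using obtain_\<phi>[OF B_union[OF \<phi>_B \<phi>_B, OF xy]] .
  then have "x \<squnion>\<^bsub>L\<^esub> y \<sqsubseteq>\<^bsub>L\<^esub> z"
    by (intro LL.join_le) (use xy in \<open>auto simp: \<phi>_le\<close>)
  then show "\<phi> (x \<squnion>\<^bsub>L\<^esub> y) \<subseteq> \<phi> x \<union> \<phi> y" using z xy by (simp add: \<phi>_le)
  show "\<phi> x \<union> \<phi> y \<subseteq> \<phi> (x \<squnion>\<^bsub>L\<^esub> y)"
    using LL.join_left[OF xy] LL.join_right[OF xy] xy by (simp add: \<phi>_le)
qed

lemma \<phi>_meet:
  assumes xy: "x \<in> carrier L" "y \<in> carrier L"
  shows "\<phi> (x \<sqinter>\<^bsub>L\<^esub> y) = \<phi> x \<inter> \<phi> y"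
proof
  obtain z where z: "z \<in> carrier L" "\<phi> z = \<phi> x \<inter> \<phi> y"
    using obtain_\<phi>[OF B_inter[OF \<phi>_B \<phi>_B, OF xy]] .
  then have "z \<sqsubseteq>\<^bsub>L\<^esub> x \<sqinter>\<^bsub>L\<^esub> y"
    by (intro LL.meet_le) (use xy in \<open>auto simp: \<phi>_le\<close>)
  then show "\<phi> x \<inter> \<phi> y \<subseteq> \<phi> (x \<sqinter>\<^bsub>L\<^esub> y)" using z xy by (simp add: \<phi>_le)
  show "\<phi> (x \<sqinter>\<^bsub>L\<^esub> y) \<subseteq> \<phi> x \<inter> \<phi> y"
    using LL.meet_left[OF xy] LL.meet_right[OF xy] xy by (simp add: \<phi>_le)
qed

lemma \<phi>_bottom: "\<phi> \<bottom>\<^bsub>L\<^esub> = {}"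
proof -
  obtain z where z: "z \<in> carrier L" "\<phi> z = {}" using obtain_\<phi>[OF B_empty] .
  then have "\<bottom>\<^bsub>L\<^esub> \<sqsubseteq>\<^bsub>L\<^esub> z" by (simp add: BL.bottom_lower)
  then show ?thesis using z by (simp add: \<phi>_le BL.bottom_closed)
qed

lemma \<phi>_top: "\<phi> \<top>\<^bsub>L\<^esub> = topspace X"
proof -
  obtain z where z: "z \<in> carrier L" "\<phi> z = topspace X" using obtain_\<phi>[OF B_top] .
  then have "z \<sqsubseteq>\<^bsub>L\<^esub> \<top>\<^bsub>L\<^esub>" by (simp add: BL.top_higher)
  then show ?thesis using z B_sub[OF \<phi>_B[of "\<top>\<^bsub>L\<^esub>"]] by (simp add: \<phi>_le BL.top_closed)
qed

lemma ex_complement: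
  assumes "x \<in> carrier L"
  obtains y where "y \<in> carrier L" "\<phi> y = topspace X - \<phi> x"
  using obtain_\<phi>[OF B_compl[OF \<phi>_B[OF assms]]] .

lemma boolean_lattice: "boolean_lattice L"
  unfolding boolean_lattice_def
proof (intro conjI ballI)
  show "bounded_lattice L" by (rule BL.bounded_lattice_axioms)
  show "x \<sqinter>\<^bsub>L\<^esub> (y \<squnion>\<^bsub>L\<^esub> z) = (x \<sqinter>\<^bsub>L\<^esub> y) \<squnion>\<^bsub>L\<^esub> (x \<sqinter>\<^bsub>L\<^esub> z)"
    if "x \<in> carrier L" "y \<in> carrier L" "z \<in> carrier L" for x y z
    by (rule \<phi>_eqD) (use that in \<open>auto simp: \<phi>_join \<phi>_meet\<close>)
  fix x assume x: "x \<in> carrier L"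
  obtain y where y: "y \<in> carrier L" "\<phi> y = topspace X - \<phi> x" using ex_complement[OF x] .
  have "x \<sqinter>\<^bsub>L\<^esub> y = \<bottom>\<^bsub>L\<^esub>"
    by (rule \<phi>_eqD) (use x y in \<open>auto simp: \<phi>_meet \<phi>_bottom BL.bottom_closed\<close>)
  moreover have "x \<squnion>\<^bsub>L\<^esub> y = \<top>\<^bsub>L\<^esub>"
    by (rule \<phi>_eqD) (use x y B_sub[OF \<phi>_B[OF x]] in \<open>auto simp: \<phi>_join \<phi>_top BL.top_closed\<close>)
  ultimately show "\<exists>y\<in>carrier L. x \<sqinter>\<^bsub>L\<^esub> y = \<bottom>\<^bsub>L\<^esub> \<and> x \<squnion>\<^bsub>L\<^esub> y = \<top>\<^bsub>L\<^esub>"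
    using y(1) by blast
qed

definition point_ideal where "point_ideal c = {x \<in> carrier L. c \<notin> \<phi> x}"

lemma prime_point_ideal:
  assumes c: "c \<in> topspace X"
  shows "lattice_prime_ideal L (point_ideal c)"
proof -
  have "\<bottom>\<^bsub>L\<^esub> \<in> point_ideal c" by (simp add: point_ideal_def \<phi>_bottom BL.bottom_closed)
  moreover have "\<top>\<^bsub>L\<^esub> \<notin> point_ideal c" using c by (simp add: point_ideal_def \<phi>_top)
  ultimately show ?thesis
    using BL.top_closed
    by (auto simp: lattice_prime_ideal_def point_ideal_def \<phi>_le \<phi>_join \<phi>_meet)
qed

text \<open>If the sets of \<open>P\<close> covered the space, a single one would, and
  \<open>P\<close> would be everything; so some point c is missed. Conversely, if
  \<open>\<phi> x\<close> misses c, then the complement y of x contains c and is not in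
  \<open>P\<close>, while the meet of x and y is bottom, so primeness puts x in
  \<open>P\<close>.\<close>

lemma prime_ideal_eq_point_ideal:
  assumes P: "lattice_prime_ideal L P"
  shows "\<exists>c\<in>topspace X. P = point_ideal c"
proof -
  have sub: "P \<subseteq> carrier L" and ne: "P \<noteq> {}" "P \<noteq> carrier L"
    and down: "\<And>x y. \<lbrakk>x \<in> carrier L; y \<in> P; x \<sqsubseteq>\<^bsub>L\<^esub> y\<rbrakk> \<Longrightarrow> x \<in> P"
    and join: "\<And>x y. \<lbrakk>x \<in> P; y \<in> P\<rbrakk> \<Longrightarrow> x \<squnion>\<^bsub>L\<^esub> y \<in> P"
    and prime: "\<And>x y. \<lbrakk>x \<in> carrier L; y \<in> carrier L; x \<sqinter>\<^bsub>L\<^esub> y \<in> P\<rbrakk> \<Longrightarrow> x \<in> P \<or> y \<in> P"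
    using P by (auto simp: lattice_prime_ideal_def)
  have "\<exists>c\<in>topspace X. c \<notin> \<Union>(\<phi> ` P)"
  proof (rule ccontr)
    assume "\<not> ?thesis"
    then have "topspace X \<subseteq> \<Union>(\<phi> ` P)" by blast
    moreover have "U \<union> W \<in> \<phi> ` P" if UW: "U \<in> \<phi> ` P" "W \<in> \<phi> ` P" for U W
    proof -
      obtain x y where "x \<in> P" "y \<in> P" "U = \<phi> x" "W = \<phi> y" using UW by blast
      then show ?thesis using join[of x y] sub \<phi>_join[of x y] by (metis imageI subsetD)
    qed
    moreover have "\<phi> ` P \<subseteq> B" using sub \<phi>_B by blast
    ultimately obtain y where y: "y \<in> P" "topspace X \<subseteq> \<phi> y"
      using union_closed_cover[of "\<phi> ` P" "topspace X"] ne(1) by auto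
    have "x \<in> P" if "x \<in> carrier L" for x
      using down[OF that y(1)] y sub that B_sub[OF \<phi>_B[OF that]] by (auto simp: \<phi>_le)
    then show False using sub ne(2) by blast
  qed
  then obtain c where c: "c \<in> topspace X" "\<And>x. x \<in> P \<Longrightarrow> c \<notin> \<phi> x" by blast
  have "x \<in> P" if x: "x \<in> carrier L" "c \<notin> \<phi> x" for x
  proof -
    obtain y where y: "y \<in> carrier L" "\<phi> y = topspace X - \<phi> x" using ex_complement[OF x(1)] .
    obtain z where z: "z \<in> P" using ne(1) by blast
    have "\<phi> (x \<sqinter>\<^bsub>L\<^esub> y) = {}" using x y by (auto simp: \<phi>_meet)
    then have "x \<sqinter>\<^bsub>L\<^esub> y \<in> P" using down[OF _ z] z sub x y by (auto simp: \<phi>_le)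
    then show ?thesis using prime[OF x(1) y(1)] c y x by blast
  qed
  then have "P = point_ideal c" using c sub by (auto simp: point_ideal_def)
  then show ?thesis using c by blast
qed

lemma topspace_prime_ideal_space: "topspace (prime_ideal_space L) = {P. lattice_prime_ideal L P}"
  by (auto simp: prime_ideal_space_def topology_generated_by_topspace)

lemma openin_prime_ideal_space:
  "x \<in> carrier L \<Longrightarrow> openin (prime_ideal_space L) {P. lattice_prime_ideal L P \<and> x \<notin> P}"
  unfolding prime_ideal_space_def by (rule topology_generated_by_Basis) blast

text \<open>Prime ideals being point ideals, two of them are separated by an element of
  \<open>L\<close> and its complement.\<close>

lemma Hausdorff_prime_ideal_space: "Hausdorff_space (prime_ideal_space L)"
proof -
  have *: "\<exists>x\<in>carrier L. \<exists>y\<in>carrier L. c \<in> \<phi> x \<and> d \<in> \<phi> y \<and> \<phi> x \<inter> \<phi> y = {}"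
    if cd: "c \<in> topspace X" "d \<in> topspace X" "c \<noteq> d" for c d
  proof -
    obtain U where U: "U \<in> B" "c \<in> U" "d \<notin> U" using B_sep cd by blast
    obtain x where x: "x \<in> carrier L" "\<phi> x = U" using obtain_\<phi>[OF U(1)] .
    obtain y where y: "y \<in> carrier L" "\<phi> y = topspace X - \<phi> x" using ex_complement[OF x(1)] .
    have "c \<in> \<phi> x" "d \<in> \<phi> y" "\<phi> x \<inter> \<phi> y = {}" using x y U cd by auto
    then show ?thesis using x(1) y(1) by blast
  qed
  show ?thesis
    unfolding Hausdorff_space_def topspace_prime_ideal_space
  proof (intro allI impI)
    fix P Q assume PQ: "P \<in> {P. lattice_prime_ideal L P} \<and> Q \<in> {P. lattice_prime_ideal L P} \<and> P \<noteq> Q"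
    then obtain c d where cd: "c \<in> topspace X" "d \<in> topspace X" "P = point_ideal c" "Q = point_ideal d"
      using prime_ideal_eq_point_ideal by (metis mem_Collect_eq)
    then obtain x y where xy: "x \<in> carrier L" "y \<in> carrier L" "c \<in> \<phi> x" "d \<in> \<phi> y" "\<phi> x \<inter> \<phi> y = {}"
      using *[of c d] PQ by blast
    have "disjnt {P. lattice_prime_ideal L P \<and> x \<notin> P} {P. lattice_prime_ideal L P \<and> y \<notin> P}"
      using xy prime_ideal_eq_point_ideal by (fastforce simp: disjnt_def point_ideal_def)
    then show "\<exists>U W. openin (prime_ideal_space L) U \<and> openin (prime_ideal_space L) W \<and> P \<in> U \<and> Q \<in> W \<and> disjnt U W"
      using openin_prime_ideal_space xy PQ cd
      by (intro exI[of _ "{P. lattice_prime_ideal L P \<and> x \<notin> P}"]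
          exI[of _ "{P. lattice_prime_ideal L P \<and> y \<notin> P}"]) (auto simp: point_ideal_def)
  qed
qed

text \<open>\<open>point_ideal\<close> is a continuous bijection from a compact space onto a
  Hausdorff space.\<close>

lemma homeomorphic_prime_ideal_space: "X homeomorphic_space prime_ideal_space L"
proof -
  have "continuous_map X (prime_ideal_space L) point_ideal"
    unfolding prime_ideal_space_def
  proof (rule continuous_on_generated_topo)
    show "point_ideal ` topspace X \<subseteq> \<Union>(insert {P. lattice_prime_ideal L P}
        {{P. lattice_prime_ideal L P \<and> x \<notin> P} | x. x \<in> carrier L})"
      using prime_point_ideal by blast
    fix U assume "U \<in> insert {P. lattice_prime_ideal L P}
        {{P. lattice_prime_ideal L P \<and> x \<notin> P} | x. x \<in> carrier L}"
    then consider "U = {P. lattice_prime_ideal L P}"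
      | x where "x \<in> carrier L" "U = {P. lattice_prime_ideal L P \<and> x \<notin> P}" by blast
    then show "openin X (point_ideal -` U \<inter> topspace X)"
    proof cases
      case 1
      then have "point_ideal -` U \<inter> topspace X = topspace X" using prime_point_ideal by auto
      then show ?thesis by simp
    next
      case (2 x)
      then have "point_ideal -` U \<inter> topspace X = \<phi> x"
        using prime_point_ideal B_sub[OF \<phi>_B[of x]] by (auto simp: point_ideal_def)
      then show ?thesis using B_open \<phi>_B 2 by simp
    qed
  qed
  moreover have "point_ideal ` topspace X = topspace (prime_ideal_space L)"
    unfolding topspace_prime_ideal_space
    using prime_point_ideal prime_ideal_eq_point_ideal by blast
  moreover have "inj_on point_ideal (topspace X)"
  proof (rule inj_onI, rule ccontr)
    fix c d assume cd: "c \<in> topspace X" "d \<in> topspace X" "point_ideal c = point_ideal d" "c \<noteq> d"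
    then obtain U where U: "U \<in> B" "c \<in> U" "d \<notin> U" using B_sep by blast
    obtain x where x: "x \<in> carrier L" "\<phi> x = U" using obtain_\<phi>[OF U(1)] .
    then have "x \<in> point_ideal d" "x \<notin> point_ideal c" using U by (auto simp: point_ideal_def)
    then show False using cd by simp
  qed
  ultimately show ?thesis
    using continuous_imp_homeomorphic_map[OF _ compact Hausdorff_prime_ideal_space]
      homeomorphic_map_imp_homeomorphic_space by blast
qed

end

section \<open>The minimal layer\<close>

context po_grp
begin

definition adapted_cones :: "lgroup_variety \<Rightarrow> 'a set set" where
  "adapted_cones V = {C. total_cone G C \<and> adapted V G C \<and> C \<noteq> carrier G}"

definition min_layer :: "lgroup_variety \<Rightarrow> 'a set set" where
  "min_layer V = {C \<in> preorders V G. \<forall>D\<in>preorders V G. D \<subseteq> C \<longrightarrow> D = C}"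

lemma adapted_cones_preorders: "adapted_cones V \<subseteq> preorders V G"
proof
  fix C assume C: "C \<in> adapted_cones V"
  then interpret cone G C by unfold_locales (simp add: adapted_cones_def)
  show "C \<in> preorders V G"
    using C in_variety_of_adapted by (simp add: preorders_eq[OF po_group] adapted_cones_def)
qed

lemma ex_adapted_cone_below:
  assumes C: "C \<in> preorders V G"
  shows "\<exists>E\<in>adapted_cones V. E \<subseteq> C"
proof -
  from C interpret cone G C by unfold_locales (simp add: preorders_eq[OF po_group])
  obtain E where E: "total_cone G E" "adapted V G E" "E \<subseteq> C"
    using ex_adapted_below[of V] C by (auto simp: preorders_eq[OF po_group])
  have "C \<noteq> carrier G" "C \<subseteq> carrier G"
    using C C_closed by (auto simp: preorders_eq[OF po_group])
  then show ?thesis using E by (auto simp: adapted_cones_def)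
qed

text \<open>Only totality uses the chain condition: if one member omits x and another x^-1, then the
  smaller of the two omits both.\<close>

lemma adapted_Inter_chain:
  assumes ne: "\<C> \<noteq> {}" and sub: "\<C> \<subseteq> adapted_cones V"
    and chain: "\<And>C D. \<lbrakk>C \<in> \<C>; D \<in> \<C>\<rbrakk> \<Longrightarrow> C \<subseteq> D \<or> D \<subseteq> C"
  shows "\<Inter>\<C> \<in> adapted_cones V"
proof -
  have tc: "total_cone G C" and ad: "adapted V G C" and proper: "C \<noteq> carrier G" if "C \<in> \<C>" for C
    using that sub by (auto simp: adapted_cones_def)
  obtain C0 where C0: "C0 \<in> \<C>" using ne by blast
  have "x \<in> \<Inter>\<C> \<or> inv x \<in> \<Inter>\<C>" if x: "x \<in> carrier G" for x
  proof (rule ccontr)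
    assume "\<not> ?thesis"
    then obtain C D where CD: "C \<in> \<C>" "D \<in> \<C>" "x \<notin> C" "inv x \<notin> D" by blast
    then have "inv x \<in> C" "x \<in> D"
      using tc[of C] tc[of D] x unfolding total_cone_def by blast+
    then show False using chain[OF CD(1,2)] CD by blast
  qed
  moreover have C0_sub: "C0 \<subseteq> carrier G" using tc[OF C0] by (simp add: total_cone_def)
  moreover have "x \<in> C" if "x \<in> carrier G" "\<one> \<preceq> x" "C \<in> \<C>" for x C
    using that tc[OF that(3)] by (simp add: total_cone_def)
  moreover have "x \<otimes> y \<in> C" if "x \<in> C" "y \<in> C" "C \<in> \<C>" for x y C
    using that tc[OF that(3)] by (simp add: total_cone_def)
  ultimately have "total_cone G (\<Inter>\<C>)"
    unfolding total_cone_def using C0 by auto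
  moreover have "adapted V G (\<Inter>\<C>)"
    using ad by (cases V) auto
  moreover have "\<Inter>\<C> \<noteq> carrier G"
    using C0 C0_sub proper by blast
  ultimately show ?thesis by (simp add: adapted_cones_def)
qed

lemma ex_minimal_adapted_cone:
  assumes C: "C \<in> adapted_cones V"
  shows "\<exists>E\<in>adapted_cones V. E \<subseteq> C \<and> (\<forall>D\<in>adapted_cones V. D \<subseteq> E \<longrightarrow> D = E)"
proof -
  \<comment> \<open>Zorn's lemma provides maximal elements for inclusion, so it is applied to the
    complements.\<close>
  let ?S = "{X. - X \<in> adapted_cones V \<and> - X \<subseteq> C}"
  have union: "\<Union>\<X> \<in> ?S" if ne: "\<X> \<noteq> {}" and ch: "subset.chain ?S \<X>" for \<X>
  proof -
    have X: "\<And>X. X \<in> \<X> \<Longrightarrow> - X \<in> adapted_cones V \<and> - X \<subseteq> C"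
      and XY: "\<And>X Y. \<lbrakk>X \<in> \<X>; Y \<in> \<X>\<rbrakk> \<Longrightarrow> X \<subseteq> Y \<or> Y \<subseteq> X"
      using ch by (auto simp: subset_chain_def)
    have "\<Inter>(uminus ` \<X>) \<in> adapted_cones V"
    proof (rule adapted_Inter_chain)
      fix A B assume "A \<in> uminus ` \<X>" "B \<in> uminus ` \<X>"
      then obtain X Y where "X \<in> \<X>" "Y \<in> \<X>" "A = - X" "B = - Y" by blast
      then show "A \<subseteq> B \<or> B \<subseteq> A" using XY[of X Y] by auto
    qed (use ne X in auto)
    moreover have "\<Inter>(uminus ` \<X>) = - \<Union>\<X>" by auto
    moreover have "- \<Union>\<X> \<subseteq> C" using ne X by blast
    ultimately show ?thesis by simp
  qed
  have "\<exists>M\<in>?S. \<forall>X\<in>?S. M \<subseteq> X \<longrightarrow> X = M"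
    by (rule subset_Zorn_nonempty[OF _ union]) (use C in \<open>auto intro!: exI[of _ "- C"]\<close>)
  then obtain M where M: "- M \<in> adapted_cones V" "- M \<subseteq> C"
    and max: "\<And>X. \<lbrakk>- X \<in> adapted_cones V; - X \<subseteq> C; M \<subseteq> X\<rbrakk> \<Longrightarrow> X = M" by auto
  have "D = - M" if "D \<in> adapted_cones V" "D \<subseteq> - M" for D
    using max[of "- D"] that M(2) by auto
  then show ?thesis using M by blast
qed

text \<open>Every pre-cone in \<open>preorders V G\<close> has an adapted one below it, so both
  families have the same minimal elements.\<close>

lemma min_layer_adapted:
  "min_layer V = {C \<in> adapted_cones V. \<forall>D\<in>adapted_cones V. D \<subseteq> C \<longrightarrow> D = C}"
proof (intro equalityI subsetI)
  fix C assume C: "C \<in> min_layer V"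
  then have C': "C \<in> preorders V G" "\<And>D. \<lbrakk>D \<in> preorders V G; D \<subseteq> C\<rbrakk> \<Longrightarrow> D = C"
    by (auto simp: min_layer_def)
  then obtain E where "E \<in> adapted_cones V" "E \<subseteq> C" using ex_adapted_cone_below by blast
  then have "C \<in> adapted_cones V" using C'(2) adapted_cones_preorders by blast
  then show "C \<in> {C \<in> adapted_cones V. \<forall>D\<in>adapted_cones V. D \<subseteq> C \<longrightarrow> D = C}"
    using C'(2) adapted_cones_preorders by blast
next
  fix C assume C: "C \<in> {C \<in> adapted_cones V. \<forall>D\<in>adapted_cones V. D \<subseteq> C \<longrightarrow> D = C}"
  have "D = C" if D: "D \<in> preorders V G" "D \<subseteq> C" for D
  proof -
    obtain E where "E \<in> adapted_cones V" "E \<subseteq> D" using ex_adapted_cone_below[OF D(1)] by blast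
    then show ?thesis using C D(2) by blast
  qed
  then show "C \<in> min_layer V" using C adapted_cones_preorders by (auto simp: min_layer_def)
qed

lemma ex_min_layer_below: "C \<in> adapted_cones V \<Longrightarrow> \<exists>E\<in>min_layer V. E \<subseteq> C"
  using ex_minimal_adapted_cone[of C V] by (auto simp: min_layer_adapted)

text \<open>The lexicographic product: order by \<open>C\<close> first, and by \<open>E\<close> on \<open>C \<inter> C\<inverse>\<close>.\<close>

lemma adapted_lex:
  assumes C: "C \<in> adapted_cones V" and E: "total_cone G E" "adapted V G E"
  shows "{g \<in> C. inv g \<in> C \<longrightarrow> g \<in> E} \<in> adapted_cones V" (is "?L \<in> _")
proof -
  have tC: "total_cone G C" and aC: "adapted V G C" and pC: "C \<noteq> carrier G"
    using C by (auto simp: adapted_cones_def)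
  have cl: "x \<in> carrier G" if "x \<in> C" for x using tC that by (auto simp: total_cone_def)
  have mC: "x \<otimes> y \<in> C" if "x \<in> C" "y \<in> C" for x y using tC that by (auto simp: total_cone_def)
  have mE: "x \<otimes> y \<in> E" if "x \<in> E" "y \<in> E" for x y using E that by (auto simp: total_cone_def)
  have mult: "x \<otimes> y \<in> ?L" if xy: "x \<in> ?L" "y \<in> ?L" for x y
  proof -
    \<comment> \<open>If x y is a tie for \<open>C\<close>, so are both factors, since x^-1 is y (x
      y)^-1 and y^-1 is (x y)^-1 x; then \<open>E\<close> decides for each of them.\<close>
    have "x \<in> E \<and> y \<in> E" if i: "inv (x \<otimes> y) \<in> C"
    proof -
      have "inv x = y \<otimes> inv (x \<otimes> y)" "inv y = inv (x \<otimes> y) \<otimes> x"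
        using xy cl by (simp_all add: inv_mult_group m_assoc mult_inv_cancel)
      then show ?thesis using mC xy i by auto
    qed
    then show ?thesis using xy mC mE by auto
  qed
  have tot: "x \<in> ?L \<or> inv x \<in> ?L" if "x \<in> carrier G" for x
    using tC E(1) that inv_inv unfolding total_cone_def by auto
  have pos: "x \<in> ?L" if "x \<in> carrier G" "\<one> \<preceq> x" for x
    using that tC E(1) by (auto simp: total_cone_def)
  have "total_cone G ?L"
    unfolding total_cone_def
  proof (intro conjI ballI impI)
    show "?L \<subseteq> carrier G" using cl by blast
  qed (rule pos mult tot; assumption)+
  moreover have "adapted V G ?L"
  proof (cases V)
    case Representable_LGroups
    have "g \<otimes> x \<otimes> inv g \<in> ?L" if g: "g \<in> carrier G" and x: "x \<in> ?L" for g x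
    proof -
      \<comment> \<open>Normality of \<open>C\<close>, applied to g^-1, undoes the conjugation, so a
        tie at the conjugate is a tie at x.\<close>
      have "inv x \<in> C" if "inv (g \<otimes> x \<otimes> inv g) \<in> C"
      proof -
        have "inv g \<otimes> inv (g \<otimes> x \<otimes> inv g) \<otimes> inv (inv g) \<in> C"
          using aC[unfolded Representable_LGroups adapted.simps] that inv_closed[OF g] by blast
        moreover have "inv g \<otimes> inv (g \<otimes> x \<otimes> inv g) \<otimes> inv (inv g) = inv x"
          using g x cl by (simp add: inv_mult_group m_assoc mult_inv_cancel)
        ultimately show ?thesis by simp
      qed
      then show ?thesis using aC E(2) Representable_LGroups g x by auto
    qed
    then show ?thesis using Representable_LGroups by simp
  qed (use aC E(2) in auto)
  moreover have "?L \<noteq> carrier G" using pC cl by blast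
  ultimately show ?thesis by (simp add: adapted_cones_def)
qed

text \<open>Refining a minimal \<open>C\<close> lexicographically by any adapted \<open>E\<close>
  returns \<open>C\<close>, so elements tied in \<open>C\<close> lie in \<open>E\<close>.
  Conversely, for an adapted \<open>D\<close> inside \<open>C\<close>, an a in \<open>C\<close> but
  not in \<open>D\<close> would have its inverse in \<open>D\<close>, hence be tied in
  \<open>C\<close> and so lie in every adapted cone, in particular in \<open>D\<close>.\<close>

lemma min_layer_iff:
  "C \<in> min_layer V \<longleftrightarrow> C \<in> adapted_cones V \<and> (\<forall>a\<in>C. inv a \<in> C \<longrightarrow> a \<in> \<Inter>(adapted_cones V))"
proof
  assume C: "C \<in> min_layer V"
  have "a \<in> E" if "a \<in> C" "inv a \<in> C" "E \<in> adapted_cones V" for a E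
  proof -
    have "{g \<in> C. inv g \<in> C \<longrightarrow> g \<in> E} \<in> adapted_cones V"
      using C that(3) by (intro adapted_lex) (auto simp: min_layer_adapted adapted_cones_def)
    then have "{g \<in> C. inv g \<in> C \<longrightarrow> g \<in> E} = C"
      using C by (auto simp: min_layer_adapted)
    then show ?thesis using that by blast
  qed
  then show "C \<in> adapted_cones V \<and> (\<forall>a\<in>C. inv a \<in> C \<longrightarrow> a \<in> \<Inter>(adapted_cones V))"
    using C by (auto simp: min_layer_adapted)
next
  assume C: "C \<in> adapted_cones V \<and> (\<forall>a\<in>C. inv a \<in> C \<longrightarrow> a \<in> \<Inter>(adapted_cones V))"
  have "C \<subseteq> D" if D: "D \<in> adapted_cones V" "D \<subseteq> C" for D
  proof
    fix a assume a: "a \<in> C"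
    have "total_cone G C" "total_cone G D" using C D by (auto simp: adapted_cones_def)
    then have "a \<in> D \<or> inv a \<in> D" using a unfolding total_cone_def by blast
    then show "a \<in> D"
    proof
      assume "inv a \<in> D"
      then have "inv a \<in> C" using D(2) by blast
      then show ?thesis using C D(1) a by blast
    qed
  qed
  then show "C \<in> min_layer V" using C unfolding min_layer_adapted by blast
qed

text \<open>By \<open>min_layer_iff\<close>, minimality is a condition on pairs a, a^-1 against one
  fixed set. What has to be removed is properness, which is not a closed condition.\<close>

lemma compact_min_layer: "compact {f. {x. f x} \<in> min_layer V}"
proof (cases "adapted_cones V = {}")
  case True
  then show ?thesis by (simp add: min_layer_adapted)
next
  case False
  let ?I = "\<Inter>(adapted_cones V)"
  obtain E where E: "E \<in> adapted_cones V" using False by blast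
  then obtain a where a: "a \<in> carrier G" "a \<notin> ?I"
    by (auto simp: adapted_cones_def total_cone_def)
  \<comment> \<open>The element \<open>a\<close> outside \<open>?I\<close> excludes the improper
    cone from the right side, since that cone contains both \<open>a\<close> and its
    inverse.\<close>
  have "{f. {x. f x} \<in> min_layer V} = {f. total_cone G {x. f x} \<and> adapted V G {x. f x} \<and>
      (\<forall>x. f x \<longrightarrow> f (inv x) \<longrightarrow> x \<in> ?I)}"
    using a by (auto simp: min_layer_iff adapted_cones_def)
  moreover have "closed {f. total_cone G {x. f x} \<and> adapted V G {x. f x} \<and>
      (\<forall>x. f x \<longrightarrow> f (inv x) \<longrightarrow> x \<in> ?I)}"
    by (intro clopen_Collect_intros closed_total_cone closed_adapted)
  ultimately show ?thesis
    using compact_Int_closed[OF compact_UNIV_pred] by simp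
qed

lemma topspace_minimal_layer: "topspace (minimal_layer V G) = min_layer V"
proof -
  have "topspace (preorder_space V G) = preorders V G"
    by (auto simp: preorder_space_def topology_generated_by_topspace)
  then show ?thesis by (auto simp: minimal_layer_def min_layer_def)
qed

lemma minimal_layer_eq: "minimal_layer V G = subtopology (preorder_space V G) (min_layer V)"
  by (simp add: minimal_layer_def min_layer_def)

text \<open>The subbasic sets of the layer are open for pointwise convergence, so
  \<open>Collect\<close> maps the compact set of characteristic functions continuously onto the
  layer.\<close>

lemma compact_space_minimal_layer: "compact_space (minimal_layer V G)"
proof -
  let ?S = "{f. {x. f x} \<in> min_layer V}"
  have "continuous_map (top_of_set ?S) (preorder_space V G) Collect"
    unfolding preorder_space_def
  proof (rule continuous_on_generated_topo)
    show "Collect ` topspace (top_of_set ?S) \<subseteq> \<Union>(insert (preorders V G)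
        {{C \<in> preorders V G. a \<in> C \<and> inv a \<notin> C} | a. a \<in> carrier G})"
      by (auto simp: min_layer_def)
    fix U assume "U \<in> insert (preorders V G)
        {{C \<in> preorders V G. a \<in> C \<and> inv a \<notin> C} | a. a \<in> carrier G}"
    then consider "U = preorders V G"
      | a where "U = {C \<in> preorders V G. a \<in> C \<and> inv a \<notin> C}" by blast
    then show "openin (top_of_set ?S) (Collect -` U \<inter> topspace (top_of_set ?S))"
    proof cases
      case 1
      then have "Collect -` U \<inter> topspace (top_of_set ?S) = ?S" by (auto simp: min_layer_def)
      then show ?thesis by simp
    next
      case (2 a)
      then have "Collect -` U \<inter> topspace (top_of_set ?S) = ?S \<inter> {f. f a \<and> \<not> f (inv a)}"
        by (auto simp: min_layer_def)
      moreover have "open {f :: 'a \<Rightarrow> bool. f a \<and> \<not> f (inv a)}"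
        by (intro clopen_Collect_intros open_Collect_neg)
      ultimately show ?thesis by (simp add: openin_open_Int)
    qed
  qed
  moreover have "compactin (top_of_set ?S) ?S"
    using compact_min_layer by (simp add: compactin_subtopology)
  ultimately have "compactin (preorder_space V G) (Collect ` ?S)"
    by (rule image_compactin[rotated])
  moreover have "Collect ` ?S = min_layer V"
  proof (intro equalityI subsetI)
    fix C assume "C \<in> min_layer V"
    then show "C \<in> Collect ` ?S" by (intro image_eqI[of C Collect "\<lambda>x. x \<in> C"]) simp_all
  qed auto
  ultimately show ?thesis
    by (simp add: minimal_layer_eq compact_space_subtopology)
qed

end

section \<open>Supports\<close>

context free_lgrp
begin

abbreviation "M \<equiv> min_layer V"

text \<open>The extension is the inverse image of \<open>stab\<close>.\<close>

lemma ex_prime_cone_extension: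
  assumes C: "C \<in> preorders V G"
  shows "\<exists>D. prime_cone F D \<and> (\<forall>a\<in>carrier G. \<eta> a \<in> D \<longleftrightarrow> a \<in> C)"
proof -
  from C interpret cone G C by unfold_locales (simp add: preorders_eq[OF po_group])
  have "in_variety HC V" using C by (simp add: preorders_eq[OF po_group])
  then obtain h where h: "h \<in> l_hom F HC" "\<And>a. a \<in> carrier G \<Longrightarrow> h (\<eta> a) = Rm a"
    using ex_hom[OF _ Rm_po_hom carrier_HC] by blast
  interpret h: lgrp_hom F HC h using h(1) by unfold_locales
  show ?thesis
    using h.prime_cone_vimage[OF prime_cone_stab] h(2) Rm_stab_iff
    by (intro exI[of _ "{x \<in> carrier F. h x \<in> stab}"]) simp
qed

text \<open>The choice is harmless: by \<open>prime_cone_lattice_closure_mono\<close> and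
  \<open>carrier_F\<close> a prime cone of \<open>F\<close> is determined by its trace on the image
  of \<open>G\<close>.\<close>

definition ext_cone :: "'g set \<Rightarrow> 'f set" where
  "ext_cone C = (SOME D. prime_cone F D \<and> (\<forall>a\<in>carrier G. \<eta> a \<in> D \<longleftrightarrow> a \<in> C))"

lemma
  assumes "C \<in> M"
  shows prime_ext_cone: "prime_cone F (ext_cone C)"
    and \<eta>_ext_cone: "a \<in> carrier G \<Longrightarrow> \<eta> a \<in> ext_cone C \<longleftrightarrow> a \<in> C"
proof -
  have "C \<in> preorders V G" using assms by (simp add: min_layer_def)
  from someI_ex[OF ex_prime_cone_extension[OF this]]
  show "prime_cone F (ext_cone C)" "a \<in> carrier G \<Longrightarrow> \<eta> a \<in> ext_cone C \<longleftrightarrow> a \<in> C"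
    by (auto simp: ext_cone_def)
qed

text \<open>Otherwise some adapted prime cone \<open>P\<close> of \<open>F\<close> omits x. Its
  inverse image in \<open>G\<close> lies above some C in \<open>M\<close>, and since the trace of
  \<open>ext_cone C\<close> on the image of \<open>G\<close> lies in \<open>P\<close>, all of
  \<open>ext_cone C\<close> does, including x.\<close>

lemma one_le_if_in_ext_cones:
  assumes x: "x \<in> carrier F" "\<And>C. C \<in> M \<Longrightarrow> x \<in> ext_cone C"
  shows "\<one>\<^bsub>F\<^esub> \<preceq>\<^bsub>F\<^esub> x"
proof (rule ccontr)
  assume "\<not> ?thesis"
  then obtain P where P: "prime_cone F P" "adapted V F P" "x \<notin> P"
    using F_in_variety x(1) unfolding F.in_variety_iff by blast
  have \<eta>F: "\<eta> ` carrier G \<subseteq> carrier F" by auto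
  have mono: "D \<subseteq> P" if D: "prime_cone F D" "D \<inter> \<eta> ` carrier G \<subseteq> P" for D
  proof -
    have "D \<subseteq> carrier F" using F.l_coneD(1)[OF F.prime_coneD(1)[OF D(1)]] by blast
    then show ?thesis
      using F.prime_cone_lattice_closure_mono[OF D(1) P(1) \<eta>F D(2)] carrier_F by blast
  qed
  let ?C = "{a \<in> carrier G. \<eta> a \<in> P}"
  \<comment> \<open>If \<open>P\<close> contained the whole image of \<open>G\<close>, it would
    contain the lattice generated by it, which is \<open>F\<close>; this is \<open>mono\<close>
    applied to the improper cone.\<close>
  have "?C \<noteq> carrier G"
  proof
    assume "?C = carrier G"
    then have "carrier F \<inter> \<eta> ` carrier G \<subseteq> P" by blast
    moreover have "prime_cone F (carrier F)" by (auto simp: F.prime_cone_iff F.l_cone_def)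
    ultimately show False using mono[of "carrier F"] x(1) P(3) by blast
  qed
  then have "?C \<in> adapted_cones V"
    using total_cone_vimage[OF po_group F.po_group \<eta>, of P] P
      adapted_vimage[OF \<eta>.group_hom_axioms P(2)]
    by (simp add: adapted_cones_def prime_cone_def)
  then obtain C where C: "C \<in> M" "C \<subseteq> ?C" using ex_min_layer_below by blast
  have "ext_cone C \<inter> \<eta> ` carrier G \<subseteq> P" using \<eta>_ext_cone[OF C(1)] C(2) by blast
  then show False using mono[OF prime_ext_cone[OF C(1)]] x(2)[OF C(1)] P(3) by blast
qed

text \<open>For \<open>C\<close> in the minimal layer, \<open>ext_cone C\<close> is the prime cone of \<open>F\<close> that restricts to \<open>C\<close>.
  An element of \<open>F\<close> is trivial at \<open>C\<close> if it belongs to the corresponding prime l-subgroup.\<close>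

definition neg_set :: "'f \<Rightarrow> 'g set set" where
  "neg_set x = {C \<in> M. x \<notin> ext_cone C}"

definition supp :: "'f \<Rightarrow> 'g set set" where
  "supp x = neg_set x \<union> neg_set (inv\<^bsub>F\<^esub> x)"

lemma neg_set_join: "\<lbrakk>x \<in> carrier F; y \<in> carrier F\<rbrakk> \<Longrightarrow> neg_set (ljoin F x y) = neg_set x \<inter> neg_set y"
  and neg_set_meet: "\<lbrakk>x \<in> carrier F; y \<in> carrier F\<rbrakk> \<Longrightarrow> neg_set (lmeet F x y) = neg_set x \<union> neg_set y"
  using F.prime_cone_join_iff[OF prime_ext_cone] F.prime_cone_meet_iff[OF prime_ext_cone]
  by (auto simp: neg_set_def)

lemma neg_set_empty: "\<lbrakk>x \<in> carrier F; \<one>\<^bsub>F\<^esub> \<preceq>\<^bsub>F\<^esub> x\<rbrakk> \<Longrightarrow> neg_set x = {}"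
  using F.l_coneD(2)[OF F.prime_coneD(1)[OF prime_ext_cone]] by (auto simp: neg_set_def)

lemma neg_set_empty_iff: "x \<in> carrier F \<Longrightarrow> neg_set x = {} \<longleftrightarrow> \<one>\<^bsub>F\<^esub> \<preceq>\<^bsub>F\<^esub> x"
  using one_le_if_in_ext_cones neg_set_empty by (auto simp: neg_set_def)

lemma neg_set_inv_disjoint: "x \<in> carrier F \<Longrightarrow> neg_set x \<inter> neg_set (inv\<^bsub>F\<^esub> x) = {}"
  using F.prime_coneD(2)[OF prime_ext_cone] by (auto simp: neg_set_def)

lemma labs_closed [simp]: "x \<in> carrier F \<Longrightarrow> labs F x \<in> carrier F"
  by (simp add: labs_def)

lemma one_le_labs: "x \<in> carrier F \<Longrightarrow> \<one>\<^bsub>F\<^esub> \<preceq>\<^bsub>F\<^esub> labs F x"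
  using neg_set_empty_iff[of "labs F x"] neg_set_inv_disjoint[of x]
  by (simp add: labs_def neg_set_join)

lemma neg_set_inv_labs: "x \<in> carrier F \<Longrightarrow> neg_set (inv\<^bsub>F\<^esub> (labs F x)) = supp x"
  by (simp add: labs_def F.inv_join neg_set_meet supp_def Un_commute)

text \<open>The meet of two absolute values is positive, so only its inverse contributes to the
  support; that inverse is a join, and joins intersect the negative sets.\<close>

lemma supp_labs_meet:
  assumes "x \<in> carrier F" "y \<in> carrier F"
  shows "supp (lmeet F (labs F x) (labs F y)) = supp x \<inter> supp y"
  using assms neg_set_empty[OF _ one_le_labs] neg_set_inv_labs
  by (simp add: supp_def[of "lmeet F _ _"] neg_set_meet F.inv_meet neg_set_join)

lemma supp_labs_join:
  assumes "x \<in> carrier F" "y \<in> carrier F"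
  shows "supp (ljoin F (labs F x) (labs F y)) = supp x \<union> supp y"
  using assms neg_set_empty[OF _ one_le_labs] neg_set_inv_labs
  by (simp add: supp_def[of "ljoin F _ _"] neg_set_join F.inv_join neg_set_meet)

lemma supp_empty_iff: "x \<in> carrier F \<Longrightarrow> supp x = {} \<longleftrightarrow> x = \<one>\<^bsub>F\<^esub>"
  using neg_set_empty_iff[of x] neg_set_empty_iff[of "inv\<^bsub>F\<^esub> x"] F.po_le_inv_iff[of "\<one>\<^bsub>F\<^esub>" x]
  by (auto simp: supp_def intro: F.po_antisym)

lemma labs_meet_eq_one_iff:
  "\<lbrakk>x \<in> carrier F; y \<in> carrier F\<rbrakk> \<Longrightarrow> lmeet F (labs F x) (labs F y) = \<one>\<^bsub>F\<^esub> \<longleftrightarrow> supp x \<inter> supp y = {}"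
  using supp_empty_iff[of "lmeet F (labs F x) (labs F y)"] by (simp add: supp_labs_meet)

section \<open>The field of supports and its topology\<close>

abbreviation "supports \<equiv> supp ` carrier F"

lemma supports_Un: "\<lbrakk>U \<in> supports; W \<in> supports\<rbrakk> \<Longrightarrow> U \<union> W \<in> supports"
  and supports_Int: "\<lbrakk>U \<in> supports; W \<in> supports\<rbrakk> \<Longrightarrow> U \<inter> W \<in> supports"
  by (auto simp: supp_labs_join[symmetric] supp_labs_meet[symmetric])

lemma neg_set_supports: "x \<in> carrier F \<Longrightarrow> neg_set x \<in> supports"
proof -
  assume x: "x \<in> carrier F"
  \<comment> \<open>The negative part 1 \<and> x is nontrivial exactly where x is negative.\<close>
  then have "supp (lmeet F \<one>\<^bsub>F\<^esub> x) = neg_set x"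
    using neg_set_empty[of "\<one>\<^bsub>F\<^esub>"] by (auto simp: supp_def neg_set_meet F.inv_meet neg_set_join)
  then show ?thesis using x by force
qed

lemma neg_set_\<eta>: "a \<in> carrier G \<Longrightarrow> neg_set (\<eta> a) = {C \<in> M. a \<notin> C}"
  using \<eta>_ext_cone by (auto simp: neg_set_def)

lemma total_cone_M: "C \<in> M \<Longrightarrow> total_cone G C"
  by (simp add: min_layer_iff adapted_cones_def)

text \<open>An element of \<open>G\<close> that is tied at one point of the layer is tied at all of
  them. The description of complements and the existence of an element with full support depend on
  this.\<close>

lemma M_symmetric_elem:
  assumes "C \<in> M" "a \<in> C" "inv a \<in> C" "D \<in> M"
  shows "a \<in> D"
proof -
  have "a \<in> \<Inter>(adapted_cones V)" using assms(1-3) unfolding min_layer_iff by blast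
  moreover have "D \<in> adapted_cones V" using assms(4) unfolding min_layer_iff by blast
  ultimately show ?thesis by blast
qed

text \<open>Either a is tied at some point of \<open>M\<close>, hence at all, and its negative set
  is empty; or every point of \<open>M\<close> contains exactly one of a and a^-1.\<close>

lemma compl_neg_set_\<eta>:
  assumes a: "a \<in> carrier G"
  shows "M - neg_set (\<eta> a) = M \<or> M - neg_set (\<eta> a) = neg_set (\<eta> (inv a))"
proof (cases "\<exists>C\<in>M. a \<in> C \<and> inv a \<in> C")
  case True
  then show ?thesis using M_symmetric_elem a by (auto simp: neg_set_\<eta>)
next
  case False
  then have "a \<in> C \<longleftrightarrow> inv a \<notin> C" if "C \<in> M" for C
    using that total_cone_M[OF that] a by (auto simp: total_cone_def)
  then have "M - {C \<in> M. a \<notin> C} = {C \<in> M. inv a \<notin> C}" by blast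
  then show ?thesis unfolding neg_set_\<eta>[OF a] neg_set_\<eta>[OF inv_closed[OF a]] by blast
qed

text \<open>An a missing from one point of \<open>M\<close> is tied at no point, by
  \<open>M_symmetric_elem\<close>, so \<open>\<eta> a\<close> has full support: its absolute value
  is a weak unit of \<open>F\<close>. For empty \<open>M\<close> the support of 1 is full.\<close>

lemma M_supports: "M \<in> supports"
proof (cases "M = {}")
  case True
  then have "supp \<one>\<^bsub>F\<^esub> = M" by (auto simp: supp_def neg_set_def)
  then show ?thesis by force
next
  case False
  then obtain C where C: "C \<in> M" by blast
  have "C \<subseteq> carrier G" using total_cone_M[OF C] by (simp add: total_cone_def)
  moreover have "C \<noteq> carrier G" using C by (simp add: min_layer_iff adapted_cones_def)
  ultimately obtain a where a: "a \<in> carrier G" "a \<notin> C" by blast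
  then have "\<not> (a \<in> D \<and> inv a \<in> D)" if "D \<in> M" for D
    using M_symmetric_elem[OF that _ _ C] by blast
  then have "supp (\<eta> a) = M"
    using a by (auto simp: supp_def neg_set_\<eta> simp flip: \<eta>.hom_inv)
  then show ?thesis using a by force
qed

text \<open>Induction over the generation of \<open>F\<close> from the image of \<open>G\<close> by
  lattice operations; joins and meets follow by De Morgan's laws.\<close>

lemma compl_neg_set: "x \<in> carrier F \<Longrightarrow> M - neg_set x \<in> supports"
proof -
  assume "x \<in> carrier F"
  then have "x \<in> lattice_closure F (\<eta> ` carrier G)" using carrier_F by simp
  then show ?thesis
  proof induct
    case (gen x)
    then obtain a where "a \<in> carrier G" "x = \<eta> a" by blast
    then show ?case
      using compl_neg_set_\<eta>[of a] M_supports neg_set_supports[of "\<eta> (inv a)"] by auto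
  next
    case (join x y)
    have "x \<in> carrier F" "y \<in> carrier F" using join(1,3) carrier_F by auto
    then have "M - neg_set (ljoin F x y) = (M - neg_set x) \<union> (M - neg_set y)"
      by (auto simp: neg_set_join)
    then show ?case using supports_Un join(2,4) by simp
  next
    case (meet x y)
    have "x \<in> carrier F" "y \<in> carrier F" using meet(1,3) carrier_F by auto
    then have "M - neg_set (lmeet F x y) = (M - neg_set x) \<inter> (M - neg_set y)"
      by (auto simp: neg_set_meet)
    then show ?case using supports_Int meet(2,4) by simp
  qed
qed

lemma supports_compl: "U \<in> supports \<Longrightarrow> M - U \<in> supports"
proof -
  assume "U \<in> supports"
  then obtain x where "x \<in> carrier F" "U = supp x" by blast
  moreover have "M - supp x = (M - neg_set x) \<inter> (M - neg_set (inv\<^bsub>F\<^esub> x))"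
    by (auto simp: supp_def)
  ultimately show ?thesis
    using supports_Int compl_neg_set by simp
qed

text \<open>By totality, omitting a amounts to a^-1 being strictly positive, which is a subbasic
  condition.\<close>

lemma openin_neg_set_\<eta>:
  assumes a: "a \<in> carrier G"
  shows "openin (minimal_layer V G) (neg_set (\<eta> a))"
proof -
  have "openin (preorder_space V G) {C \<in> preorders V G. inv a \<in> C \<and> inv (inv a) \<notin> C}"
    unfolding preorder_space_def using a
    by (intro topology_generated_by_Basis insertI2) blast
  moreover have "neg_set (\<eta> a) = M \<inter> {C \<in> preorders V G. inv a \<in> C \<and> inv (inv a) \<notin> C}"
  proof -
    have "inv a \<in> C" if "C \<in> M" "a \<notin> C" for C
      using that total_cone_M[OF that(1)] a by (auto simp: total_cone_def)
    then show ?thesis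
      using a by (auto simp: neg_set_\<eta> min_layer_def)
  qed
  ultimately show ?thesis
    by (simp add: minimal_layer_eq openin_subtopology_Int2)
qed

lemma openin_neg_set: "x \<in> carrier F \<Longrightarrow> openin (minimal_layer V G) (neg_set x)"
proof -
  assume "x \<in> carrier F"
  then have "x \<in> lattice_closure F (\<eta> ` carrier G)" using carrier_F by simp
  then show ?thesis
  proof induct
    case (join x y)
    then show ?case using neg_set_join[of x y] carrier_F openin_Int by simp
  next
    case (meet x y)
    then show ?case using neg_set_meet[of x y] carrier_F openin_Un by simp
  qed (use openin_neg_set_\<eta> in auto)
qed

sublocale clopen_field "minimal_layer V G" supports
proof
  show "compact_space (minimal_layer V G)" by (rule compact_space_minimal_layer)
  show "openin (minimal_layer V G) U" if "U \<in> supports" for U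
    using that openin_neg_set by (auto simp: supp_def intro!: openin_Un)
  fix C D assume "C \<in> topspace (minimal_layer V G)" "D \<in> topspace (minimal_layer V G)" "C \<noteq> D"
  then have CD: "C \<in> M" "D \<in> M" "C \<noteq> D" by (simp_all add: topspace_minimal_layer)
  \<comment> \<open>Distinct minimal elements are incomparable, so either order of the pair can be
    separated by an element of \<open>G\<close>.\<close>
  then have "\<not> D \<subseteq> C" by (auto simp: min_layer_adapted)
  then obtain a where a: "a \<in> D" "a \<notin> C" by blast
  then have "a \<in> carrier G" using total_cone_M[OF CD(2)] by (auto simp: total_cone_def)
  then show "\<exists>U\<in>supports. C \<in> U \<and> D \<notin> U"
    using neg_set_supports[of "\<eta> a"] a CD by (intro bexI[of _ "neg_set (\<eta> a)"]) (auto simp: neg_set_\<eta>)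
qed (use M_supports supports_Un supports_compl in \<open>simp_all add: topspace_minimal_layer\<close>)

section \<open>Principal polars as supports\<close>

lemma polar_eq_supp:
  "S \<subseteq> carrier F \<Longrightarrow> polar F S = {z \<in> carrier F. \<forall>y\<in>S. supp z \<inter> supp y = {}}"
  unfolding polar_def
  by (intro Collect_cong conj_cong ball_cong refl) (use labs_meet_eq_one_iff in blast)

text \<open>The complement of \<open>supp x\<close> is itself the support of some x'. This x' lies
  in the polar of x, and being orthogonal to x' means having support inside
  \<open>supp x\<close>.\<close>

lemma double_polar:
  assumes x: "x \<in> carrier F"
  shows "polar F (polar F {x}) = {y \<in> carrier F. supp y \<subseteq> supp x}"
proof -
  have px: "polar F {x} = {y \<in> carrier F. supp y \<inter> supp x = {}}"
    using x polar_eq_supp[of "{x}"] by simp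
  obtain x' where x': "x' \<in> carrier F" "supp x' = M - supp x"
    using supports_compl[of "supp x"] x by force
  have sub: "supp y \<subseteq> M" for y by (auto simp: supp_def neg_set_def)
  have "polar F (polar F {x}) = {z \<in> carrier F. \<forall>y\<in>carrier F. supp y \<inter> supp x = {} \<longrightarrow> supp z \<inter> supp y = {}}"
    unfolding px by (subst polar_eq_supp) auto
  also have "\<dots> = {y \<in> carrier F. supp y \<subseteq> supp x}"
  proof (intro equalityI subsetI)
    fix z assume "z \<in> {z \<in> carrier F. \<forall>y\<in>carrier F. supp y \<inter> supp x = {} \<longrightarrow> supp z \<inter> supp y = {}}"
    then have z: "z \<in> carrier F" "supp z \<inter> supp x' = {}" using x' by auto
    then show "z \<in> {y \<in> carrier F. supp y \<subseteq> supp x}" using x' sub[of z] by auto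
  qed auto
  finally show ?thesis .
qed

text \<open>A union over all members recovers the support of a generator from its principal polar
  without choosing the generator.\<close>

definition polar_supp :: "'f set \<Rightarrow> 'g set set" where
  "polar_supp T = \<Union>(supp ` T)"

lemma polar_supp: "x \<in> carrier F \<Longrightarrow> polar_supp (polar F (polar F {x})) = supp x"
  by (auto simp: polar_supp_def double_polar)

lemma carrier_principal_polars:
  "carrier (principal_polars F) = (\<lambda>x. polar F (polar F {x})) ` carrier F"
  by (auto simp: principal_polars_def)

sublocale clopen_representation "minimal_layer V G" supports "principal_polars F" polar_supp
proof
  show "eq (principal_polars F) = (=)" by (simp add: principal_polars_def)
  show "polar_supp ` carrier (principal_polars F) = supports"
    by (auto simp: carrier_principal_polars polar_supp image_image)
  show "inj_on polar_supp (carrier (principal_polars F))"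
  proof (rule inj_onI)
    fix S T assume "S \<in> carrier (principal_polars F)" "T \<in> carrier (principal_polars F)"
      "polar_supp S = polar_supp T"
    then obtain x y where "x \<in> carrier F" "y \<in> carrier F" "supp x = supp y"
      "S = polar F (polar F {x})" "T = polar F (polar F {y})"
      by (auto simp: carrier_principal_polars polar_supp)
    then show "S = T" by (simp add: double_polar)
  qed
  show "S \<sqsubseteq>\<^bsub>principal_polars F\<^esub> T \<longleftrightarrow> polar_supp S \<subseteq> polar_supp T"
    if "S \<in> carrier (principal_polars F)" "T \<in> carrier (principal_polars F)" for S T
    using that
    by (auto simp: carrier_principal_polars polar_supp) (auto simp: principal_polars_def double_polar)
qed

end

theorem theorem7p3:
  fixes V :: lgroup_variety
    and G :: "'g po_group"
    and F :: "'f po_group"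
    and \<eta> :: "'g \<Rightarrow> 'f"
  assumes "po_group G"
    and "free_lgroup_over V G F \<eta>"
  shows "stone_space (minimal_layer V G) \<and>
    boolean_lattice (principal_polars F) \<and>
    minimal_layer V G homeomorphic_space prime_ideal_space (principal_polars F)"
proof -
  interpret free_lgrp V G F \<eta>
    using assms by unfold_locales
  show ?thesis
    using stone_space boolean_lattice homeomorphic_prime_ideal_space by blast
qed

end
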